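(* For all $\mu\in\mathcal M(\mathbb R_+)$ and all $\eta>0$ we have $$\forall t\ge0,\qquad\|\mu M_t-(\mu\mathbf 1)\mu_\infty\|_{TV}\le e^{-\alpha(t-t_0)}\|\mu-(\mu\mathbf 1)\mu_\infty\|_{TV},$$ where $t_0=a_*+\eta$, $c=\eta\,\beta_{\min}\,e^{-\beta_{\max}(a_*+\eta)}$, and $\alpha=\frac{-\log(1-c)}{t_0}$.
   Context: Notation: $\mathbb R_+=[0,\infty)$; $\mathcal M(\mathbb R_+)$ is the set of finite signed Borel measures on $\mathbb R_+$; for $\mu\in\mathcal M(\mathbb R_+)$ with Jordan decomposition $\mu=\mu_+-\mu_-$, the total variation norm is $\|\mu\|_{TV}=\mu_+(\mathbb R_+)+\mu_-(\mathbb R_+)$; $C_b(\mathbb R_+)$ is the space of bounded continuous functions with the sup norm, and $C_b(\mathbb R_+\times\mathbb R_+)$ is defined similarly; $C_0(\mathbb R_+)$ is the space of continuous functions on $\mathbb R_+$ tending to $0$ at infinity. For $\mu\in\mathcal M(\mathbb R_+)$ and $f\in C_b(\mathbb R_+)$ write $\mu f=\int_{\mathbb R_+}f\,d\mu$; $\mathbf 1$ is the constant function equal to $1$, so $\mu\mathbf 1=\mu(\mathbb R_+)$. Standing assumption: $\beta:\mathbb R_+\to\mathbb R$ is continuous and $a_*,\beta_{\min},\beta_{\max}>0$ are constants such that $\beta_{\min}\mathbf 1_{[a_*,\infty)}(a)\le\beta(a)\le\beta_{\max}$ for all $a\ge0$. Renewal semigroup: for $f_0\in C_b(\mathbb R_+)$,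 there is a unique $f\in C_b(\mathbb R_+\times\mathbb R_+)$ satisfying, for all $t,a\ge0$, $$f(t,a)=f_0(a+t)e^{-\int_0^t\beta(a+u)\,du}+\int_0^te^{-\int_0^\tau\beta(a+u)\,du}\beta(a+\tau)f(t-\tau,0)\,d\tau,$$ and one sets $M_tf_0=f(t,\cdot)\in C_b(\mathbb R_+)$. For $\mu\in\mathcal M(\mathbb R_+)$ and $t\ge0$, $\mu M_t\in\mathcal M(\mathbb R_+)$ is the unique measure (given by the Riesz representation theorem $\mathcal M(\mathbb R_+)=C_0(\mathbb R_+)'$) such that $\int_{\mathbb R_+}f\,d(\mu M_t)=\int_{\mathbb R_+}M_tf\,d\mu$ for all $f\in C_0(\mathbb R_+)$. Invariant measure: $\mu_\infty$ is the probability measure on $\mathbb R_+$ with Lebesgue density $N(a)=N(0)\,e^{-\int_0^a\beta(u)\,du}$, where $N(0)>0$ is chosen so that $\int_0^\infty N(a)\,da=1$. It is the unique probability measure such that $\mu_\infty M_t=\mu_\infty$ for all $t\ge 0$. *)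

theory Defs
  imports "HOL-Analysis.Analysis"
begin

text \<open>The measurable space \<open>[0,\<infinity>)\<close> with its Borel sets. Functions on \<open>[0,\<infinity>)\<close> are modelled by functions
  on \<^typ>\<open>real\<close> of which only the values on \<open>{0..}\<close> are relevant.\<close>

definition borel_nonneg :: "real measure" where
  "borel_nonneg = restrict_space borel {0..}"

text \<open>Only the space and the \<open>\<sigma>\<close>-algebra of \<open>M\<close> matter below. As for the type
  \<^typ>\<open>'a measure\<close>, a signed measure takes the value \<open>0\<close> outside the \<open>\<sigma>\<close>-algebra, so that two signed
  measures are equal as soon as they agree on measurable sets.\<close>

definition signed_measures :: "'a measure \<Rightarrow> ('a set \<Rightarrow> real) set" where
  "signed_measures M = {\<mu>. \<mu> {} = 0 \<and>
     (\<forall>A :: nat \<Rightarrow> 'a set. range A \<subseteq> sets M \<longrightarrow> disjoint_family A \<longrightarrow>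
        (\<lambda>i. \<mu> (A i)) sums \<mu> (\<Union>i. A i)) \<and>
     (\<forall>A. A \<notin> sets M \<longrightarrow> \<mu> A = 0)}"

definition jordan_decomposition ::
    "'a measure \<Rightarrow> ('a set \<Rightarrow> real) \<Rightarrow> 'a measure \<Rightarrow> 'a measure \<Rightarrow> bool" where
  "jordan_decomposition M \<mu> P N \<longleftrightarrow>
     finite_measure P \<and> finite_measure N \<and> sets P = sets M \<and> sets N = sets M \<and>
     (\<exists>D\<in>sets M. emeasure P (space M - D) = 0 \<and> emeasure N D = 0) \<and>
     (\<forall>A\<in>sets M. \<mu> A = measure P A - measure N A)"

definition pos_part :: "'a measure \<Rightarrow> ('a set \<Rightarrow> real) \<Rightarrow> 'a measure" where
  "pos_part M \<mu> = (THE P. \<exists>N. jordan_decomposition M \<mu> P N)"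

definition neg_part :: "'a measure \<Rightarrow> ('a set \<Rightarrow> real) \<Rightarrow> 'a measure" where
  "neg_part M \<mu> = (THE N. \<exists>P. jordan_decomposition M \<mu> P N)"

definition tv_norm :: "'a measure \<Rightarrow> ('a set \<Rightarrow> real) \<Rightarrow> real" where
  "tv_norm M \<mu> = measure (pos_part M \<mu>) (space M) + measure (neg_part M \<mu>) (space M)"

definition signed_integral :: "'a measure \<Rightarrow> ('a set \<Rightarrow> real) \<Rightarrow> ('a \<Rightarrow> real) \<Rightarrow> real" where
  "signed_integral M \<mu> f = (\<integral>x. f x \<partial>pos_part M \<mu>) - (\<integral>x. f x \<partial>neg_part M \<mu>)"

definition C0_nonneg :: "(real \<Rightarrow> real) set" where
  "C0_nonneg = {f. continuous_on {0..} f \<and> (f \<longlongrightarrow> 0) at_top}"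

text \<open>Membership in \<^const>\<open>extensional\<close> fixes the irrelevant values outside the quadrant, so that the
  solution is unique as a function on \<^typ>\<open>real \<times> real\<close>.\<close>

definition renewal_solution ::
    "(real \<Rightarrow> real) \<Rightarrow> (real \<Rightarrow> real) \<Rightarrow> (real \<times> real \<Rightarrow> real) \<Rightarrow> bool" where
  "renewal_solution \<beta> f0 f \<longleftrightarrow>
     f \<in> extensional ({0..} \<times> {0..}) \<and>
     continuous_on ({0..} \<times> {0..}) f \<and> bounded (f ` ({0..} \<times> {0..})) \<and>
     (\<forall>t\<ge>0. \<forall>a\<ge>0.
        f (t, a) = f0 (a + t) * exp (- integral {0..t} (\<lambda>u. \<beta> (a + u)))
          + integral {0..t} (\<lambda>\<tau>. exp (- integral {0..\<tau>} (\<lambda>u. \<beta> (a + u))) * \<beta> (a + \<tau>) * f (t - \<tau>, 0)))"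

definition renewal_semigroup ::
    "(real \<Rightarrow> real) \<Rightarrow> real \<Rightarrow> (real \<Rightarrow> real) \<Rightarrow> real \<Rightarrow> real" where
  "renewal_semigroup \<beta> t f0 = (\<lambda>a. (THE f. renewal_solution \<beta> f0 f) (t, a))"

definition dual_semigroup ::
    "(real \<Rightarrow> real) \<Rightarrow> (real set \<Rightarrow> real) \<Rightarrow> real \<Rightarrow> real set \<Rightarrow> real" where
  "dual_semigroup \<beta> \<mu> t = (THE \<nu>. \<nu> \<in> signed_measures borel_nonneg \<and>
     (\<forall>f\<in>C0_nonneg. signed_integral borel_nonneg \<nu> f
        = signed_integral borel_nonneg \<mu> (renewal_semigroup \<beta> t f)))"

definition stationary_constant :: "(real \<Rightarrow> real) \<Rightarrow> real" where
  "stationary_constant \<beta> =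
     (THE N0. N0 > 0 \<and> ((\<lambda>a. N0 * exp (- integral {0..a} \<beta>)) has_integral 1) {0..})"

definition invariant_measure :: "(real \<Rightarrow> real) \<Rightarrow> real measure" where
  "invariant_measure \<beta> = density (restrict_space lborel {0..})
     (\<lambda>a. ennreal (stationary_constant \<beta> * exp (- integral {0..a} \<beta>)))"

end

theory Submission
  imports Defs
begin

text \<open>Let \<open>S\<close> be the survival function \<open>exp (- \<integral> \<beta>)\<close>. The boundary trace \<open>\<Phi> f = f(\<cdot>, 0)\<close> solves a
  Volterra equation that is a contraction on every \<open>[0, T]\<close>; this makes sense for bounded measurable
  \<open>f\<close> and defines a positive conservative semigroup \<open>U f t\<close>, continuous along increasing sequences,
  that extends \<open>M\<^sub>t\<close>. Hence \<open>\<mu> M\<^sub>t\<close> is the set function \<open>A \<mapsto> \<integral> U 1\<^sub>A t d\<mu>\<close>, without any appeal to the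
  Riesz theorem. During the time \<open>t0 = a_star + \<eta>\<close> every individual reproduces at rate at least
  \<open>\<beta>_min\<close> in the window \<open>[a_star, t0]\<close>, so \<open>U f t0 \<ge> c m(f)\<close> for \<open>f \<ge> 0\<close>, with \<open>m\<close> the uniform
  probability on \<open>[0, \<eta>]\<close>. Therefore \<open>U f t0\<close> oscillates at most \<open>1 - c\<close> times as much as \<open>f\<close>, and
  by the semigroup property \<open>U 1\<^sub>D t\<close> has oscillation at most \<open>(1 - c) ^ n\<close> for \<open>n = \<lfloor>t / t0\<rfloor>\<close>. If
  \<open>\<sigma> = \<mu> - (\<mu> 1) \<mu>\<^sub>\<infinity>\<close>, then \<open>\<nu> = \<sigma> M\<^sub>t\<close> has mass \<open>0\<close>, so its total variation is \<open>2 \<nu> D\<close> for a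
  positive Hahn set \<open>D\<close>, and \<open>\<nu> D = \<integral> U 1\<^sub>D t d\<sigma>\<close> is at most that oscillation times half the total
  variation of \<open>\<sigma>\<close>.\<close>

section \<open>Bounded measurable functions\<close>

text \<open>The total variation norm is attained on a Hahn set, whose indicator is not continuous,
  whereas \<open>dual_semigroup\<close> is characterised by its action on \<open>C0_nonneg\<close>
  alone. This gap shapes the proof: the renewal equation has to be solved for bounded measurable
  data, and the result is tied back to the definitions by two uniqueness statements, one for
  continuous solutions of the equation and one for signed measures tested against
  \<open>C0_nonneg\<close>. Uniqueness of the boundary trace also supplies linearity, monotone
  limits and the semigroup law of \<open>U\<close>: in each case a guessed trace is checked to solve
  the same Volterra equation. The exponential in c comes from two survival periods, before and after
  a renewal, whose lengths add up to exactly t0. The shift by t0 in the final exponent pays for the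
  incomplete period lost in the floor of t / t0. That \<nu> is the image of \<sigma> rests on the
  invariance of \<mu>_\<infinity>, an identity for the weight \<open>S\<close> that Tonelli's
  theorem reduces to one for the boundary trace.\<close>

definition bounded_measurable :: "'a measure \<Rightarrow> ('a \<Rightarrow> real) set" where
  "bounded_measurable M = {f \<in> borel_measurable M. \<exists>C. \<forall>x\<in>space M. \<bar>f x\<bar> \<le> C}"

lemma bounded_measurableI:
  "f \<in> borel_measurable M \<Longrightarrow> (\<And>x. x \<in> space M \<Longrightarrow> \<bar>f x\<bar> \<le> C) \<Longrightarrow> f \<in> bounded_measurable M"
  by (auto simp: bounded_measurable_def)

lemma bounded_measurableD:
  assumes "f \<in> bounded_measurable M"
  shows "f \<in> borel_measurable M" "\<exists>C\<ge>0. \<forall>x\<in>space M. \<bar>f x\<bar> \<le> C"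
proof -
  show "f \<in> borel_measurable M" using assms by (auto simp: bounded_measurable_def)
  obtain C where "\<forall>x\<in>space M. \<bar>f x\<bar> \<le> C"
    using assms by (auto simp: bounded_measurable_def)
  then have "\<forall>x\<in>space M. \<bar>f x\<bar> \<le> max C 0" by (auto simp: le_max_iff_disj)
  then show "\<exists>C\<ge>0. \<forall>x\<in>space M. \<bar>f x\<bar> \<le> C" by (intro exI[of _ "max C 0"]) auto
qed

lemma bounded_measurable_indicator:
  "A \<in> sets M \<Longrightarrow> indicator A \<in> bounded_measurable M"
  by (auto intro!: bounded_measurableI[where C = 1] simp: indicator_def)

lemma bounded_measurable_const: "(\<lambda>_. k) \<in> bounded_measurable M"
  by (rule bounded_measurableI[where C = "\<bar>k\<bar>"]) auto

lemma bounded_measurable_cmult: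
  assumes "f \<in> bounded_measurable M"
  shows "(\<lambda>x. k * f x) \<in> bounded_measurable M"
proof -
  obtain C where C: "C \<ge> 0" "\<forall>x\<in>space M. \<bar>f x\<bar> \<le> C"
    using bounded_measurableD(2)[OF assms] by blast
  show ?thesis
    using bounded_measurableD(1)[OF assms] C
    by (intro bounded_measurableI[where C = "\<bar>k\<bar> * C"]) (auto simp: abs_mult intro!: mult_left_mono)
qed

lemma bounded_measurable_add:
  assumes "f \<in> bounded_measurable M" "g \<in> bounded_measurable M"
  shows "(\<lambda>x. f x + g x) \<in> bounded_measurable M"
proof -
  obtain C D where "\<forall>x\<in>space M. \<bar>f x\<bar> \<le> C" "\<forall>x\<in>space M. \<bar>g x\<bar> \<le> D"
    using bounded_measurableD(2)[OF assms(1)] bounded_measurableD(2)[OF assms(2)] by blast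
  then show ?thesis
    using bounded_measurableD(1)[OF assms(1)] bounded_measurableD(1)[OF assms(2)]
    by (intro bounded_measurableI[where C = "C + D"]) (auto intro: order_trans[OF abs_triangle_ineq] add_mono)
qed

lemma bounded_measurable_diff:
  assumes "f \<in> bounded_measurable M" "g \<in> bounded_measurable M"
  shows "(\<lambda>x. f x - g x) \<in> bounded_measurable M"
  using bounded_measurable_add[OF assms(1) bounded_measurable_cmult[OF assms(2), of "-1"]] by simp

lemma (in finite_measure) integrable_bounded_measurable:
  assumes "f \<in> bounded_measurable M"
  shows "integrable M f"
proof -
  obtain C where "\<forall>x\<in>space M. \<bar>f x\<bar> \<le> C"
    using bounded_measurableD(2)[OF assms] by blast
  then show ?thesis
    using bounded_measurableD(1)[OF assms] by (intro integrable_const_bound[where B = C]) auto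
qed

text \<open>The nonnegative case is a monotone class induction; a general \<open>f\<close> is
  reduced to it by adding its bound and subtracting a constant again. The limit case supplies
  increasing, nonnegative, uniformly bounded sequences, which is the form in which both
  \<open>U\<close> and the integrals pass to the limit.\<close>

lemma bounded_measurable_induct [consumes 1, case_names cong indicator cmult add lim]:
  fixes P :: "('a \<Rightarrow> real) \<Rightarrow> bool"
  assumes f: "f \<in> bounded_measurable M"
    and cong: "\<And>u v. (\<And>x. x \<in> space M \<Longrightarrow> u x = v x) \<Longrightarrow> P u \<Longrightarrow> P v"
    and ind: "\<And>A. A \<in> sets M \<Longrightarrow> P (indicator A)"
    and cmult: "\<And>u k. u \<in> bounded_measurable M \<Longrightarrow> P u \<Longrightarrow> P (\<lambda>x. k * u x)"
    and add: "\<And>u v. u \<in> bounded_measurable M \<Longrightarrow> v \<in> bounded_measurable M \<Longrightarrow> P u \<Longrightarrow> P v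
      \<Longrightarrow> P (\<lambda>x. u x + v x)"
    and lim: "\<And>U u K. (\<And>i. U i \<in> borel_measurable M) \<Longrightarrow> u \<in> borel_measurable M
      \<Longrightarrow> (\<And>i x. x \<in> space M \<Longrightarrow> 0 \<le> U i x) \<Longrightarrow> (\<And>i x. x \<in> space M \<Longrightarrow> U i x \<le> K)
      \<Longrightarrow> incseq U \<Longrightarrow> (\<And>i. P (U i)) \<Longrightarrow> (\<And>x. x \<in> space M \<Longrightarrow> (\<lambda>i. U i x) \<longlonglongrightarrow> u x) \<Longrightarrow> P u"
  shows "P f"
proof -
  \<comment> \<open>Boundedness is part of the induction formula, because it has to be handed down
    to the scaled function, the summands and the approximating sequence.\<close>
  have nonneg: "(\<exists>C. \<forall>x\<in>space M. u x \<le> C) \<longrightarrow> P u"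
    if u: "u \<in> borel_measurable M" "\<And>x. 0 \<le> u x" for u
    using u
  proof (induction rule: borel_measurable_induct_real)
    case (set A)
    then show ?case using ind by blast
  next
    case (mult v k)
    show ?case
    proof (intro impI, elim exE)
      fix C assume C: "\<forall>x\<in>space M. k * v x \<le> C"
      show "P (\<lambda>x. k * v x)"
      proof (cases "k = 0")
        case True
        \<comment> \<open>For k = 0 the bound on the product says nothing about \<open>v\<close>, so
          the zero function is produced from the empty set.\<close>
        have "P (\<lambda>x. 0 * indicator {} x)"
          by (intro cmult ind bounded_measurable_indicator) auto
        then show ?thesis using True by simp
      next
        case False
        with mult.hyps have k: "k > 0" by simp
        have b: "v x \<le> C / k" if "x \<in> space M" for x
          using C that k by (auto simp: field_simps)
        then have "P v" using mult.IH by blast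
        moreover have "v \<in> bounded_measurable M"
          using b mult.hyps by (intro bounded_measurableI[where C = "C / k"]) auto
        ultimately show ?thesis by (rule cmult[rotated])
      qed
    qed
  next
    case (add v w)
    show ?case
    proof (intro impI, elim exE)
      fix C assume C: "\<forall>x\<in>space M. w x + v x \<le> C"
      have b: "v x \<le> C" "w x \<le> C" if "x \<in> space M" for x
        using C that add.hyps(2)[of x] add.hyps(4)[of x] by (auto dest!: bspec[OF _ that])
      have bm: "v \<in> bounded_measurable M" "w \<in> bounded_measurable M"
        using b add.hyps by (auto intro!: bounded_measurableI[where C = C])
      show "P (\<lambda>x. w x + v x)"
        using b add.IH by (intro assms(5) bm) blast+
    qed
  next
    case (seq U)
    show ?case
    proof (intro impI, elim exE)
      fix C assume C: "\<forall>x\<in>space M. u x \<le> C"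
      have b: "U i x \<le> C" if "x \<in> space M" for i x
      proof -
        have "U i x \<le> u x"
          using seq.hyps(3) seq.hyps(4)[OF that]
          by (intro incseq_le) (auto simp: incseq_def le_fun_def)
        then show ?thesis using C that by force
      qed
      show "P u"
      proof (rule lim[of U u C])
        show "u \<in> borel_measurable M"
          using seq.hyps(1,4) by (rule borel_measurable_LIMSEQ_real[rotated])
        show "P (U i)" for i using seq.IH[of i] b by blast
      qed (use seq b in auto)
    qed
  qed
  obtain C where C: "C \<ge> 0" "\<forall>x\<in>space M. \<bar>f x\<bar> \<le> C"
    using bounded_measurableD(2)[OF f] by blast
  \<comment> \<open>\<open>nonneg\<close> asks for a function that is nonnegative everywhere, while
    \<open>f\<close> is controlled on the space only; the indicator cuts off the rest.\<close>
  let ?h = "\<lambda>x. indicator (space M) x * (f x + C)"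
  have h_meas: "?h \<in> borel_measurable M"
    using bounded_measurableD(1)[OF f] by measurable
  have h_nonneg: "0 \<le> ?h x" for x
    using C by (auto simp: indicator_def abs_le_iff)
  have h_le: "?h x \<le> 2 * C" if "x \<in> space M" for x
    using C that by (auto simp: indicator_def abs_le_iff)
  have "P ?h"
    using nonneg[OF h_meas h_nonneg] h_le by blast
  moreover have "?h \<in> bounded_measurable M"
    using h_meas h_nonneg h_le by (intro bounded_measurableI[where C = "2 * C"]) (simp_all only: abs_of_nonneg)
  moreover have "P (\<lambda>x. - C * indicator (space M) x)"
    by (intro cmult ind bounded_measurable_indicator) auto
  moreover have "(\<lambda>x. - C * indicator (space M) x) \<in> bounded_measurable M"
    by (intro bounded_measurable_cmult bounded_measurable_indicator) auto
  ultimately have "P (\<lambda>x. ?h x + - C * indicator (space M) x)"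
    by (intro add)
  then show "P f" by (rule cong[rotated]) (auto simp: indicator_def)
qed

lemma finite_measure_of_real:
  fixes m :: "'a set \<Rightarrow> real"
  assumes empty: "m {} = 0" and nonneg: "\<And>A. A \<in> sets M \<Longrightarrow> 0 \<le> m A"
    and sums: "\<And>A :: nat \<Rightarrow> 'a set. range A \<subseteq> sets M \<Longrightarrow> disjoint_family A
      \<Longrightarrow> (\<lambda>i. m (A i)) sums m (\<Union>i. A i)"
  obtains P where "finite_measure P" "sets P = sets M" "\<And>A. A \<in> sets M \<Longrightarrow> measure P A = m A"
proof -
  define P where "P = measure_of (space M) (sets M) (\<lambda>A. ennreal (m A))"
  have sets: "sets P = sets M" unfolding P_def by simp
  have em: "emeasure P A = ennreal (m A)" if "A \<in> sets M" for A
    unfolding P_def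
  proof (rule emeasure_measure_of_sigma)
    show "countably_additive (sets M) (\<lambda>A. ennreal (m A))"
    proof (rule countably_additiveI)
      fix A :: "nat \<Rightarrow> 'a set"
      assume A: "range A \<subseteq> sets M" "disjoint_family A"
      have "(\<lambda>i. ennreal (m (A i))) sums ennreal (m (\<Union>i. A i))"
        using sums[OF A] nonneg A by (subst sums_ennreal) (auto intro!: nonneg)
      then show "(\<Sum>i. ennreal (m (A i))) = ennreal (m (\<Union>i. A i))"
        by (rule sums_unique[symmetric])
    qed
  qed (use that in \<open>auto simp: positive_def empty sets.sigma_algebra_axioms\<close>)
  show ?thesis
  proof
    have "space P = space M" using sets by (rule sets_eq_imp_space_eq)
    then show "finite_measure P" by (intro finite_measureI) (simp add: em)
    show "sets P = sets M" by (rule sets)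
    show "measure P A = m A" if "A \<in> sets M" for A
      using that by (simp add: measure_def em nonneg)
  qed
qed

section \<open>Hahn and Jordan decompositions\<close>

lemma signed_measures_empty: "\<mu> \<in> signed_measures M \<Longrightarrow> \<mu> {} = 0"
  by (simp add: signed_measures_def)

lemma signed_measures_sums:
  "\<mu> \<in> signed_measures M \<Longrightarrow> range A \<subseteq> sets M \<Longrightarrow> disjoint_family A \<Longrightarrow>
    (\<lambda>i::nat. \<mu> (A i)) sums \<mu> (\<Union>i. A i)"
  unfolding signed_measures_def by blast

lemma signed_measures_outside: "\<mu> \<in> signed_measures M \<Longrightarrow> A \<notin> sets M \<Longrightarrow> \<mu> A = 0"
  by (simp add: signed_measures_def)

lemma signed_measures_Un:
  assumes \<mu>: "\<mu> \<in> signed_measures M" and "A \<in> sets M" "B \<in> sets M" "A \<inter> B = {}"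
  shows "\<mu> (A \<union> B) = \<mu> A + \<mu> B"
proof -
  have "(\<lambda>i. \<mu> (binaryset A B i)) sums \<mu> (\<Union>i. binaryset A B i)"
    using assms by (intro signed_measures_sums[OF \<mu>])
      (auto simp: disjoint_family_on_def binaryset_def)
  then show ?thesis
    using binaryset_sums[of \<mu> A B, OF signed_measures_empty[OF \<mu>]]
    by (simp add: UN_binaryset_eq sums_iff)
qed

lemma signed_measures_Diff:
  assumes "\<mu> \<in> signed_measures M" "A \<in> sets M" "B \<in> sets M" "B \<subseteq> A"
  shows "\<mu> (A - B) = \<mu> A - \<mu> B"
proof -
  have "(A - B) \<union> B = A" using assms by auto
  then show ?thesis
    using signed_measures_Un[of \<mu> M "A - B" B] assms by (simp add: Int_commute Diff_disjoint)
qed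

lemma signed_measures_diff_cmult:
  assumes \<mu>: "\<mu> \<in> signed_measures M" and \<nu>: "\<nu> \<in> signed_measures M"
  shows "(\<lambda>A. \<mu> A - k * \<nu> A) \<in> signed_measures M"
  using assms unfolding signed_measures_def
  by (auto intro!: sums_diff sums_mult)

lemma signed_measures_cmult:
  assumes \<mu>: "\<mu> \<in> signed_measures M"
  shows "(\<lambda>A. k * \<mu> A) \<in> signed_measures M"
  using assms unfolding signed_measures_def
  by (auto intro!: sums_mult)

lemma measure_in_signed_measures:
  assumes "finite_measure P" "sets P = sets M"
  shows "measure P \<in> signed_measures M"
  using finite_measure.finite_measure_UNION[OF assms(1)] assms(2)
  unfolding signed_measures_def by (auto simp: measure_notin_sets)

text \<open>Greedy exhaustion: each \<open>B n\<close> is a member of \<open>\<C>\<close> inside what is left, with at least half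
  of the mass (capped at \<open>1\<close>) that such a member can have. The masses are summable, so nothing of
  positive mass remains in the limit.\<close>

lemma signed_measures_exhaust:
  assumes \<mu>: "\<mu> \<in> signed_measures M" and C: "{} \<in> \<C>" "\<C> \<subseteq> sets M" and D: "D \<in> sets M"
  obtains B :: "nat \<Rightarrow> 'a set" where "disjoint_family B"
    "\<And>n. B n \<in> \<C>" "\<And>n. B n \<subseteq> D" "\<And>n. 0 \<le> \<mu> (B n)"
    "\<And>C. C \<in> \<C> \<Longrightarrow> C \<subseteq> D - (\<Union>n. B n) \<Longrightarrow> \<mu> C \<le> 0"
proof -
  have ex: "\<exists>B\<in>\<C>. B \<subseteq> E \<and> (\<forall>C\<in>\<C>. C \<subseteq> E \<longrightarrow> min 1 (\<mu> C / 2) \<le> \<mu> B)" for E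
  proof (cases "\<exists>B\<in>\<C>. B \<subseteq> E \<and> 1 \<le> \<mu> B")
    case True
    then show ?thesis by (meson min.coboundedI1)
  next
    case False
    \<comment> \<open>Without a member of mass at least 1 the masses inside \<open>E\<close> are
      bounded, so the supremum exists and some member reaches half of it.\<close>
    let ?S = "\<mu> ` {C \<in> \<C>. C \<subseteq> E}"
    have bdd: "bdd_above ?S"
      using False by (intro bdd_aboveI[of _ 1]) (auto simp: not_le less_imp_le)
    have ne: "0 \<in> ?S" using C signed_measures_empty[OF \<mu>] by force
    have le: "\<mu> C \<le> Sup ?S" if "C \<in> \<C>" "C \<subseteq> E" for C
      using that by (intro cSup_upper bdd) auto
    have nonneg: "0 \<le> Sup ?S" using ne by (intro cSup_upper bdd)
    have "\<exists>s\<in>?S. Sup ?S / 2 \<le> s"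
    proof (cases "Sup ?S = 0")
      case True
      then show ?thesis using ne by (intro bexI[of _ 0]) auto
    next
      case False
      then have "Sup ?S / 2 < Sup ?S" using nonneg by simp
      then have "\<exists>s\<in>?S. Sup ?S / 2 < s" by (rule less_cSupD[rotated]) (use ne in auto)
      then show ?thesis by (meson less_imp_le)
    qed
    then obtain B where B: "B \<in> \<C>" "B \<subseteq> E" "Sup ?S / 2 \<le> \<mu> B" by blast
    have "min 1 (\<mu> C / 2) \<le> \<mu> B" if "C \<in> \<C>" "C \<subseteq> E" for C
      using le[OF that] B(3) by linarith
    then show ?thesis using B by blast
  qed
  then obtain b where b: "\<And>E. b E \<in> \<C>" "\<And>E. b E \<subseteq> E"
    "\<And>E C. C \<in> \<C> \<Longrightarrow> C \<subseteq> E \<Longrightarrow> min 1 (\<mu> C / 2) \<le> \<mu> (b E)"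
    by metis
  define E where "E = rec_nat D (\<lambda>_ E. E - b E)"
  have E: "E 0 = D" "\<And>n. E (Suc n) = E n - b (E n)" by (simp_all add: E_def)
  define B where "B n = b (E n)" for n
  have dec: "E n \<subseteq> E m" if "m \<le> n" for m n
    using that by (induction rule: dec_induct) (auto simp: E)
  have BE: "B n \<subseteq> E n" for n using b by (simp add: B_def)
  have disj1: "B m \<inter> B n = {}" if "m < n" for m n
    using dec[of "Suc m" n] that BE[of n] by (auto simp: E B_def)
  have disj: "disjoint_family B"
    unfolding disjoint_family_on_def
    by (metis disj1 Int_commute linorder_neqE_nat)
  have BC: "B n \<in> \<C>" for n using b by (simp add: B_def)
  have nonneg: "0 \<le> \<mu> (B n)" for n
    using b(3)[OF C(1), of "E n"] signed_measures_empty[OF \<mu>] by (simp add: B_def)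
  have "summable (\<lambda>n. \<mu> (B n))"
    using signed_measures_sums[OF \<mu> _ disj] BC C(2) by (auto simp: sums_iff)
  then have to0: "(\<lambda>n. \<mu> (B n)) \<longlonglongrightarrow> 0" by (rule summable_LIMSEQ_zero)
  show ?thesis
  proof (rule that[OF disj BC _ nonneg])
    show "B n \<subseteq> D" for n using BE[of n] dec[of 0 n] E by auto
    fix C assume C': "C \<in> \<C>" "C \<subseteq> D - (\<Union>n. B n)"
    have "C \<subseteq> E n" for n
      using C'(2) by (induction n) (auto simp: E B_def)
    then have "min 1 (\<mu> C / 2) \<le> \<mu> (B n)" for n
      using b(3)[OF C'(1)] by (simp add: B_def)
    then have "min 1 (\<mu> C / 2) \<le> 0"
      using to0 by (intro LIMSEQ_le_const) auto
    then show "\<mu> C \<le> 0" by (auto simp: min_def split: if_splits)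
  qed
qed

lemma signed_measures_UN_nonpos:
  assumes \<mu>: "\<mu> \<in> signed_measures M" and "disjoint_family B" "\<And>n::nat. B n \<in> sets M"
    and neg: "\<And>n C. C \<in> sets M \<Longrightarrow> C \<subseteq> B n \<Longrightarrow> \<mu> C \<le> 0"
    and C: "C \<in> sets M" "C \<subseteq> (\<Union>n. B n)"
  shows "\<mu> C \<le> 0"
proof -
  have "(\<lambda>n. \<mu> (C \<inter> B n)) sums \<mu> (\<Union>n. C \<inter> B n)"
    using assms by (intro signed_measures_sums[OF \<mu>]) (auto simp: disjoint_family_on_def)
  moreover have "(\<Union>n. C \<inter> B n) = C" using C by auto
  ultimately have "(\<lambda>n. \<mu> (C \<inter> B n)) sums \<mu> C" by simp
  moreover have "\<mu> (C \<inter> B n) \<le> 0" for n using assms by (intro neg) auto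
  ultimately show ?thesis using sums_le[of "\<lambda>n. \<mu> (C \<inter> B n)" "\<lambda>_. 0"] by simp
qed

text \<open>Exhaustion over all measurable sets removes disjoint pieces of nonnegative mass from
  \<open>D\<close>, which can only lower its mass. What is left has no measurable subset of positive
  mass.\<close>

lemma signed_measures_nonpos_subset:
  assumes \<mu>: "\<mu> \<in> signed_measures M" and D: "D \<in> sets M"
  obtains N where "N \<in> sets M" "N \<subseteq> D" "\<mu> N \<le> \<mu> D" "\<And>C. C \<in> sets M \<Longrightarrow> C \<subseteq> N \<Longrightarrow> \<mu> C \<le> 0"
proof -
  obtain B :: "nat \<Rightarrow> 'a set" where B: "disjoint_family B" "\<And>n. B n \<in> sets M" "\<And>n. B n \<subseteq> D"
    "\<And>n. 0 \<le> \<mu> (B n)" "\<And>C. C \<in> sets M \<Longrightarrow> C \<subseteq> D - (\<Union>n. B n) \<Longrightarrow> \<mu> C \<le> 0"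
    using signed_measures_exhaust[OF \<mu> _ _ D, of "sets M"] by blast
  have "(\<lambda>n. \<mu> (B n)) sums \<mu> (\<Union>n. B n)"
    using B by (intro signed_measures_sums[OF \<mu>]) auto
  then have "0 \<le> \<mu> (\<Union>n. B n)"
    using B(4) sums_le[of "\<lambda>_. 0" "\<lambda>n. \<mu> (B n)"] by simp
  then have "\<mu> (D - (\<Union>n. B n)) \<le> \<mu> D"
    using B by (subst signed_measures_Diff[OF \<mu>]) (auto simp: D)
  then show ?thesis
    using B D by (intro that[of "D - (\<Union>n. B n)"]) auto
qed

text \<open>The negative set is exhausted by totally nonpositive sets, with - \<mu> as the mass. If
  a set \<open>A\<close> disjoint from their union had negative mass,
  \<open>signed_measures_nonpos_subset\<close> would place in it a totally nonpositive
  \<open>N\<close> with \<mu> N \<le> \<mu> A < 0, and the exhaustion leaves no such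
  \<open>N\<close>.\<close>

lemma signed_measures_Hahn:
  assumes \<mu>: "\<mu> \<in> signed_measures M"
  obtains D where "D \<in> sets M" "\<And>A. A \<in> sets M \<Longrightarrow> A \<subseteq> D \<Longrightarrow> 0 \<le> \<mu> A"
    "\<And>A. A \<in> sets M \<Longrightarrow> A \<subseteq> space M - D \<Longrightarrow> \<mu> A \<le> 0"
proof -
  define \<N> where "\<N> = {N \<in> sets M. \<forall>C\<in>sets M. C \<subseteq> N \<longrightarrow> \<mu> C \<le> 0}"
  have \<mu>': "(\<lambda>A. - 1 * \<mu> A) \<in> signed_measures M" by (rule signed_measures_cmult[OF \<mu>])
  obtain B :: "nat \<Rightarrow> 'a set" where B: "disjoint_family B" "\<And>n. B n \<in> \<N>" "\<And>n. B n \<subseteq> space M"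
    "\<And>C. C \<in> \<N> \<Longrightarrow> C \<subseteq> space M - (\<Union>n. B n) \<Longrightarrow> - 1 * \<mu> C \<le> 0"
    by (rule signed_measures_exhaust[OF \<mu>', of \<N> "space M"])
      (auto simp: \<N>_def signed_measures_empty[OF \<mu>])
  have Bm: "B n \<in> sets M" for n using B(2) by (auto simp: \<N>_def)
  show ?thesis
  proof (rule that[of "space M - (\<Union>n. B n)"])
    show "space M - (\<Union>n. B n) \<in> sets M" using Bm by auto
    fix A assume A: "A \<in> sets M"
    show "0 \<le> \<mu> A" if sub: "A \<subseteq> space M - (\<Union>n. B n)"
    proof -
      obtain N where N: "N \<in> sets M" "N \<subseteq> A" "\<mu> N \<le> \<mu> A"
        "\<And>C. C \<in> sets M \<Longrightarrow> C \<subseteq> N \<Longrightarrow> \<mu> C \<le> 0"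
        using signed_measures_nonpos_subset[OF \<mu> A] by blast
      have "N \<in> \<N>" using N by (auto simp: \<N>_def)
      with B(4)[of N] N sub have "0 \<le> \<mu> N" by (simp add: subset_trans)
      with N(3) show ?thesis by simp
    qed
    show "\<mu> A \<le> 0" if "A \<subseteq> space M - (space M - (\<Union>n. B n))"
      by (rule signed_measures_UN_nonpos[OF \<mu> B(1) Bm _ A]) (use B(2) that in \<open>auto simp: \<N>_def\<close>)
  qed
qed

lemma jordan_decomposition_exists:
  assumes \<mu>: "\<mu> \<in> signed_measures M"
  obtains P N where "jordan_decomposition M \<mu> P N"
proof -
  obtain D where D: "D \<in> sets M" "\<And>A. A \<in> sets M \<Longrightarrow> A \<subseteq> D \<Longrightarrow> 0 \<le> \<mu> A"
    "\<And>A. A \<in> sets M \<Longrightarrow> A \<subseteq> space M - D \<Longrightarrow> \<mu> A \<le> 0"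
    using signed_measures_Hahn[OF \<mu>] by blast
  have sums: "(\<lambda>i. \<mu> (A i \<inter> E)) sums \<mu> ((\<Union>i. A i) \<inter> E)"
    if "range A \<subseteq> sets M" "disjoint_family A" "E \<in> sets M" for A :: "nat \<Rightarrow> 'a set" and E
    using signed_measures_sums[OF \<mu>, of "\<lambda>i. A i \<inter> E"] that
    by (auto simp: disjoint_family_on_def)
  obtain P where P: "finite_measure P" "sets P = sets M"
    "\<And>A. A \<in> sets M \<Longrightarrow> measure P A = \<mu> (A \<inter> D)"
    by (rule finite_measure_of_real[of "\<lambda>A. \<mu> (A \<inter> D)" M])
      (use D sums in \<open>auto simp: signed_measures_empty[OF \<mu>]\<close>)
  obtain N where N: "finite_measure N" "sets N = sets M"
    "\<And>A. A \<in> sets M \<Longrightarrow> measure N A = - \<mu> (A \<inter> (space M - D))"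
  proof (rule finite_measure_of_real[of "\<lambda>A. - \<mu> (A \<inter> (space M - D))" M])
    show "0 \<le> - \<mu> (A \<inter> (space M - D))" if "A \<in> sets M" for A
      using D(3)[of "A \<inter> (space M - D)"] D(1) that by auto
  qed (use D sums in \<open>auto simp: signed_measures_empty[OF \<mu>] intro!: sums_minus\<close>)
  have "jordan_decomposition M \<mu> P N"
    unfolding jordan_decomposition_def
  proof (intro conjI ballI)
    show "\<exists>D\<in>sets M. emeasure P (space M - D) = 0 \<and> emeasure N D = 0"
    proof (intro bexI[of _ D] conjI D)
      have "(space M - D) \<inter> D = {}" "D \<inter> (space M - D) = {}" by auto
      then have "measure P (space M - D) = 0" "measure N D = 0"
        using D by (auto simp: P N signed_measures_empty[OF \<mu>])
      then show "emeasure P (space M - D) = 0" "emeasure N D = 0"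
        using P N D by (auto simp: finite_measure.emeasure_eq_measure)
    qed
    fix A assume A: "A \<in> sets M"
    have "(A \<inter> D) \<union> (A \<inter> (space M - D)) = A" using sets.sets_into_space[OF A] by auto
    then show "\<mu> A = measure P A - measure N A"
      using signed_measures_Un[OF \<mu>, of "A \<inter> D" "A \<inter> (space M - D)"] A D(1)
      by (auto simp: P N)
  qed (use P N in auto)
  then show ?thesis by (rule that)
qed

text \<open>On \<open>D\<close> the part \<open>N\<close> has no mass, so there P = \<mu> \<le> P';
  off \<open>D\<close> the part \<open>P\<close> has no mass, so there N = - \<mu> \<le> N'. Used in
  both directions for two Jordan decompositions, this gives the uniqueness that the
  \<open>THE\<close> in \<open>pos_part\<close> and \<open>neg_part\<close> calls for.\<close>

lemma jordan_decomposition_minimal: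
  assumes J: "jordan_decomposition M \<mu> P N"
    and P': "finite_measure P'" "sets P' = sets M" and N': "finite_measure N'" "sets N' = sets M"
    and eq: "\<And>A. A \<in> sets M \<Longrightarrow> \<mu> A = measure P' A - measure N' A"
    and A: "A \<in> sets M"
  shows "measure P A \<le> measure P' A" "measure N A \<le> measure N' A"
proof -
  obtain D where D: "D \<in> sets M" "emeasure P (space M - D) = 0" "emeasure N D = 0"
    and fin: "finite_measure P" "finite_measure N" and sets: "sets P = sets M" "sets N = sets M"
    and mu: "\<And>A. A \<in> sets M \<Longrightarrow> \<mu> A = measure P A - measure N A"
    using J unfolding jordan_decomposition_def by blast
  interpret P: finite_measure P by (rule fin)
  interpret N: finite_measure N by (rule fin)
  interpret P': finite_measure P' by (rule P')
  interpret N': finite_measure N' by (rule N')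
  have z: "measure P (A - D) = 0" "measure N (A \<inter> D) = 0"
  proof -
    have "measure P (A - D) \<le> measure P (space M - D)"
      using D A sets sets.sets_into_space[OF A] by (intro P.finite_measure_mono) auto
    then show "measure P (A - D) = 0"
      using D by (simp add: measure_def order_antisym)
    have "measure N (A \<inter> D) \<le> measure N D"
      using D sets by (intro N.finite_measure_mono) auto
    then show "measure N (A \<inter> D) = 0"
      using D by (simp add: measure_def order_antisym)
  qed
  have mA: "A \<inter> D \<in> sets M" "A - D \<in> sets M" using A D by auto
  have "measure P A = measure P (A \<inter> D) + measure P (A - D)"
    "measure N A = measure N (A \<inter> D) + measure N (A - D)"
    using P.finite_measure_Union[of "A \<inter> D" "A - D"] N.finite_measure_Union[of "A \<inter> D" "A - D"] mA sets
    by (auto simp: Int_Diff_Un Int_Diff_disjoint)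
  moreover have "measure P (A \<inter> D) \<le> measure P' (A \<inter> D)" "measure N (A - D) \<le> measure N' (A - D)"
    using mu[OF mA(1)] eq[OF mA(1)] mu[OF mA(2)] eq[OF mA(2)] z
    by (simp_all add: measure_nonneg) (smt (verit) measure_nonneg)+
  moreover have "measure P' (A \<inter> D) \<le> measure P' A" "measure N' (A - D) \<le> measure N' A"
    using A P' N' by (auto intro!: P'.finite_measure_mono N'.finite_measure_mono)
  ultimately show "measure P A \<le> measure P' A" "measure N A \<le> measure N' A"
    using z by auto
qed

lemma jordan_decomposition_unique:
  assumes J: "jordan_decomposition M \<mu> P N" and J': "jordan_decomposition M \<mu> P' N'"
  shows "P = P'" "N = N'"
proof -
  have fin: "finite_measure P" "finite_measure N" "finite_measure P'" "finite_measure N'"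
    and sets: "sets P = sets M" "sets N = sets M" "sets P' = sets M" "sets N' = sets M"
    and mu: "\<And>A. A \<in> sets M \<Longrightarrow> \<mu> A = measure P A - measure N A"
      "\<And>A. A \<in> sets M \<Longrightarrow> \<mu> A = measure P' A - measure N' A"
    using J J' unfolding jordan_decomposition_def by blast+
  have "measure P A = measure P' A" "measure N A = measure N' A" if "A \<in> sets M" for A
    using jordan_decomposition_minimal[OF J fin(3) sets(3) fin(4) sets(4) mu(2) that]
      jordan_decomposition_minimal[OF J' fin(1) sets(1) fin(2) sets(2) mu(1) that]
    by (auto intro: order_antisym)
  then show "P = P'" "N = N'"
    using fin sets by (auto intro!: measure_eqI simp: finite_measure.emeasure_eq_measure)
qed

lemma jordan_decomposition_parts:
  assumes "\<mu> \<in> signed_measures M"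
  shows "jordan_decomposition M \<mu> (pos_part M \<mu>) (neg_part M \<mu>)"
proof -
  obtain P N where J: "jordan_decomposition M \<mu> P N"
    using jordan_decomposition_exists[OF assms] by blast
  have "pos_part M \<mu> = P" "neg_part M \<mu> = N"
    unfolding pos_part_def neg_part_def
    using J jordan_decomposition_unique by (blast intro!: the_equality)+
  then show ?thesis using J by simp
qed

lemma finite_measure_integral_eq:
  assumes fin: "finite_measure P" "finite_measure N" "finite_measure P'" "finite_measure N'"
    and sets: "sets P = sets M" "sets N = sets M" "sets P' = sets M" "sets N' = sets M"
    and eq: "\<And>A. A \<in> sets M \<Longrightarrow> measure P A - measure N A = measure P' A - measure N' A"
    and f: "f \<in> bounded_measurable M"
  shows "(\<integral>x. f x \<partial>P) - (\<integral>x. f x \<partial>N) = (\<integral>x. f x \<partial>P') - (\<integral>x. f x \<partial>N')"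
  using f
proof (induction rule: bounded_measurable_induct)
  case (cong u v)
  have "(\<integral>x. u x \<partial>Q) = (\<integral>x. v x \<partial>Q)" if "sets Q = sets M" for Q
    using cong sets_eq_imp_space_eq[OF that] by (intro Bochner_Integration.integral_cong) auto
  then show ?case using cong sets by simp
next
  case (indicator A)
  then show ?case
    using eq[OF indicator] sets sets.sets_into_space[OF indicator] sets[THEN sets_eq_imp_space_eq]
    by (simp add: Int_absorb2)
next
  case (cmult u k)
  then show ?case by (simp add: right_diff_distrib[symmetric])
next
  case (add u v)
  have int: "integrable Q u" "integrable Q v" if "finite_measure Q" "sets Q = sets M" for Q
  proof -
    have "bounded_measurable Q = bounded_measurable M"
      using that sets_eq_imp_space_eq[OF that(2)] measurable_cong_sets[OF that(2) refl]
      by (auto simp: bounded_measurable_def)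
    then show "integrable Q u" "integrable Q v"
      using add that by (auto intro!: finite_measure.integrable_bounded_measurable)
  qed
  show ?case using add.IH int fin sets by simp
next
  case (lim U u K)
  have conv: "(\<lambda>i. \<integral>x. U i x \<partial>Q) \<longlonglongrightarrow> (\<integral>x. u x \<partial>Q)" if Q: "finite_measure Q" "sets Q = sets M" for Q
  proof (rule integral_dominated_convergence[where w = "\<lambda>_. K"])
    interpret Q: finite_measure Q by (rule Q)
    show "integrable Q (\<lambda>_. K)" by simp
  qed (use lim Q sets_eq_imp_space_eq[OF Q(2)] measurable_cong_sets[OF Q(2) refl] in auto)
  have "(\<lambda>i. (\<integral>x. U i x \<partial>P) - (\<integral>x. U i x \<partial>N)) \<longlonglongrightarrow> (\<integral>x. u x \<partial>P) - (\<integral>x. u x \<partial>N)"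
    by (intro tendsto_diff conv fin sets)
  moreover have "(\<lambda>i. (\<integral>x. U i x \<partial>P) - (\<integral>x. U i x \<partial>N)) \<longlonglongrightarrow> (\<integral>x. u x \<partial>P') - (\<integral>x. u x \<partial>N')"
    unfolding lim.IH by (intro tendsto_diff conv fin sets)
  ultimately show ?case by (rule LIMSEQ_unique)
qed

text \<open>The images of the two Jordan parts under the dual semigroup need not be mutually
  singular. Integrals against their difference can nevertheless be computed with this pair, since
  any representation as a difference of finite measures gives the same value.\<close>

lemma signed_integral_eq:
  assumes \<mu>: "\<mu> \<in> signed_measures M"
    and fin: "finite_measure P" "finite_measure N" and sets: "sets P = sets M" "sets N = sets M"
    and eq: "\<And>A. A \<in> sets M \<Longrightarrow> \<mu> A = measure P A - measure N A"
    and f: "f \<in> bounded_measurable M"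
  shows "signed_integral M \<mu> f = (\<integral>x. f x \<partial>P) - (\<integral>x. f x \<partial>N)"
proof -
  have J: "finite_measure (pos_part M \<mu>)" "finite_measure (neg_part M \<mu>)"
    "sets (pos_part M \<mu>) = sets M" "sets (neg_part M \<mu>) = sets M"
    "\<And>A. A \<in> sets M \<Longrightarrow> \<mu> A = measure (pos_part M \<mu>) A - measure (neg_part M \<mu>) A"
    using jordan_decomposition_parts[OF \<mu>] unfolding jordan_decomposition_def by blast+
  show ?thesis
    unfolding signed_integral_def
    by (rule finite_measure_integral_eq[OF J(1,2) fin J(3,4) sets _ f]) (metis J(5) eq)
qed

section \<open>The renewal equation\<close>

text \<open>Continuity on the whole line gives the primitive of \<open>\<beta>\<close> a two-sided
  derivative at every point, including 0. The theorem enters this setting with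
  \<open>\<beta>\<close> extended to the left by its value at 0.\<close>

locale renewal =
  fixes \<beta> :: "real \<Rightarrow> real" and \<beta>_max :: real
  assumes cont_\<beta>: "continuous_on UNIV \<beta>"
    and \<beta>_nonneg: "0 \<le> \<beta> a" and \<beta>_le: "\<beta> a \<le> \<beta>_max"
begin

text \<open>The second integral makes \<open>H\<close> an antiderivative of \<open>\<beta>\<close> on the whole line.\<close>

definition H :: "real \<Rightarrow> real" where
  "H x = integral {0..x} \<beta> - integral {x..0} \<beta>"

definition S :: "real \<Rightarrow> real" where
  "S x = exp (- H x)"

text \<open>This is - S', the density of the age at which a newborn is first renewed. Being an exact
  derivative, it makes integrals of the kernel telescope.\<close>

definition \<psi> :: "real \<Rightarrow> real" where
  "\<psi> x = \<beta> x * S x"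

lemma \<beta>_max_nonneg: "0 \<le> \<beta>_max"
  using \<beta>_nonneg \<beta>_le order_trans by blast

lemma \<beta>_integrable: "\<beta> integrable_on {a..b}"
  by (intro integrable_continuous_interval continuous_on_subset[OF cont_\<beta>]) auto

lemma H_diff: "x \<le> y \<Longrightarrow> H y - H x = integral {x..y} \<beta>"
  using Henstock_Kurzweil_Integration.integral_combine[of 0 x y \<beta>]
    Henstock_Kurzweil_Integration.integral_combine[of x 0 y \<beta>]
    Henstock_Kurzweil_Integration.integral_combine[of x y 0 \<beta>]
  by (cases "0 \<le> x"; cases "0 \<le> y"; cases "x = 0"; cases "y = 0") (auto simp: H_def \<beta>_integrable)

lemma H_eq_integral: "0 \<le> x \<Longrightarrow> H x = integral {0..x} \<beta>"
  by (cases "x = 0") (auto simp: H_def)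

lemma H_0 [simp]: "H 0 = 0"
  by (simp add: H_def)

lemma DERIV_H: "(H has_real_derivative \<beta> x) (at x)"
proof -
  \<comment> \<open>The integral starts at x - 1, so that x is an interior point and the derivative
    within the interval is a two-sided one.\<close>
  have "((\<lambda>y. integral {x - 1..y} \<beta>) has_real_derivative \<beta> x) (at x within {x - 1..x + 1})"
    by (intro integral_has_real_derivative continuous_on_subset[OF cont_\<beta>]) auto
  moreover have "at x within {x - 1..x + 1} = at x"
    by (intro at_within_interior) auto
  ultimately have "((\<lambda>y. H (x - 1) + integral {x - 1..y} \<beta>) has_real_derivative \<beta> x) (at x)"
    by (auto intro!: derivative_eq_intros)
  moreover have "\<forall>\<^sub>F y in nhds x. H (x - 1) + integral {x - 1..y} \<beta> = H y"
  proof -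
    have "\<forall>\<^sub>F y in nhds x. y \<in> {x - 1<..}" by (intro eventually_nhds_in_open) auto
    then show ?thesis
    proof eventually_elim
      case (elim y)
      then show ?case using H_diff[of "x - 1" y] by simp
    qed
  qed
  ultimately show ?thesis by (subst (asm) DERIV_cong_ev[OF refl _ refl])
qed

lemma DERIV_S [derivative_intros]:
  "(f has_real_derivative D) (at x) \<Longrightarrow> ((\<lambda>x. S (f x)) has_real_derivative (- \<psi> (f x) * D)) (at x)"
  unfolding S_def \<psi>_def
  by (auto intro!: derivative_eq_intros DERIV_chain2[OF DERIV_H])

lemma continuous_S: "continuous_on A S"
  using DERIV_S[OF DERIV_ident] by (auto intro!: continuous_at_imp_continuous_on DERIV_isCont)

lemma continuous_\<psi>: "continuous_on A \<psi>"
  unfolding \<psi>_def using continuous_S cont_\<beta>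
  by (intro continuous_on_mult continuous_on_subset[OF cont_\<beta>]) auto

lemma measurable_S [measurable]: "S \<in> borel_measurable borel"
  by (intro borel_measurable_continuous_onI continuous_S)

lemma measurable_\<psi> [measurable]: "\<psi> \<in> borel_measurable borel"
  by (intro borel_measurable_continuous_onI continuous_\<psi>)

lemma S_0 [simp]: "S 0 = 1"
  by (simp add: S_def)

lemma S_pos [simp]: "0 < S x"
  by (simp add: S_def)

lemma S_nonneg [simp]: "0 \<le> S x"
  by (simp add: S_def)

lemma S_nonzero [simp]: "S x \<noteq> 0"
  by (simp add: S_def)

lemma \<psi>_nonneg [simp]: "0 \<le> \<psi> x"
  by (simp add: \<psi>_def \<beta>_nonneg)

lemma H_mono: "x \<le> y \<Longrightarrow> H x \<le> H y"
  using DERIV_nonneg_imp_nondecreasing[of x y H] DERIV_H \<beta>_nonneg by blast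

lemma H_le: 
  assumes "x \<le> y"
  shows "H y \<le> H x + \<beta>_max * (y - x)"
proof -
  have "\<beta>_max * x - H x \<le> \<beta>_max * y - H y"
    using assms
  proof (rule DERIV_nonneg_imp_nondecreasing)
    fix z
    have "((\<lambda>z. \<beta>_max * z - H z) has_real_derivative \<beta>_max - \<beta> z) (at z)"
      by (auto intro!: derivative_eq_intros DERIV_H)
    then show "\<exists>d. ((\<lambda>z. \<beta>_max * z - H z) has_real_derivative d) (at z) \<and> 0 \<le> d"
      using \<beta>_le[of z] by force
  qed
  then show ?thesis by (simp add: algebra_simps)
qed

lemma S_antimono: "x \<le> y \<Longrightarrow> S y \<le> S x"
  using H_mono by (simp add: S_def)

lemma S_le_1: "0 \<le> x \<Longrightarrow> S x \<le> 1"
  using S_antimono[of 0 x] by simp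

lemma S_ge: "x \<le> y \<Longrightarrow> S x * exp (- \<beta>_max * (y - x)) \<le> S y"
  using H_le[of x y] by (simp add: S_def flip: exp_add)

lemma \<psi>_le: "0 \<le> x \<Longrightarrow> \<psi> x \<le> \<beta>_max"
  unfolding \<psi>_def using mult_mono[OF \<beta>_le S_le_1] \<beta>_max_nonneg by (simp add: \<beta>_nonneg)

text \<open>For \<open>a, t \<ge> 0\<close>, \<open>conv \<phi> a t / S a\<close> is the integral term of the renewal equation, with
  \<open>\<phi> = f(\<cdot>, 0)\<close> and \<open>\<tau> = t - s\<close>.\<close>

definition conv :: "(real \<Rightarrow> real) \<Rightarrow> real \<Rightarrow> real \<Rightarrow> real" where
  "conv \<phi> a t = (\<integral>s. indicator {0..t} s * (\<psi> (a + t - s) * \<phi> s) \<partial>lborel)"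

lemma integrable_indicator_Icc: "integrable lborel (\<lambda>s. indicator {a..b::real} s * (k::real))"
  by (cases "a \<le> b") (auto intro!: integrable_mult_left integrable_real_indicator)

lemma conv_bound:
  assumes "0 \<le> a" "\<And>s. 0 \<le> s \<Longrightarrow> s \<le> t \<Longrightarrow> \<bar>\<phi> s\<bar> \<le> C"
  shows "\<bar>indicator {0..t} s * (\<psi> (a + t - s) * \<phi> s)\<bar> \<le> indicator {0..t} s * (\<beta>_max * C)"
  using assms \<psi>_le[of "a + t - s"] \<beta>_max_nonneg
  by (auto simp: indicator_def abs_mult intro!: mult_mono)

lemma conv_integrable:
  assumes [measurable]: "\<phi> \<in> borel_measurable borel"
    and "0 \<le> a" "\<And>s. 0 \<le> s \<Longrightarrow> s \<le> t \<Longrightarrow> \<bar>\<phi> s\<bar> \<le> C"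
  shows "integrable lborel (\<lambda>s. indicator {0..t} s * (\<psi> (a + t - s) * \<phi> s))"
proof (rule Bochner_Integration.integrable_bound)
  show "integrable lborel (\<lambda>s. indicator {0..t} s * (\<beta>_max * C))"
    by (rule integrable_indicator_Icc)
  show "AE s in lborel. norm (indicator {0..t} s * (\<psi> (a + t - s) * \<phi> s))
      \<le> norm (indicator {0..t} s * (\<beta>_max * C))"
    using conv_bound[OF assms(2,3)] by (auto intro!: AE_I2 order_trans[OF _ abs_ge_self])
qed measurable

lemma conv_neg: "t < 0 \<Longrightarrow> conv \<phi> a t = 0"
  by (simp add: conv_def)

lemma conv_cong: "(\<And>s. 0 \<le> s \<Longrightarrow> s \<le> t \<Longrightarrow> \<phi> s = \<phi>' s) \<Longrightarrow> conv \<phi> a t = conv \<phi>' a t"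
  unfolding conv_def by (intro Bochner_Integration.integral_cong) (auto simp: indicator_def)

lemma conv_cmult: "conv (\<lambda>s. k * \<phi> s) a t = k * conv \<phi> a t"
proof -
  have "conv (\<lambda>s. k * \<phi> s) a t = (\<integral>s. k * (indicator {0..t} s * (\<psi> (a + t - s) * \<phi> s)) \<partial>lborel)"
    unfolding conv_def by (simp add: algebra_simps)
  then show ?thesis by (simp add: conv_def)
qed

text \<open>The kernel integrates to a difference of values of \<open>S\<close>. This is
  conservation of mass: the convolution replaces exactly what the survival factor in
  \<open>g\<close> loses, so that constants are fixed by \<open>U\<close>.\<close>

lemma conv_const:
  assumes "0 \<le> t"
  shows "conv (\<lambda>_. k) a t = k * (S a - S (a + t))"
proof -
  have "(\<integral>s. \<psi> (a + t - s) * indicator {0..t} s \<partial>lborel) = S (a + t - t) - S (a + t - 0)"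
    using assms by (intro integral_FTC_Icc_nonneg) (auto intro!: derivative_eq_intros)
  then have "conv (\<lambda>_. 1) a t = S a - S (a + t)" by (simp add: conv_def mult.commute)
  then show ?thesis using conv_cmult[of k "\<lambda>_. 1"] by simp
qed

lemma conv_nonneg: "(\<And>s. 0 \<le> s \<Longrightarrow> s \<le> t \<Longrightarrow> 0 \<le> \<phi> s) \<Longrightarrow> 0 \<le> conv \<phi> a t"
  unfolding conv_def by (intro integral_nonneg_AE AE_I2) (auto simp: indicator_def)

context
  fixes \<phi> \<phi>' :: "real \<Rightarrow> real" and a t C D :: real
  assumes \<phi>: "\<phi> \<in> borel_measurable borel" "\<And>s. 0 \<le> s \<Longrightarrow> s \<le> t \<Longrightarrow> \<bar>\<phi> s\<bar> \<le> C"
    and \<phi>': "\<phi>' \<in> borel_measurable borel" "\<And>s. 0 \<le> s \<Longrightarrow> s \<le> t \<Longrightarrow> \<bar>\<phi>' s\<bar> \<le> D"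
    and a: "0 \<le> a"
begin

lemma conv_add: "conv (\<lambda>s. \<phi> s + \<phi>' s) a t = conv \<phi> a t + conv \<phi>' a t"
  using Bochner_Integration.integral_add[OF conv_integrable[OF \<phi>(1) a \<phi>(2)] conv_integrable[OF \<phi>'(1) a \<phi>'(2)], of t t]
  by (simp add: conv_def algebra_simps)

lemma conv_diff: "conv (\<lambda>s. \<phi> s - \<phi>' s) a t = conv \<phi> a t - conv \<phi>' a t"
  using Bochner_Integration.integral_diff[OF conv_integrable[OF \<phi>(1) a \<phi>(2)] conv_integrable[OF \<phi>'(1) a \<phi>'(2)], of t t]
  by (simp add: conv_def algebra_simps)

lemma conv_mono: "(\<And>s. 0 \<le> s \<Longrightarrow> s \<le> t \<Longrightarrow> \<phi> s \<le> \<phi>' s) \<Longrightarrow> conv \<phi> a t \<le> conv \<phi>' a t"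
  unfolding conv_def
  by (intro integral_mono conv_integrable[OF \<phi>(1) a \<phi>(2)] conv_integrable[OF \<phi>'(1) a \<phi>'(2)])
    (auto simp: indicator_def intro!: mult_left_mono)

end

text \<open>Comparison with the constants C and - C. Keeping the exact factor S a - S (a + t),
  instead of estimating the kernel by \<beta>_max, is what makes the operator a contraction on
  intervals of any length, and what lets the bounds on \<open>g\<close> and on the convolution add
  up to C * S a without loss.\<close>

lemma abs_conv_le:
  assumes \<phi>: "\<phi> \<in> borel_measurable borel" "\<And>s. 0 \<le> s \<Longrightarrow> s \<le> t \<Longrightarrow> \<bar>\<phi> s\<bar> \<le> C"
    and "0 \<le> a" "0 \<le> t"
  shows "\<bar>conv \<phi> a t\<bar> \<le> C * (S a - S (a + t))"
proof -
  have "0 \<le> C" using \<phi>(2)[of 0] \<open>0 \<le> t\<close> by auto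
  then have C: "\<And>s. 0 \<le> s \<Longrightarrow> s \<le> t \<Longrightarrow> \<bar>C\<bar> \<le> C" "\<And>s. 0 \<le> s \<Longrightarrow> s \<le> t \<Longrightarrow> \<bar>-C\<bar> \<le> C" by auto
  have "conv \<phi> a t \<le> conv (\<lambda>_. C) a t"
    by (rule conv_mono[OF \<phi> _ C(1) \<open>0 \<le> a\<close>]) (use \<phi>(2) in \<open>auto simp: abs_le_iff\<close>)
  moreover have "conv (\<lambda>_. - C) a t \<le> conv \<phi> a t"
    by (rule conv_mono[OF _ C(2) \<phi> \<open>0 \<le> a\<close>]) (use \<phi>(2) in \<open>auto simp: abs_le_iff minus_le_iff\<close>)
  ultimately show ?thesis using conv_const[OF \<open>0 \<le> t\<close>] by (auto simp: abs_le_iff)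
qed

lemma conv_tendsto:
  assumes meas: "\<And>n. \<phi> n \<in> borel_measurable borel" "\<phi>' \<in> borel_measurable borel"
    and bound: "\<And>n s. 0 \<le> s \<Longrightarrow> s \<le> t \<Longrightarrow> \<bar>\<phi> n s\<bar> \<le> C"
    and lim: "\<And>s. 0 \<le> s \<Longrightarrow> s \<le> t \<Longrightarrow> (\<lambda>n. \<phi> n s) \<longlonglongrightarrow> \<phi>' s"
    and a: "0 \<le> a"
  shows "(\<lambda>n. conv (\<phi> n) a t) \<longlonglongrightarrow> conv \<phi>' a t"
  unfolding conv_def
proof (rule integral_dominated_convergence)
  note [measurable] = meas
  show "integrable lborel (\<lambda>s. indicator {0..t} s * (\<beta>_max * C))"
    by (rule integrable_indicator_Icc)
  show "AE s in lborel. (\<lambda>n. indicator {0..t} s * (\<psi> (a + t - s) * \<phi> n s))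
      \<longlonglongrightarrow> indicator {0..t} s * (\<psi> (a + t - s) * \<phi>' s)"
    using lim by (intro AE_I2) (auto simp: indicator_def intro!: tendsto_intros)
  show "AE s in lborel. norm (indicator {0..t} s * (\<psi> (a + t - s) * \<phi> n s))
      \<le> indicator {0..t} s * (\<beta>_max * C)" for n
    using conv_bound[OF a bound] by (intro AE_I2) auto
  show "(\<lambda>s. indicator {0..t} s * (\<psi> (a + t - s) * \<phi> n s)) \<in> borel_measurable lborel"
    "(\<lambda>s. indicator {0..t} s * (\<psi> (a + t - s) * \<phi>' s)) \<in> borel_measurable lborel" for n
    by measurable
qed

text \<open>\<open>\<phi>\<close> is merely measurable and bounded on the half-line; continuity
  comes from the kernel and from the moving endpoint. Along a convergent sequence of endpoints the
  indicator can fail to converge only at the limit endpoint, a null set. Measurability of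
  \<open>conv\<close> in time and of \<open>U\<close> in age follows from this.\<close>

lemma continuous_conv:
  assumes \<phi> [measurable]: "\<phi> \<in> borel_measurable borel" and bound: "\<And>s. 0 \<le> s \<Longrightarrow> \<bar>\<phi> s\<bar> \<le> C"
  shows "continuous_on ({0..} \<times> UNIV) (\<lambda>(a, t). conv \<phi> a t)"
proof (rule continuous_on_sequentiallyI)
  fix p :: "nat \<Rightarrow> real \<times> real" and q
  assume p: "\<forall>n. p n \<in> {0..} \<times> UNIV" and q: "q \<in> {0..} \<times> UNIV" and lim: "p \<longlonglongrightarrow> q"
  define a t where "a n = fst (p n)" and "t n = snd (p n)" for n
  obtain a' t' where q': "q = (a', t')" by (cases q)
  have at: "a \<longlonglongrightarrow> a'" "t \<longlonglongrightarrow> t'"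
    using tendsto_fst[OF lim] tendsto_snd[OF lim] unfolding a_def[abs_def] t_def[abs_def] by (simp_all add: q')
  have a0: "0 \<le> a n" for n using p by (auto simp: a_def mem_Times_iff)
  \<comment> \<open>One bound for all endpoints, so that a single integrable function dominates the
    sequence.\<close>
  obtain T where T: "\<And>n. \<bar>t n\<bar> \<le> T"
    using convergent_imp_Bseq[OF convergentI[OF at(2)]] unfolding Bseq_def real_norm_def by blast
  have C: "0 \<le> C" using bound[of 0] by auto
  have "(\<lambda>n. conv \<phi> (a n) (t n)) \<longlonglongrightarrow> conv \<phi> a' t'"
    unfolding conv_def
  proof (rule integral_dominated_convergence)
    show "integrable lborel (\<lambda>s. indicator {0..T} s * (\<beta>_max * C))"
      by (rule integrable_indicator_Icc)
    have ind: "(\<lambda>n. indicator {0..t n} s :: real) \<longlonglongrightarrow> indicator {0..t'} s" if "s \<noteq> t'" for s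
    proof (rule tendsto_eventually)
      show "\<forall>\<^sub>F n in sequentially. (indicator {0..t n} s :: real) = indicator {0..t'} s"
      proof (cases "s < t'")
        case True
        then show ?thesis
          using order_tendstoD(1)[OF at(2) True] by (auto elim!: eventually_mono simp: indicator_def)
      next
        case False
        then show ?thesis
          using order_tendstoD(2)[OF at(2), of s] that
          by (auto elim!: eventually_mono simp: indicator_def)
      qed
    qed
    have lim\<psi>: "(\<lambda>n. \<psi> (a n + t n - s)) \<longlonglongrightarrow> \<psi> (a' + t' - s)" for s
      using continuous_\<psi>[of UNIV]
      by (intro continuous_on_tendsto_compose[where s = UNIV and f = \<psi>] tendsto_intros at) auto
    show "AE s in lborel. (\<lambda>n. indicator {0..t n} s * (\<psi> (a n + t n - s) * \<phi> s))
        \<longlonglongrightarrow> indicator {0..t'} s * (\<psi> (a' + t' - s) * \<phi> s)"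
      using AE_lborel_singleton[of t']
      by eventually_elim (intro tendsto_intros ind lim\<psi>)
    show "AE s in lborel. norm (indicator {0..t n} s * (\<psi> (a n + t n - s) * \<phi> s))
        \<le> indicator {0..T} s * (\<beta>_max * C)" for n
    proof (intro AE_I2)
      fix s
      have "indicator {0..t n} s * (\<beta>_max * C) \<le> indicator {0..T} s * (\<beta>_max * C)"
        using T[of n] C \<beta>_max_nonneg by (intro mult_right_mono) (auto simp: indicator_def)
      moreover have "\<bar>indicator {0..t n} s * (\<psi> (a n + t n - s) * \<phi> s)\<bar>
          \<le> indicator {0..t n} s * (\<beta>_max * C)"
        using bound by (intro conv_bound[OF a0])
      ultimately show "norm (indicator {0..t n} s * (\<psi> (a n + t n - s) * \<phi> s))
          \<le> indicator {0..T} s * (\<beta>_max * C)"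
        by simp
    qed
  qed measurable
  then show "(\<lambda>n. case p n of (a, t) \<Rightarrow> conv \<phi> a t) \<longlonglongrightarrow> (case q of (a, t) \<Rightarrow> conv \<phi> a t)"
    by (simp add: q' a_def t_def case_prod_unfold)
qed

lemma measurable_conv_0:
  assumes "\<phi> \<in> borel_measurable borel" "\<And>s. 0 \<le> s \<Longrightarrow> \<bar>\<phi> s\<bar> \<le> C"
  shows "conv \<phi> 0 \<in> borel_measurable borel"
proof (rule borel_measurable_continuous_onI)
  show "continuous_on UNIV (conv \<phi> 0)"
    using continuous_on_compose2[OF continuous_conv[OF assms], of UNIV "\<lambda>t. (0, t)"]
    by (simp add: continuous_on_Pair image_subset_iff)
qed

text \<open>The interval [0, t + s] is cut at s. The lower piece is the convolution started at age a
  + t and run for time s; on the upper piece a translation by s gives the convolution of the shifted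
  function. This is the algebra behind the semigroup law.\<close>

lemma conv_shift:
  assumes [measurable]: "\<phi> \<in> borel_measurable borel" and bound: "\<And>s. 0 \<le> s \<Longrightarrow> \<bar>\<phi> s\<bar> \<le> C"
    and "0 \<le> a" "0 \<le> s" "0 \<le> t"
  shows "conv \<phi> a (t + s) = conv \<phi> (a + t) s + conv (\<lambda>r. \<phi> (r + s)) a t"
proof -
  have "conv (\<lambda>r. \<phi> (r + s)) a t
    = (\<integral>r. indicator {s..t + s} r * (\<psi> (a + (t + s) - r) * \<phi> r) \<partial>lborel)"
    unfolding conv_def
    by (subst (2) lborel_integral_real_affine[of 1 _ s])
      (auto intro!: Bochner_Integration.integral_cong simp: indicator_def algebra_simps)
  moreover have "integrable lborel (\<lambda>r. indicator {s..t + s} r * (\<psi> (a + (t + s) - r) * \<phi> r))"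
  proof -
    have "integrable lborel (\<lambda>r. indicator {s..t + s} r *\<^sub>R
      (indicator {0..t + s} r * (\<psi> (a + (t + s) - r) * \<phi> r)))"
      using bound by (intro integrable_mult_indicator conv_integrable[OF assms(1,3)]) auto
    moreover have "(\<lambda>r. indicator {s..t + s} r *\<^sub>R (indicator {0..t + s} r * (\<psi> (a + (t + s) - r) * \<phi> r)))
      = (\<lambda>r. indicator {s..t + s} r * (\<psi> (a + (t + s) - r) * \<phi> r))"
      using \<open>0 \<le> s\<close> by (auto simp: indicator_def fun_eq_iff)
    ultimately show ?thesis by simp
  qed
  moreover have "integrable lborel (\<lambda>r. indicator {0..s} r * (\<psi> (a + t + s - r) * \<phi> r))"
    using assms by (intro conv_integrable[OF assms(1) _ bound]) auto
  ultimately have "conv \<phi> (a + t) s + conv (\<lambda>r. \<phi> (r + s)) a t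
    = (\<integral>r. indicator {0..s} r * (\<psi> (a + t + s - r) * \<phi> r)
        + indicator {s..t + s} r * (\<psi> (a + (t + s) - r) * \<phi> r) \<partial>lborel)"
    by (simp add: conv_def)
  also have "\<dots> = conv \<phi> a (t + s)"
    unfolding conv_def
  proof (rule integral_cong_AE)
    show "AE r in lborel. indicator {0..s} r * (\<psi> (a + t + s - r) * \<phi> r)
        + indicator {s..t + s} r * (\<psi> (a + (t + s) - r) * \<phi> r)
        = indicator {0..t + s} r * (\<psi> (a + (t + s) - r) * \<phi> r)"
      using AE_lborel_singleton[of s]
      by eventually_elim (use \<open>0 \<le> s\<close> \<open>0 \<le> t\<close> in \<open>auto simp: indicator_def add.assoc\<close>)
  qed measurable
  finally show ?thesis ..
qed

end

lemma space_borel_nonneg [simp]: "space borel_nonneg = {0..}"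
  by (simp add: borel_nonneg_def space_restrict_space)

lemma measurable_borel_nonneg_iff:
  fixes f :: "real \<Rightarrow> real"
  shows "f \<in> borel_measurable borel_nonneg \<longleftrightarrow> (\<lambda>x. indicator {0..} x * f x) \<in> borel_measurable borel"
  unfolding borel_nonneg_def by (subst borel_measurable_restrict_space_iff) simp_all

section \<open>The boundary trace by Picard iteration\<close>

context renewal
begin

text \<open>The datum weighted by survival; extension by 0 makes it a Borel function on the whole
  line, whatever \<open>f\<close> does at negative arguments.\<close>

definition g :: "(real \<Rightarrow> real) \<Rightarrow> real \<Rightarrow> real" where
  "g f x = indicator {0..} x * f x * S x"

text \<open>Picard iteration from 0: the n-th iterate collects the histories with fewer than n
  renewals, and it is nonnegative for nonnegative data.\<close>

primrec \<Phi>_iter :: "(real \<Rightarrow> real) \<Rightarrow> nat \<Rightarrow> real \<Rightarrow> real" where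
  "\<Phi>_iter f 0 = (\<lambda>_. 0)"
| "\<Phi>_iter f (Suc n) = (\<lambda>t. g f t + conv (\<Phi>_iter f n) 0 t)"

definition \<Phi> :: "(real \<Rightarrow> real) \<Rightarrow> real \<Rightarrow> real" where
  "\<Phi> f t = lim (\<lambda>n. \<Phi>_iter f n t)"

text \<open>Multiplied by \<open>S a\<close>, the renewal equation involves only \<open>S\<close>
  and \<open>\<psi>\<close> at absolute ages; the division returns to survival conditioned on having
  reached age a.\<close>

definition U :: "(real \<Rightarrow> real) \<Rightarrow> real \<Rightarrow> real \<Rightarrow> real" where
  "U f t a = (g f (a + t) + conv (\<Phi> f) a t) / S a"

lemma g_measurable [measurable (raw)]:
  assumes "f \<in> borel_measurable borel_nonneg"
  shows "g f \<in> borel_measurable borel"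
  using assms unfolding g_def[abs_def] measurable_borel_nonneg_iff by measurable

lemma g_neg: "x < 0 \<Longrightarrow> g f x = 0"
  by (simp add: g_def)

lemma g_nonneg: "(\<And>x. 0 \<le> x \<Longrightarrow> 0 \<le> f x) \<Longrightarrow> 0 \<le> g f x"
  by (simp add: g_def indicator_def)

lemma g_bound:
  assumes "\<And>x. 0 \<le> x \<Longrightarrow> \<bar>f x\<bar> \<le> C" "0 \<le> x"
  shows "\<bar>g f x\<bar> \<le> C * S x"
  using assms by (auto simp: g_def abs_mult intro!: mult_right_mono)

lemma \<Phi>_iter_neg: "t < 0 \<Longrightarrow> \<Phi>_iter f n t = 0"
  by (cases n) (simp_all add: g_neg conv_neg)

context
  fixes f :: "real \<Rightarrow> real" and C :: real
  assumes f: "f \<in> borel_measurable borel_nonneg" and f_bound: "\<And>x. 0 \<le> x \<Longrightarrow> \<bar>f x\<bar> \<le> C"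
begin

lemma bound_nonneg: "0 \<le> C"
  using f_bound[of 0] by auto

text \<open>The bounds C * S t for \<open>g\<close> and C * (1 - S t) for the convolution add up to
  exactly C, so nothing grows with n. Measurability is carried along because measurability of the
  next convolution uses the bound.\<close>

lemma \<Phi>_iter_props: "\<Phi>_iter f n \<in> borel_measurable borel \<and> (\<forall>t. \<bar>\<Phi>_iter f n t\<bar> \<le> C)"
proof (induction n)
  case 0
  then show ?case by (simp add: bound_nonneg)
next
  case (Suc n)
  then have "conv (\<Phi>_iter f n) 0 \<in> borel_measurable borel"
    by (intro measurable_conv_0) auto
  then have "\<Phi>_iter f (Suc n) \<in> borel_measurable borel"
    using g_measurable[OF f] by simp
  moreover have "\<bar>\<Phi>_iter f (Suc n) t\<bar> \<le> C" for t
  proof (cases "0 \<le> t")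
    case True
    have "\<bar>g f t\<bar> \<le> C * S t" by (rule g_bound[OF f_bound True])
    moreover have "\<bar>conv (\<Phi>_iter f n) 0 t\<bar> \<le> C * (1 - S t)"
      using abs_conv_le[of "\<Phi>_iter f n" t C 0] Suc True by simp
    ultimately show ?thesis by (simp add: algebra_simps)
  next
    case False
    then show ?thesis using bound_nonneg by (simp add: g_neg conv_neg)
  qed
  ultimately show ?case by blast
qed

lemmas \<Phi>_iter_measurable = \<Phi>_iter_props[THEN conjunct1]
lemmas \<Phi>_iter_bound = \<Phi>_iter_props[THEN conjunct2, rule_format]

text \<open>The operator \<open>\<phi> \<mapsto> conv \<phi> 0\<close> is a contraction on \<open>[0, T]\<close>, with factor \<open>1 - S T\<close>.\<close>

lemma \<Phi>_iter_diff:
  assumes "t \<le> T" "0 \<le> T"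
  shows "\<bar>\<Phi>_iter f (Suc n) t - \<Phi>_iter f n t\<bar> \<le> C * (1 - S T) ^ n"
  using assms
proof (induction n arbitrary: t)
  case 0
  then show ?case using \<Phi>_iter_bound[of "Suc 0" t] by simp
next
  case (Suc n)
  show ?case
  proof (cases "0 \<le> t")
    case True
    have "\<Phi>_iter f (Suc (Suc n)) t - \<Phi>_iter f (Suc n) t
      = conv (\<lambda>s. \<Phi>_iter f (Suc n) s - \<Phi>_iter f n s) 0 t"
      using conv_diff[OF \<Phi>_iter_measurable \<Phi>_iter_bound \<Phi>_iter_measurable \<Phi>_iter_bound, of 0 "Suc n" n t]
      by simp
    moreover have "\<bar>\<dots>\<bar> \<le> C * (1 - S T) ^ n * (S 0 - S (0 + t))"
      using Suc \<Phi>_iter_measurable True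
      by (intro abs_conv_le borel_measurable_diff) (auto simp del: \<Phi>_iter.simps)
    moreover have "\<dots> \<le> C * (1 - S T) ^ n * (1 - S T)"
      using S_antimono[OF Suc.prems(1)] S_le_1[OF \<open>0 \<le> T\<close>] bound_nonneg
      by (intro mult_left_mono mult_nonneg_nonneg) auto
    ultimately show ?thesis by (simp add: mult_ac del: \<Phi>_iter.simps)
  next
    case False
    then show ?thesis
      using bound_nonneg S_le_1[OF \<open>0 \<le> T\<close>] \<Phi>_iter_neg[of t]
      by (auto simp del: \<Phi>_iter.simps intro!: mult_nonneg_nonneg)
  qed
qed

lemma \<Phi>_iter_tendsto: "(\<lambda>n. \<Phi>_iter f n t) \<longlonglongrightarrow> \<Phi> f t"
proof -
  \<comment> \<open>The contraction estimate requires T \<ge> 0; the maximum covers negative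
    t.\<close>
  define T where "T = max 0 t"
  have "norm (1 - S T) < 1" using S_le_1[of T] by (simp add: T_def)
  then have "summable (\<lambda>n. C * (1 - S T) ^ n)"
    by (intro summable_mult summable_geometric)
  then have "summable (\<lambda>n. \<Phi>_iter f (Suc n) t - \<Phi>_iter f n t)"
    by (rule summable_comparison_test'[where N = 0]) (use \<Phi>_iter_diff[of t T] in \<open>simp add: T_def\<close>)
  then have "convergent (\<lambda>n. \<Sum>k<n. \<Phi>_iter f (Suc k) t - \<Phi>_iter f k t)"
    by (simp only: summable_iff_convergent)
  then have "convergent (\<lambda>n. \<Phi>_iter f n t)"
    unfolding sum_lessThan_telescope[of "\<lambda>k. \<Phi>_iter f k t"] by (simp del: \<Phi>_iter.simps(2))
  then show ?thesis unfolding \<Phi>_def by (rule convergent_LIMSEQ_iff[THEN iffD1])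
qed

lemma \<Phi>_measurable: "\<Phi> f \<in> borel_measurable borel"
  by (rule borel_measurable_LIMSEQ_real[OF \<Phi>_iter_tendsto]) (simp_all add: \<Phi>_iter_measurable)

lemma \<Phi>_bound: "\<bar>\<Phi> f t\<bar> \<le> C"
  using \<Phi>_iter_tendsto[of t] \<Phi>_iter_bound
  by (intro LIMSEQ_le_const2[OF tendsto_rabs]) auto

lemma \<Phi>_eq: "\<Phi> f t = g f t + conv (\<Phi> f) 0 t"
proof (rule LIMSEQ_unique)
  show "(\<lambda>n. \<Phi>_iter f (Suc n) t) \<longlonglongrightarrow> \<Phi> f t"
    by (rule LIMSEQ_Suc[OF \<Phi>_iter_tendsto])
  show "(\<lambda>n. \<Phi>_iter f (Suc n) t) \<longlonglongrightarrow> g f t + conv (\<Phi> f) 0 t"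
    unfolding \<Phi>_iter.simps
    by (intro tendsto_intros conv_tendsto[where C = C] \<Phi>_iter_measurable \<Phi>_measurable
        \<Phi>_iter_bound \<Phi>_iter_tendsto) auto
qed

text \<open>The difference of two solutions is a fixed point of the convolution operator, hence
  bounded on [0, t] by (C + D) * (1 - S t) ^ n for every n. Only nonnegative times enter, so a
  candidate may take any values at negative ones as long as it is measurable.\<close>

lemma \<Phi>_unique:
  assumes \<phi>: "\<phi> \<in> borel_measurable borel" "\<And>s. 0 \<le> s \<Longrightarrow> \<bar>\<phi> s\<bar> \<le> D"
    and eq: "\<And>t. 0 \<le> t \<Longrightarrow> \<phi> t = g f t + conv \<phi> 0 t" and "0 \<le> t"
  shows "\<Phi> f t = \<phi> t"
proof -
  define d where "d s = \<Phi> f s - \<phi> s" for s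
  have d_eq: "d s = conv d 0 s" if "0 \<le> s" for s
    using conv_diff[OF \<Phi>_measurable \<Phi>_bound \<phi>, of s 0] \<Phi>_eq[of s] eq[OF that]
    unfolding d_def[abs_def] by simp
  have d_meas: "d \<in> borel_measurable borel"
    unfolding d_def[abs_def] using \<Phi>_measurable \<phi>(1) by measurable
  have le: "\<bar>d s\<bar> \<le> (C + D) * (1 - S t) ^ n" if "0 \<le> s" "s \<le> t" for s n
    using that
  proof (induction n arbitrary: s)
    case 0
    then show ?case using \<Phi>_bound[of s] \<phi>(2)[of s] by (simp add: d_def)
  next
    case (Suc n)
    have "\<bar>d s\<bar> \<le> (C + D) * (1 - S t) ^ n * (S 0 - S (0 + s))"
      unfolding d_eq[OF Suc.prems(1)] using Suc by (intro abs_conv_le d_meas) auto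
    also have "\<dots> \<le> (C + D) * (1 - S t) ^ n * (1 - S t)"
      using S_antimono[OF Suc.prems(2)] S_le_1[OF \<open>0 \<le> t\<close>] bound_nonneg \<phi>(2)[of 0]
      by (intro mult_left_mono mult_nonneg_nonneg) auto
    finally show ?case by (simp add: mult_ac)
  qed
  have "(\<lambda>n. (C + D) * (1 - S t) ^ n) \<longlonglongrightarrow> (C + D) * 0"
    using S_le_1[OF \<open>0 \<le> t\<close>] by (intro tendsto_mult LIMSEQ_realpow_zero tendsto_const) auto
  then have "\<bar>d t\<bar> \<le> (C + D) * 0"
    by (rule LIMSEQ_le_const) (use le \<open>0 \<le> t\<close> in auto)
  then show ?thesis by (simp add: d_def)
qed

lemma \<Phi>_iter_nonneg:
  assumes "\<And>x. 0 \<le> x \<Longrightarrow> 0 \<le> f x"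
  shows "0 \<le> \<Phi>_iter f n t"
  by (induction n arbitrary: t) (auto intro!: add_nonneg_nonneg conv_nonneg g_nonneg assms)

lemma \<Phi>_nonneg:
  assumes "\<And>x. 0 \<le> x \<Longrightarrow> 0 \<le> f x"
  shows "0 \<le> \<Phi> f t"
  using \<Phi>_iter_tendsto[of t] \<Phi>_iter_nonneg[OF assms] by (intro LIMSEQ_le_const) auto

lemma \<Phi>_eq_U: "0 \<le> t \<Longrightarrow> \<Phi> f t = U f t 0"
  using \<Phi>_eq[of t] by (simp add: U_def)

lemma U_nonneg:
  assumes "\<And>x. 0 \<le> x \<Longrightarrow> 0 \<le> f x"
  shows "0 \<le> U f t a"
  unfolding U_def
  by (intro divide_nonneg_nonneg add_nonneg_nonneg conv_nonneg \<Phi>_nonneg[OF assms] g_nonneg assms S_nonneg)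

lemma U_bound:
  assumes "0 \<le> t" "0 \<le> a"
  shows "\<bar>U f t a\<bar> \<le> C"
proof -
  have "\<bar>g f (a + t)\<bar> \<le> C * S (a + t)" using assms by (intro g_bound f_bound) auto
  moreover have "\<bar>conv (\<Phi> f) a t\<bar> \<le> C * (S a - S (a + t))"
    using assms by (intro abs_conv_le \<Phi>_measurable \<Phi>_bound) auto
  ultimately have "\<bar>g f (a + t) + conv (\<Phi> f) a t\<bar> \<le> C * S a"
    by (simp add: algebra_simps)
  then show ?thesis by (simp add: U_def abs_div pos_divide_le_eq)
qed

lemma U_measurable:
  assumes "0 \<le> t"
  shows "U f t \<in> borel_measurable borel_nonneg"
proof -
  have "continuous_on {0..} (\<lambda>a. conv (\<Phi> f) a t)"
    using continuous_on_compose2[OF continuous_conv[OF \<Phi>_measurable \<Phi>_bound], of "{0..}" "\<lambda>a. (a, t)"]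
    by (simp add: continuous_on_Pair image_subset_iff)
  then have "(\<lambda>a. conv (\<Phi> f) a t) \<in> borel_measurable borel_nonneg"
    unfolding borel_nonneg_def by (rule borel_measurable_continuous_on_restrict)
  moreover have "(\<lambda>a. g f (a + t)) \<in> borel_measurable borel_nonneg"
    unfolding borel_nonneg_def using measurable_compose[OF _ g_measurable[OF f], of "\<lambda>a. a + t" borel]
    by (intro measurable_restrict_space1) simp
  moreover have "S \<in> borel_measurable borel_nonneg"
    unfolding borel_nonneg_def by (intro measurable_restrict_space1) measurable
  ultimately show ?thesis unfolding U_def[abs_def] by measurable
qed

lemma U_bounded_measurable: "0 \<le> t \<Longrightarrow> U f t \<in> bounded_measurable borel_nonneg"
  using U_measurable U_bound by (intro bounded_measurableI[where C = C]) auto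

end

section \<open>Linearity, monotone limits and the semigroup law\<close>

lemma bounded_measurable_nonnegE:
  assumes "f \<in> bounded_measurable borel_nonneg"
  obtains C where "f \<in> borel_measurable borel_nonneg" "\<And>x. 0 \<le> x \<Longrightarrow> \<bar>f x\<bar> \<le> C"
  using assms by (auto simp: bounded_measurable_def)

lemma U_cong: "(\<And>x. 0 \<le> x \<Longrightarrow> f x = h x) \<Longrightarrow> U f = U h"
proof -
  assume "\<And>x. 0 \<le> x \<Longrightarrow> f x = h x"
  then have g: "g f = g h" by (auto simp: g_def fun_eq_iff indicator_def)
  have "\<Phi>_iter f n = \<Phi>_iter h n" for n by (induction n) (simp_all add: g)
  then show ?thesis by (simp add: U_def[abs_def] \<Phi>_def[abs_def] g fun_eq_iff)
qed

lemma U_lincomb: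
  assumes f: "f \<in> bounded_measurable borel_nonneg" and h: "h \<in> bounded_measurable borel_nonneg"
    and "0 \<le> t" "0 \<le> a"
  shows "U (\<lambda>x. f x + k * h x) t a = U f t a + k * U h t a"
proof -
  obtain C where C: "f \<in> borel_measurable borel_nonneg" "\<And>x. 0 \<le> x \<Longrightarrow> \<bar>f x\<bar> \<le> C"
    using f by (rule bounded_measurable_nonnegE) (rule that)
  obtain D where D: "h \<in> borel_measurable borel_nonneg" "\<And>x. 0 \<le> x \<Longrightarrow> \<bar>h x\<bar> \<le> D"
    using h by (rule bounded_measurable_nonnegE) (rule that)
  obtain E where E: "(\<lambda>x. f x + k * h x) \<in> borel_measurable borel_nonneg"
    "\<And>x. 0 \<le> x \<Longrightarrow> \<bar>f x + k * h x\<bar> \<le> E"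
    using bounded_measurable_add[OF f bounded_measurable_cmult[OF h]] by (rule bounded_measurable_nonnegE) (rule that)
  have g: "g (\<lambda>x. f x + k * h x) x = g f x + k * g h x" for x
    by (simp add: g_def algebra_simps)
  have kh: "(\<lambda>s. k * \<Phi> h s) \<in> borel_measurable borel" "\<And>s. \<bar>k * \<Phi> h s\<bar> \<le> \<bar>k\<bar> * D"
    using \<Phi>_measurable[OF D] \<Phi>_bound[OF D] by (auto simp: abs_mult intro!: mult_left_mono)
  have conv: "conv (\<lambda>s. \<Phi> f s + k * \<Phi> h s) b s = conv (\<Phi> f) b s + k * conv (\<Phi> h) b s"
    if "0 \<le> b" for b s
    using conv_add[OF \<Phi>_measurable[OF C] \<Phi>_bound[OF C] kh that] by (simp add: conv_cmult)
  have \<Phi>: "\<Phi> (\<lambda>x. f x + k * h x) s = \<Phi> f s + k * \<Phi> h s" if "0 \<le> s" for s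
  proof (rule \<Phi>_unique[OF E _ _ _ that])
    show "(\<lambda>s. \<Phi> f s + k * \<Phi> h s) \<in> borel_measurable borel"
      using \<Phi>_measurable[OF C] \<Phi>_measurable[OF D] by measurable
    show "\<bar>\<Phi> f s + k * \<Phi> h s\<bar> \<le> C + \<bar>k\<bar> * D" for s
      using \<Phi>_bound[OF C, of s] kh(2)[of s] by linarith
    show "\<Phi> f t + k * \<Phi> h t = g (\<lambda>x. f x + k * h x) t + conv (\<lambda>s. \<Phi> f s + k * \<Phi> h s) 0 t" for t
      using conv[of 0 t] \<Phi>_eq[OF C, of t] \<Phi>_eq[OF D, of t] by (simp add: g algebra_simps)
  qed
  have "conv (\<Phi> (\<lambda>x. f x + k * h x)) a t = conv (\<lambda>s. \<Phi> f s + k * \<Phi> h s) a t"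
    using \<Phi> by (intro conv_cong) auto
  then show ?thesis
    using conv[OF \<open>0 \<le> a\<close>, of t] by (simp add: U_def g add_divide_distrib distrib_left)
qed

lemma U_const:
  assumes "0 \<le> t" "0 \<le> a"
  shows "U (\<lambda>_. k) t a = k"
proof -
  have "\<Phi> (\<lambda>_. k) s = k" if "0 \<le> s" for s
  proof (rule \<Phi>_unique[OF _ _ _ _ _ that])
    show "k = g (\<lambda>_. k) t + conv (\<lambda>_. k) 0 t" if "0 \<le> t" for t
      using conv_const[OF that, of k 0] that by (simp add: g_def algebra_simps)
    show "\<bar>k\<bar> \<le> \<bar>k\<bar>" "\<bar>k\<bar> \<le> \<bar>k\<bar>" by simp_all
  qed simp_all
  then have "conv (\<Phi> (\<lambda>_. k)) a t = k * (S a - S (a + t))"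
    using conv_const[OF \<open>0 \<le> t\<close>, of k a] conv_cong[of t "\<Phi> (\<lambda>_. k)" "\<lambda>_. k" a] by simp
  then have "g (\<lambda>_. k) (a + t) + conv (\<Phi> (\<lambda>_. k)) a t = k * S a"
    using assms by (simp add: g_def algebra_simps)
  then show ?thesis by (simp add: U_def)
qed

lemma U_cmult:
  assumes "f \<in> bounded_measurable borel_nonneg" "0 \<le> t" "0 \<le> a"
  shows "U (\<lambda>x. k * f x) t a = k * U f t a"
  using U_lincomb[OF bounded_measurable_const[of 0] assms, of k] U_const[OF assms(2,3), of 0] by simp

lemma U_add:
  assumes "f \<in> bounded_measurable borel_nonneg" "h \<in> bounded_measurable borel_nonneg" "0 \<le> t" "0 \<le> a"
  shows "U (\<lambda>x. f x + h x) t a = U f t a + U h t a"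
  using U_lincomb[OF assms, of 1] by simp

lemma U_mono:
  assumes f: "f \<in> bounded_measurable borel_nonneg" and h: "h \<in> bounded_measurable borel_nonneg"
    and le: "\<And>x. 0 \<le> x \<Longrightarrow> f x \<le> h x" and "0 \<le> t" "0 \<le> a"
  shows "U f t a \<le> U h t a"
proof -
  obtain C where C: "(\<lambda>x. h x - f x) \<in> borel_measurable borel_nonneg" "\<And>x. 0 \<le> x \<Longrightarrow> \<bar>h x - f x\<bar> \<le> C"
    using bounded_measurable_diff[OF h f] by (rule bounded_measurable_nonnegE) (rule that)
  have "0 \<le> U (\<lambda>x. h x - f x) t a" using le by (intro U_nonneg[OF C]) auto
  also have "\<dots> = U h t a - U f t a"
    using U_lincomb[OF h f assms(4,5), of "-1"] by simp
  finally show ?thesis by simp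
qed

lemma \<Phi>_mono:
  assumes f: "f \<in> bounded_measurable borel_nonneg" and h: "h \<in> bounded_measurable borel_nonneg"
    and le: "\<And>x. 0 \<le> x \<Longrightarrow> f x \<le> h x" and "0 \<le> t"
  shows "\<Phi> f t \<le> \<Phi> h t"
proof -
  obtain C where C: "f \<in> borel_measurable borel_nonneg" "\<And>x. 0 \<le> x \<Longrightarrow> \<bar>f x\<bar> \<le> C"
    using f by (rule bounded_measurable_nonnegE) (rule that)
  obtain D where D: "h \<in> borel_measurable borel_nonneg" "\<And>x. 0 \<le> x \<Longrightarrow> \<bar>h x\<bar> \<le> D"
    using h by (rule bounded_measurable_nonnegE) (rule that)
  show ?thesis
    using U_mono[OF f h le \<open>0 \<le> t\<close> order_refl] \<Phi>_eq_U[OF C \<open>0 \<le> t\<close>] \<Phi>_eq_U[OF D \<open>0 \<le> t\<close>] by simp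
qed

text \<open>The traces increase with the data and stay below K, so they converge pointwise;
  dominated convergence shows that the limit solves the equation of the limiting datum, and
  uniqueness identifies it. This is the source of countable additivity of the dual measures.\<close>

lemma U_incseq_tendsto:
  assumes F: "\<And>i. F i \<in> borel_measurable borel_nonneg" and f: "f \<in> borel_measurable borel_nonneg"
    and bounds: "\<And>i x. 0 \<le> x \<Longrightarrow> 0 \<le> F i x" "\<And>i x. 0 \<le> x \<Longrightarrow> F i x \<le> K"
    and inc: "incseq F" and lim: "\<And>x. 0 \<le> x \<Longrightarrow> (\<lambda>i. F i x) \<longlonglongrightarrow> f x"
    and t: "0 \<le> t" "0 \<le> a"
  shows "(\<lambda>i. U (F i) t a) \<longlonglongrightarrow> U f t a"
proof -
  have FK: "\<bar>F i x\<bar> \<le> K" if "0 \<le> x" for i x using bounds that by (simp add: abs_of_nonneg)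
  have F_bm: "F i \<in> bounded_measurable borel_nonneg" for i
    using F FK by (intro bounded_measurableI) auto
  have fK: "\<bar>f x\<bar> \<le> K" if "0 \<le> x" for x
    using lim[OF that] FK[OF that] by (intro LIMSEQ_le_const2[OF tendsto_rabs]) auto
  note \<Phi>F = \<Phi>_measurable[OF F FK] \<Phi>_bound[OF F FK]
  define L where "L s = (if 0 \<le> s then lim (\<lambda>i. \<Phi> (F i) s) else 0)" for s
  have L: "(\<lambda>i. \<Phi> (F i) s) \<longlonglongrightarrow> L s" if "0 \<le> s" for s
  proof -
    have "incseq (\<lambda>i. \<Phi> (F i) s)"
      using inc \<open>0 \<le> s\<close> by (auto simp: incseq_def le_fun_def intro!: \<Phi>_mono F_bm)
    moreover have "\<Phi> (F i) s \<le> K" for i using \<Phi>F(2)[of i s] by (simp add: abs_le_iff)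
    ultimately have "convergent (\<lambda>i. \<Phi> (F i) s)"
      using incseq_convergent[of "\<lambda>i. \<Phi> (F i) s" K] convergentI by metis
    then show ?thesis using that by (simp add: L_def convergent_LIMSEQ_iff)
  qed
  have L_meas: "L \<in> borel_measurable borel"
    unfolding L_def[abs_def] using \<Phi>F(1)
    by (intro measurable_If borel_measurable_lim_metric) auto
  have L_bound: "\<bar>L s\<bar> \<le> K" if "0 \<le> s" for s
    using L[OF that] \<Phi>F(2) by (intro LIMSEQ_le_const2[OF tendsto_rabs]) auto
  have conv_L: "(\<lambda>i. conv (\<Phi> (F i)) b s) \<longlonglongrightarrow> conv L b s" if "0 \<le> b" for b s
    using that by (intro conv_tendsto[where C = K] \<Phi>F L_meas L)
  have g_lim: "(\<lambda>i. g (F i) x) \<longlonglongrightarrow> g f x" for x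
    using lim[of x] unfolding g_def by (cases "0 \<le> x") (auto intro!: tendsto_intros)
  have \<Phi>_L: "\<Phi> f s = L s" if "0 \<le> s" for s
  proof (rule \<Phi>_unique[OF f fK L_meas L_bound _ that])
    fix s :: real assume "0 \<le> s"
    show "L s = g f s + conv L 0 s"
    proof (rule LIMSEQ_unique[OF L[OF \<open>0 \<le> s\<close>]])
      show "(\<lambda>i. \<Phi> (F i) s) \<longlonglongrightarrow> g f s + conv L 0 s"
        by (subst \<Phi>_eq[OF F FK], assumption) (intro tendsto_intros g_lim conv_L order_refl)
    qed
  qed
  have "conv (\<Phi> f) a t = conv L a t" using \<Phi>_L by (intro conv_cong) auto
  then show ?thesis
    unfolding U_def using conv_L[OF t(2)] by (auto intro!: tendsto_intros g_lim)
qed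

text \<open>By \<open>conv_shift\<close> the translated trace of \<open>f\<close> solves the trace
  equation with datum \<open>U f s\<close>, so it is the trace of that datum. The same splitting at
  a general age then gives the claim.\<close>

lemma U_semigroup:
  assumes f: "f \<in> bounded_measurable borel_nonneg" and "0 \<le> s" "0 \<le> t" "0 \<le> a"
  shows "U f (t + s) a = U (U f s) t a"
proof -
  obtain C where C: "f \<in> borel_measurable borel_nonneg" "\<And>x. 0 \<le> x \<Longrightarrow> \<bar>f x\<bar> \<le> C"
    using f by (rule bounded_measurable_nonnegE) (rule that)
  note \<Phi>f = \<Phi>_measurable[OF C] \<Phi>_bound[OF C]
  have shift: "conv (\<Phi> f) b (r + s) = conv (\<Phi> f) (b + r) s + conv (\<lambda>r. \<Phi> f (r + s)) b r"
    if "0 \<le> b" "0 \<le> r" for b r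
    using that \<open>0 \<le> s\<close> by (intro conv_shift[OF \<Phi>f])
  have g: "g (U f s) r = g f (r + s) + conv (\<Phi> f) r s" if "0 \<le> r" for r
    using that by (simp add: g_def[of "U f s"] U_def)
  have \<Phi>: "\<Phi> (U f s) r = \<Phi> f (r + s)" if "0 \<le> r" for r
  proof (rule \<Phi>_unique[OF _ _ _ _ _ that])
    show "U f s \<in> borel_measurable borel_nonneg" by (rule U_measurable[OF C \<open>0 \<le> s\<close>])
    show "\<bar>U f s x\<bar> \<le> C" if "0 \<le> x" for x by (rule U_bound[OF C \<open>0 \<le> s\<close> that])
    show "\<bar>\<Phi> f (r + s)\<bar> \<le> C" for r by (rule \<Phi>f(2))
    show "(\<lambda>r. \<Phi> f (r + s)) \<in> borel_measurable borel" using \<Phi>f(1) by measurable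
    show "\<Phi> f (r + s) = g (U f s) r + conv (\<lambda>r. \<Phi> f (r + s)) 0 r" if "0 \<le> r" for r
      using shift[of 0 r] that \<Phi>_eq[OF C, of "r + s"] by (simp add: g[OF that])
  qed
  have "conv (\<Phi> (U f s)) a t = conv (\<lambda>r. \<Phi> f (r + s)) a t"
    using \<Phi> by (intro conv_cong) auto
  then show ?thesis
    using shift[OF \<open>0 \<le> a\<close> \<open>0 \<le> t\<close>] g[of "a + t"] assms by (simp add: U_def add.assoc)
qed

end

lemma bounded_measurable_cong_sets:
  assumes "sets M = sets N"
  shows "bounded_measurable M = bounded_measurable N"
  using measurable_cong_sets[OF assms refl] sets_eq_imp_space_eq[OF assms]
  by (auto simp: bounded_measurable_def)

section \<open>Existence of the dual measures\<close>

context renewal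
begin

text \<open>Finite additivity comes from linearity of \<open>U\<close>, countable additivity from
  its continuity along increasing sequences. The formula for integrals then spreads from indicators
  to all bounded measurable functions, with the same monotone limits on both sides.\<close>

lemma dual_measure_exists:
  assumes P: "finite_measure P" "sets P = sets borel_nonneg" and t: "0 \<le> t"
  obtains Q where "finite_measure Q" "sets Q = sets borel_nonneg"
    "\<And>f. f \<in> bounded_measurable borel_nonneg \<Longrightarrow> (\<integral>x. f x \<partial>Q) = (\<integral>a. U f t a \<partial>P)"
proof -
  interpret P: finite_measure P by (rule P)
  have space_P: "space P = {0..}" using sets_eq_imp_space_eq[OF P(2)] by simp
  have bm: "U f t \<in> bounded_measurable P" if f: "f \<in> bounded_measurable borel_nonneg" for f
  proof -
    obtain C where "f \<in> borel_measurable borel_nonneg" "\<And>x. 0 \<le> x \<Longrightarrow> \<bar>f x\<bar> \<le> C"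
      using f by (rule bounded_measurable_nonnegE) (rule that)
    then show ?thesis
      using U_bounded_measurable[OF _ _ t] bounded_measurable_cong_sets[OF P(2)] by blast
  qed
  note integrable = P.integrable_bounded_measurable[OF bm]
  define m where "m A = (\<integral>a. U (indicator A) t a \<partial>P)" for A
  have m_empty: "m {} = 0"
  proof -
    have "(indicator {} :: real \<Rightarrow> real) = (\<lambda>_. 0)" by auto
    then have "m {} = (\<integral>a. 0 \<partial>P)"
      unfolding m_def using U_const[OF t, of _ 0] space_P
      by (intro Bochner_Integration.integral_cong) auto
    then show ?thesis by simp
  qed
  have m_Un: "m (A \<union> B) = m A + m B"
    if A: "A \<in> sets borel_nonneg" and B: "B \<in> sets borel_nonneg" and AB: "A \<inter> B = {}" for A B
  proof -
    have "(indicator (A \<union> B) :: real \<Rightarrow> real) = (\<lambda>x. indicator A x + indicator B x)"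
      using AB by (auto simp: fun_eq_iff indicator_def)
    then have "m (A \<union> B) = (\<integral>a. U (indicator A) t a + U (indicator B) t a \<partial>P)"
      unfolding m_def using t A B space_P
      by (intro Bochner_Integration.integral_cong) (auto simp: U_add bounded_measurable_indicator)
    then show ?thesis
      using integrable[OF bounded_measurable_indicator[OF A]] integrable[OF bounded_measurable_indicator[OF B]]
      by (simp add: m_def)
  qed
  have U_lim: "(\<lambda>i. \<integral>a. U (F i) t a \<partial>P) \<longlonglongrightarrow> (\<integral>a. U f t a \<partial>P)"
    if F: "\<And>i. F i \<in> borel_measurable borel_nonneg" and f: "f \<in> borel_measurable borel_nonneg"
      and bounds: "\<And>i x. 0 \<le> x \<Longrightarrow> 0 \<le> F i x" "\<And>i x. 0 \<le> x \<Longrightarrow> F i x \<le> K"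
      and inc: "incseq F" and lim: "\<And>x. 0 \<le> x \<Longrightarrow> (\<lambda>i. F i x) \<longlonglongrightarrow> f x"
    for F f K
  proof (rule integral_dominated_convergence[where w = "\<lambda>_. K"])
    have FK: "\<bar>F i x\<bar> \<le> K" if "0 \<le> x" for i x using bounds that by (simp add: abs_of_nonneg)
    have fK: "\<bar>f x\<bar> \<le> K" if "0 \<le> x" for x
      using lim[OF that] FK[OF that] by (intro LIMSEQ_le_const2[OF tendsto_rabs]) auto
    show "U f t \<in> borel_measurable P" "U (F i) t \<in> borel_measurable P" for i
      using F FK f fK by (auto intro!: bounded_measurableD(1)[OF bm] bounded_measurableI[where C = K])
    show "AE a in P. (\<lambda>i. U (F i) t a) \<longlonglongrightarrow> U f t a"
      using space_P by (intro AE_I2 U_incseq_tendsto[OF F f bounds inc lim t]) auto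
    show "AE a in P. norm (U (F i) t a) \<le> K" for i
      using space_P U_bound[OF F FK t] by (intro AE_I2) auto
  qed simp
  obtain Q where Q: "finite_measure Q" "sets Q = sets borel_nonneg"
    "\<And>A. A \<in> sets borel_nonneg \<Longrightarrow> measure Q A = m A"
  proof (rule finite_measure_of_real[of m borel_nonneg, OF m_empty])
    show "0 \<le> m A" if "A \<in> sets borel_nonneg" for A
      unfolding m_def using that
      by (intro Bochner_Integration.integral_nonneg U_nonneg[where C = 1] borel_measurable_indicator) auto
    fix A :: "nat \<Rightarrow> real set"
    assume A: "range A \<subseteq> sets borel_nonneg" "disjoint_family A"
    have fin: "(\<Sum>i<n. m (A i)) = m (\<Union>i<n. A i)" for n
    proof (induction n)
      case (Suc n)
      have "A n \<inter> (\<Union>i<n. A i) = {}"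
      proof -
        have "A n \<inter> A i = {}" if "i < n" for i
          using A(2) that unfolding disjoint_family_on_def by auto
        then show ?thesis by blast
      qed
      moreover have "(\<Union>i<n. A i) \<in> sets borel_nonneg" "A n \<in> sets borel_nonneg"
        using A(1) by auto
      ultimately show ?case
        using Suc m_Un[of "A n" "\<Union>i<n. A i"] by (simp add: lessThan_Suc)
    qed (simp add: m_empty)
    have "(\<lambda>n. m (\<Union>i<n. A i)) \<longlonglongrightarrow> m (\<Union>i. A i)"
      unfolding m_def
    proof (rule U_lim[where K = 1])
      show "incseq (\<lambda>n. indicator (\<Union>i<n. A i) :: real \<Rightarrow> real)"
        by (auto simp: incseq_def le_fun_def indicator_def)
      show "(\<lambda>n. indicator (\<Union>i<n. A i) x :: real) \<longlonglongrightarrow> indicator (\<Union>i. A i) x" for x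
        by (rule LIMSEQ_indicator_UN)
    qed (use A(1) in \<open>auto simp: indicator_def intro!: borel_measurable_indicator\<close>)
    then show "(\<lambda>i. m (A i)) sums m (\<Union>i. A i)"
      by (simp add: sums_def fin)
  qed (rule that)
  interpret Q: finite_measure Q by (rule Q)
  have space_Q: "space Q = {0..}" using sets_eq_imp_space_eq[OF Q(2)] by simp
  have Q_integrable: "integrable Q f" if "f \<in> bounded_measurable borel_nonneg" for f
    using that bounded_measurable_cong_sets[OF Q(2)] by (intro Q.integrable_bounded_measurable) blast
  have "(\<integral>x. f x \<partial>Q) = (\<integral>a. U f t a \<partial>P)" if "f \<in> bounded_measurable borel_nonneg" for f
    using that
  proof (induction rule: bounded_measurable_induct)
    case (cong u v)
    have "(\<integral>x. u x \<partial>Q) = (\<integral>x. v x \<partial>Q)"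
      using cong(1) space_Q by (intro Bochner_Integration.integral_cong) auto
    then show ?case using cong U_cong[of u v] by simp
  next
    case (indicator A)
    then show ?case
      using Q(3)[OF indicator] sets.sets_into_space[OF indicator] space_Q by (simp add: m_def Int_absorb2)
  next
    case (cmult u k)
    have "(\<integral>a. U (\<lambda>x. k * u x) t a \<partial>P) = (\<integral>a. k * U u t a \<partial>P)"
      using cmult t space_P by (intro Bochner_Integration.integral_cong) (auto simp: U_cmult)
    then show ?case using cmult by simp
  next
    case (add u v)
    have "(\<integral>a. U (\<lambda>x. u x + v x) t a \<partial>P) = (\<integral>a. U u t a + U v t a \<partial>P)"
      using add t space_P by (intro Bochner_Integration.integral_cong) (auto simp: U_add)
    then show ?case using add integrable Q_integrable by simp
  next
    case (lim F u K)
    have "(\<lambda>i. \<integral>x. F i x \<partial>Q) \<longlonglongrightarrow> (\<integral>x. u x \<partial>Q)"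
    proof (rule integral_dominated_convergence[where w = "\<lambda>_. K"])
      show "u \<in> borel_measurable Q" "F i \<in> borel_measurable Q" for i
        using lim by (simp_all add: measurable_cong_sets[OF Q(2) refl])
      show "AE x in Q. (\<lambda>i. F i x) \<longlonglongrightarrow> u x"
        using lim.hyps(6) space_Q by (intro AE_I2) simp
      show "AE x in Q. norm (F i x) \<le> K" for i
        using lim.hyps(3,4) space_Q by (intro AE_I2) simp
    qed simp
    moreover have "(\<lambda>i. \<integral>x. F i x \<partial>Q) \<longlonglongrightarrow> (\<integral>a. U u t a \<partial>P)"
      unfolding lim.IH using lim.hyps by (intro U_lim[where K = K]) simp_all
    ultimately show ?case by (rule LIMSEQ_unique)
  qed
  then show ?thesis by (rule that[OF Q(1,2)])
qed

section \<open>Identification with the renewal semigroup\<close>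

lemma exp_integral_shift:
  assumes "0 \<le> \<tau>"
  shows "exp (- integral {0..\<tau>} (\<lambda>u. \<beta> (a + u))) = S (a + \<tau>) / S a"
proof -
  have "((\<lambda>u. \<beta> (a + u)) has_integral H (a + \<tau>) - H (a + 0)) {0..\<tau>}"
    using assms
  proof (rule fundamental_theorem_of_calculus)
    fix u
    have "((\<lambda>u. H (a + u)) has_real_derivative \<beta> (a + u) * 1) (at u)"
      by (rule DERIV_chain2[OF DERIV_H]) (auto intro!: derivative_eq_intros)
    then show "((\<lambda>u. H (a + u)) has_vector_derivative \<beta> (a + u)) (at u within {0..\<tau>})"
      by (simp add: has_real_derivative_iff_has_vector_derivative has_vector_derivative_at_within)
  qed
  then show ?thesis by (simp add: integral_unique S_def exp_diff[symmetric])
qed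

text \<open>Bridge from the gauge integrals of the definition to the Lebesgue integral in
  \<open>conv\<close>: since \<open>\<phi>\<close> is continuous, the integrand is continuous on a
  compact interval, where the two integrals agree.\<close>

lemma renewal_rhs_eq:
  assumes \<phi>: "continuous_on {0..} \<phi>" and "0 \<le> t" "0 \<le> a"
  shows "f (a + t) * exp (- integral {0..t} (\<lambda>u. \<beta> (a + u)))
      + integral {0..t} (\<lambda>\<tau>. exp (- integral {0..\<tau>} (\<lambda>u. \<beta> (a + u))) * \<beta> (a + \<tau>) * \<phi> (t - \<tau>))
    = (g f (a + t) + conv \<phi> a t) / S a"
proof -
  have cont: "continuous_on {0..t} (\<lambda>\<tau>. \<psi> (a + \<tau>) * \<phi> (t - \<tau>))"
    by (intro continuous_on_mult continuous_on_compose2[OF continuous_\<psi>[of UNIV]]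
        continuous_on_compose2[OF \<phi>] continuous_intros) auto
  have "conv \<phi> a t = (\<integral>\<tau>. indicator {0..t} \<tau> *\<^sub>R (\<psi> (a + \<tau>) * \<phi> (t - \<tau>)) \<partial>lborel)"
    unfolding conv_def
    by (subst lborel_integral_real_affine[of "-1" _ t])
      (auto intro!: Bochner_Integration.integral_cong simp: indicator_def algebra_simps)
  also have "\<dots> = integral {0..t} (\<lambda>\<tau>. \<psi> (a + \<tau>) * \<phi> (t - \<tau>))"
    using set_borel_integral_eq_integral(2)[of "{0..t}" "\<lambda>\<tau>. \<psi> (a + \<tau>) * \<phi> (t - \<tau>)"]
      borel_integrable_compact[OF compact_Icc cont]
    by (simp add: set_integrable_def set_lebesgue_integral_def)
  finally have "conv \<phi> a t / S a = integral {0..t} (\<lambda>\<tau>. \<psi> (a + \<tau>) * \<phi> (t - \<tau>) / S a)"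
    by simp
  also have "\<dots> = integral {0..t} (\<lambda>\<tau>. exp (- integral {0..\<tau>} (\<lambda>u. \<beta> (a + u))) * \<beta> (a + \<tau>) * \<phi> (t - \<tau>))"
    by (intro Henstock_Kurzweil_Integration.integral_cong) (simp add: exp_integral_shift \<psi>_def)
  finally show ?thesis
    using assms by (simp add: exp_integral_shift g_def add_divide_distrib)
qed

context
  fixes f :: "real \<Rightarrow> real" and C :: real
  assumes f: "continuous_on {0..} f" and f_bound: "\<And>x. 0 \<le> x \<Longrightarrow> \<bar>f x\<bar> \<le> C"
begin

lemma continuous_nonneg_measurable: "f \<in> borel_measurable borel_nonneg"
  using borel_measurable_continuous_on_restrict[OF f] by (simp add: borel_nonneg_def)

lemma continuous_U: "continuous_on ({0..} \<times> {0..}) (\<lambda>(t, a). U f t a)"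
proof -
  have "continuous_on ({0..} \<times> {0..}) (\<lambda>p. f (snd p + fst p) * S (snd p + fst p))"
    by (intro continuous_on_mult continuous_on_compose2[OF f] continuous_on_compose2[OF continuous_S[of UNIV]]
        continuous_intros) auto
  then have "continuous_on ({0..} \<times> {0..}) (\<lambda>p. g f (snd p + fst p))"
    by (rule continuous_on_cong[THEN iffD1, rotated 2]) (auto simp: g_def)
  moreover have "continuous_on ({0..} \<times> {0..}) (\<lambda>p. case (snd p, fst p) of (a, t) \<Rightarrow> conv (\<Phi> f) a t)"
    by (intro continuous_on_compose2[OF continuous_conv[OF \<Phi>_measurable[OF continuous_nonneg_measurable f_bound]
            \<Phi>_bound[OF continuous_nonneg_measurable f_bound]]] continuous_intros) auto
  moreover have "continuous_on ({0..} \<times> {0..}) (\<lambda>p::real \<times> real. S (snd p))"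
    by (intro continuous_on_compose2[OF continuous_S[of UNIV]] continuous_intros) auto
  ultimately have "continuous_on ({0..} \<times> {0..})
      (\<lambda>p. (g f (snd p + fst p) + conv (\<Phi> f) (snd p) (fst p)) / S (snd p))"
    by (auto intro!: continuous_intros)
  then show ?thesis by (simp add: U_def case_prod_unfold)
qed

lemma renewal_solution_U:
  "renewal_solution \<beta> f (restrict (\<lambda>(t, a). U f t a) ({0..} \<times> {0..}))" (is "renewal_solution _ _ ?F")
  unfolding renewal_solution_def
proof (intro conjI allI impI)
  show "continuous_on ({0..} \<times> {0..}) ?F"
    using continuous_U by (rule continuous_on_cong[THEN iffD1, rotated 2]) auto
  show "bounded (?F ` ({0..} \<times> {0..}))"
    using U_bound[OF continuous_nonneg_measurable f_bound] by (auto intro!: boundedI[where B = C])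
  fix t a :: real
  assume ta: "0 \<le> t" "0 \<le> a"
  have cont0: "continuous_on {0..} (\<lambda>s. ?F (s, 0))"
  proof (rule continuous_on_cong[THEN iffD1])
    show "continuous_on {0..} (\<lambda>s. case (s, 0) of (t, a) \<Rightarrow> U f t a)"
      by (rule continuous_on_compose2[OF continuous_U]) (auto intro!: continuous_intros)
  qed auto
  have "conv (\<lambda>s. ?F (s, 0)) a t = conv (\<Phi> f) a t"
    using \<Phi>_eq_U[OF continuous_nonneg_measurable f_bound] by (intro conv_cong) auto
  then show "?F (t, a) = f (a + t) * exp (- integral {0..t} (\<lambda>u. \<beta> (a + u)))
      + integral {0..t} (\<lambda>\<tau>. exp (- integral {0..\<tau>} (\<lambda>u. \<beta> (a + u))) * \<beta> (a + \<tau>) * ?F (t - \<tau>, 0))"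
    using renewal_rhs_eq[OF cont0 ta, of f] ta by (simp add: U_def)
qed (rule restrict_extensional)

text \<open>At age 0 the equation is the Volterra equation of the trace, which determines F (t, 0).
  The equation at age a involves \<open>F\<close> on the right only through this trace, and
  extensionality settles the values outside the quadrant.\<close>

lemma renewal_solution_unique:
  assumes F: "renewal_solution \<beta> f F"
  shows "F = restrict (\<lambda>(t, a). U f t a) ({0..} \<times> {0..})"
proof -
  have cont: "continuous_on ({0..} \<times> {0..}) F" and ext: "F \<in> extensional ({0..} \<times> {0..})"
    and bdd: "bounded (F ` ({0..} \<times> {0..}))"
    and eq: "\<And>t a. 0 \<le> t \<Longrightarrow> 0 \<le> a \<Longrightarrow> F (t, a) = f (a + t) * exp (- integral {0..t} (\<lambda>u. \<beta> (a + u)))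
      + integral {0..t} (\<lambda>\<tau>. exp (- integral {0..\<tau>} (\<lambda>u. \<beta> (a + u))) * \<beta> (a + \<tau>) * F (t - \<tau>, 0))"
    using F unfolding renewal_solution_def by blast+
  have cont0: "continuous_on {0..} (\<lambda>s. F (s, 0))"
    by (intro continuous_on_compose2[OF cont] continuous_intros) auto
  \<comment> \<open>Continuity is known on the half-line only; the cut-off yields a Borel function
    on the whole line.\<close>
  define \<phi> where "\<phi> s = indicator {0..} s *\<^sub>R F (s, 0)" for s
  have F_eq: "F (t, a) = (g f (a + t) + conv \<phi> a t) / S a" if "0 \<le> t" "0 \<le> a" for t a
    unfolding eq[OF that] renewal_rhs_eq[OF cont0 that]
    by (simp add: conv_cong[of t "\<lambda>s. F (s, 0)" \<phi>] \<phi>_def)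
  obtain D where D: "\<And>p. p \<in> {0..} \<times> {0..} \<Longrightarrow> \<bar>F p\<bar> \<le> D"
    using bdd by (auto simp: bounded_iff)
  have \<Phi>: "\<Phi> f s = \<phi> s" if "0 \<le> s" for s
  proof (rule \<Phi>_unique[OF continuous_nonneg_measurable f_bound _ _ _ that])
    show "\<phi> \<in> borel_measurable borel"
      unfolding \<phi>_def[abs_def] by (intro borel_measurable_continuous_on_indicator cont0) auto
    show "\<bar>\<phi> s\<bar> \<le> D" if "0 \<le> s" for s using D[of "(s, 0)"] that by (simp add: \<phi>_def)
    show "\<phi> t = g f t + conv \<phi> 0 t" if "0 \<le> t" for t
      using F_eq[OF that order_refl] that by (simp add: \<phi>_def)
  qed
  have "F (t, a) = U f t a" if "0 \<le> t" "0 \<le> a" for t a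
    unfolding F_eq[OF that] U_def using \<Phi> by (simp add: conv_cong[of t "\<Phi> f" \<phi>])
  then show ?thesis
    using ext by (intro extensionalityI[OF ext restrict_extensional]) auto
qed

lemma renewal_semigroup_eq_U: "0 \<le> t \<Longrightarrow> 0 \<le> a \<Longrightarrow> renewal_semigroup \<beta> t f a = U f t a"
  unfolding renewal_semigroup_def
  using the_equality[of "renewal_solution \<beta> f", OF renewal_solution_U renewal_solution_unique] by simp

end

end

locale coercive_renewal = renewal +
  fixes a_star \<beta>_min :: real
  assumes a_star_pos: "0 < a_star" and \<beta>_min_pos: "0 < \<beta>_min"
    and \<beta>_ge: "a_star \<le> a \<Longrightarrow> \<beta>_min \<le> \<beta> a"
begin

section \<open>Doeblin minorisation\<close>

lemma \<beta>_min_le_max: "\<beta>_min \<le> \<beta>_max"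
  using \<beta>_ge[of a_star] \<beta>_le[of a_star] by simp

text \<open>Put T = a_star + \<eta> and keep only the histories with a renewal when time s in
  [0, \<eta>] is left, followed by no other; this is allowed because f \<ge> 0. Such a renewal
  happens at age a + T - s \<ge> a_star, hence at rate at least \<beta>_min, and the newborn ends at
  age s. Survival is required for the times T - s and s, so the two factors multiply to at least exp
  (- \<beta>_max * T), independently of a and s.\<close>

lemma U_minorisation:
  assumes f: "f \<in> bounded_measurable borel_nonneg" and nonneg: "\<And>x. 0 \<le> x \<Longrightarrow> 0 \<le> f x"
    and "0 < \<eta>" "0 \<le> a"
  shows "\<beta>_min * exp (- \<beta>_max * (a_star + \<eta>)) * (\<integral>s. indicator {0..\<eta>} s * f s \<partial>lborel)
    \<le> U f (a_star + \<eta>) a"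
proof -
  obtain C where C: "f \<in> borel_measurable borel_nonneg" "\<And>x. 0 \<le> x \<Longrightarrow> \<bar>f x\<bar> \<le> C"
    using f by (rule bounded_measurable_nonnegE) (rule that)
  define T where "T = a_star + \<eta>"
  have T: "0 \<le> T" using a_star_pos assms by (simp add: T_def)
  let ?k = "\<beta>_min * exp (- \<beta>_max * T)"
  \<comment> \<open>The inner indicator is redundant as a value, but it is the form in which
    measurability of \<open>f\<close> on the half-line transfers to the line.\<close>
  define h where "h s = indicator {0..\<eta>} s * (indicator {0..} s * f s)" for s
  have h_meas [measurable]: "h \<in> borel_measurable borel"
    using C(1) unfolding h_def[abs_def] measurable_borel_nonneg_iff by measurable
  have h_bound: "\<bar>h s\<bar> \<le> C" for s
    using C(2)[of s] C(2)[of 0] by (auto simp: h_def indicator_def)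
  have h_eq: "h = (\<lambda>s. indicator {0..\<eta>} s * f s)" by (auto simp: h_def indicator_def fun_eq_iff)
  have h_nonneg: "0 \<le> h s" for s using nonneg[of s] by (auto simp: h_def indicator_def)
  have hS_meas: "(\<lambda>s. h s * S s) \<in> borel_measurable borel" by measurable
  have hS_bound: "\<bar>h s * S s\<bar> \<le> C" if "0 \<le> s" for s
    using mult_mono[OF h_bound S_le_1[OF that], of s] C(2)[of 0] by (simp add: abs_mult)
  have hS_le: "h s * S s \<le> \<Phi> f s" if "0 \<le> s" for s
  proof -
    have "h s * S s \<le> g f s"
      using nonneg[OF that] that by (auto simp: h_def g_def indicator_def)
    also have "\<dots> \<le> \<Phi> f s"
      by (subst \<Phi>_eq[OF C], assumption) (use \<Phi>_nonneg[OF C nonneg] in \<open>auto intro: conv_nonneg\<close>)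
    finally show ?thesis .
  qed
  \<comment> \<open>The factor \<open>S a\<close> anticipates the division in
    \<open>U\<close>.\<close>
  have "S a * (?k * (\<integral>s. h s \<partial>lborel)) = (\<integral>s. S a * ?k * h s \<partial>lborel)"
    by simp
  also have "\<dots> \<le> conv (\<lambda>s. h s * S s) a T"
    unfolding conv_def
  proof (rule integral_mono)
    have "integrable lborel (\<lambda>s. indicator {0..\<eta>} s *\<^sub>R h s)"
      using h_bound \<open>0 < \<eta>\<close> by (intro integrableI_bounded_set_indicator[where B = C]) auto
    moreover have "(\<lambda>s. indicator {0..\<eta>} s *\<^sub>R h s) = h"
      by (auto simp: h_def indicator_def fun_eq_iff)
    ultimately have "integrable lborel h" by simp
    then show "integrable lborel (\<lambda>s. S a * ?k * h s)" by simp
    show "integrable lborel (\<lambda>s. indicator {0..T} s * (\<psi> (a + T - s) * (h s * S s)))"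
      by (rule conv_integrable[OF hS_meas \<open>0 \<le> a\<close> hS_bound])
    fix s
    show "S a * ?k * h s \<le> indicator {0..T} s * (\<psi> (a + T - s) * (h s * S s))"
    proof (cases "s \<in> {0..\<eta>}")
      case True
      have "S a * exp (- \<beta>_max * (T - s)) * exp (- \<beta>_max * s) \<le> S (a + T - s) * S s"
        using S_ge[of a "a + T - s"] S_ge[of 0 s] True a_star_pos
        by (intro mult_mono) (auto simp: T_def algebra_simps)
      moreover have "exp (- \<beta>_max * (T - s)) * exp (- \<beta>_max * s) = exp (- \<beta>_max * T)"
        by (simp add: exp_add[symmetric] algebra_simps)
      ultimately have "S a * exp (- \<beta>_max * T) \<le> S (a + T - s) * S s"
        by (simp add: mult.assoc)
      moreover have "\<beta>_min \<le> \<beta> (a + T - s)"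
        using True \<open>0 \<le> a\<close> by (intro \<beta>_ge) (auto simp: T_def)
      ultimately have "\<beta>_min * (S a * exp (- \<beta>_max * T)) \<le> \<beta> (a + T - s) * (S (a + T - s) * S s)"
        using \<beta>_min_pos by (rule_tac mult_mono) (auto simp: \<beta>_nonneg)
      then have "\<beta>_min * (S a * exp (- \<beta>_max * T)) * h s \<le> \<beta> (a + T - s) * (S (a + T - s) * S s) * h s"
        by (rule mult_right_mono) (rule h_nonneg)
      then show ?thesis
        using True a_star_pos by (simp add: \<psi>_def T_def mult_ac)
    next
      case False
      then show ?thesis by (simp add: h_eq)
    qed
  qed
  also have "\<dots> \<le> conv (\<Phi> f) a T"
    using \<Phi>_measurable[OF C] \<Phi>_bound[OF C] hS_le
    by (intro conv_mono[OF hS_meas hS_bound _ _ \<open>0 \<le> a\<close>]) auto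
  also have "\<dots> \<le> g f (a + T) + conv (\<Phi> f) a T"
    using g_nonneg[OF nonneg] by simp
  finally have "?k * (\<integral>s. h s \<partial>lborel) \<le> U f T a"
    by (simp add: U_def pos_le_divide_eq mult.commute)
  then show ?thesis by (simp add: T_def h_eq)
qed

text \<open>The minorisation is applied to f - lo and to hi - f. Both resulting bounds contain the
  same term k * m, where \<open>m\<close> is the integral over [0, \<eta>] without normalisation; it
  cancels in their difference, which leaves the factor 1 - k * \<eta>.\<close>

lemma U_oscillation:
  assumes f: "f \<in> bounded_measurable borel_nonneg"
    and lo: "\<And>x. 0 \<le> x \<Longrightarrow> lo \<le> f x" and hi: "\<And>x. 0 \<le> x \<Longrightarrow> f x \<le> hi" and "0 < \<eta>"
  obtains lo' hi' where
    "hi' - lo' = (1 - \<eta> * \<beta>_min * exp (- \<beta>_max * (a_star + \<eta>))) * (hi - lo)"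
    "\<And>a. 0 \<le> a \<Longrightarrow> lo' \<le> U f (a_star + \<eta>) a" "\<And>a. 0 \<le> a \<Longrightarrow> U f (a_star + \<eta>) a \<le> hi'"
proof -
  define T k where "T = a_star + \<eta>" and "k = \<beta>_min * exp (- \<beta>_max * T)"
  have T: "0 \<le> T" using a_star_pos assms by (simp add: T_def)
  obtain C where C: "f \<in> borel_measurable borel_nonneg" "\<And>x. 0 \<le> x \<Longrightarrow> \<bar>f x\<bar> \<le> C"
    using f by (rule bounded_measurable_nonnegE) (rule that)
  define m where "m = (\<integral>s. indicator {0..\<eta>} s * f s \<partial>lborel)"
  have f_int: "integrable lborel (\<lambda>s. indicator {0..\<eta>} s * f s)"
  proof -
    have "(\<lambda>s. indicator {0..} s * f s) \<in> borel_measurable lborel"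
      using C(1) by (simp add: measurable_borel_nonneg_iff)
    then have "integrable lborel (\<lambda>s. indicator {0..\<eta>} s *\<^sub>R (indicator {0..} s * f s))"
      using C(2) \<open>0 < \<eta>\<close> by (intro integrableI_bounded_set_indicator[where B = C]) auto
    moreover have "(\<lambda>s. indicator {0..\<eta>} s *\<^sub>R (indicator {0..} s * f s)) = (\<lambda>s. indicator {0..\<eta>} s * f s)"
      by (auto simp: indicator_def fun_eq_iff)
    ultimately show ?thesis by simp
  qed
  have int_lin: "(\<integral>s. indicator {0..\<eta>} s * (q + p * f s) \<partial>lborel) = \<eta> * q + p * m" for p q
  proof -
    have "(\<integral>s. indicator {0..\<eta>} s * (q + p * f s) \<partial>lborel)
      = (\<integral>s. indicator {0..\<eta>} s * q + p * (indicator {0..\<eta>} s * f s) \<partial>lborel)"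
      by (simp add: algebra_simps)
    also have "\<dots> = (\<integral>s. indicator {0..\<eta>} s * q \<partial>lborel) + p * m"
      using f_int integrable_indicator_Icc[of 0 \<eta> q] by (simp add: m_def)
    also have "(\<integral>s. indicator {0..\<eta>} s * q \<partial>lborel) = \<eta> * q"
      using \<open>0 < \<eta>\<close> by simp
    finally show ?thesis .
  qed
  \<comment> \<open>One estimate for both bounds: q = - lo, p = 1 gives the lower one and q = hi, p
    = - 1 the upper one.\<close>
  have key: "k * (\<eta> * q + p * m) \<le> q + p * U f T a"
    if "\<And>x. 0 \<le> x \<Longrightarrow> 0 \<le> q + p * f x" "0 \<le> a" for p q a
  proof -
    have "(\<lambda>x. q + p * f x) \<in> bounded_measurable borel_nonneg"
      by (intro bounded_measurable_add bounded_measurable_const bounded_measurable_cmult f)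
    from U_minorisation[OF this that(1) \<open>0 < \<eta>\<close> that(2)]
    have "k * (\<eta> * q + p * m) \<le> U (\<lambda>x. q + p * f x) T a"
      by (simp add: int_lin k_def T_def)
    also have "\<dots> = q + p * U f T a"
      using U_lincomb[OF bounded_measurable_const[of q] f T that(2)] U_const[OF T that(2)] by simp
    finally show ?thesis .
  qed
  show ?thesis
  proof (rule that[of "hi - k * (\<eta> * hi - m)" "lo + k * (m - \<eta> * lo)"])
    show "hi - k * (\<eta> * hi - m) - (lo + k * (m - \<eta> * lo))
        = (1 - \<eta> * \<beta>_min * exp (- \<beta>_max * (a_star + \<eta>))) * (hi - lo)"
      by (simp add: k_def T_def algebra_simps)
    fix a :: real assume "0 \<le> a"
    show "lo + k * (m - \<eta> * lo) \<le> U f (a_star + \<eta>) a"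
      using key[of "- lo" 1 a] lo \<open>0 \<le> a\<close> by (simp add: T_def algebra_simps)
    show "U f (a_star + \<eta>) a \<le> hi - k * (\<eta> * hi - m)"
      using key[of hi "- 1" a] hi \<open>0 \<le> a\<close> by (simp add: T_def algebra_simps)
  qed
qed

text \<open>The remainder s runs first and merely keeps the values in [0, 1]; each of the n full
  periods then contributes one factor. The bounds move with n and only their distance is controlled,
  which is enough against a measure of mass 0.\<close>

lemma U_oscillation_iterate:
  assumes f: "f \<in> bounded_measurable borel_nonneg"
    and lo: "\<And>x. 0 \<le> x \<Longrightarrow> 0 \<le> f x" and hi: "\<And>x. 0 \<le> x \<Longrightarrow> f x \<le> 1" and "0 < \<eta>" and "0 \<le> s"
  shows "\<exists>lo hi. hi - lo = (1 - \<eta> * \<beta>_min * exp (- \<beta>_max * (a_star + \<eta>))) ^ n \<and>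
    (\<forall>a\<ge>0. lo \<le> U f (real n * (a_star + \<eta>) + s) a \<and> U f (real n * (a_star + \<eta>) + s) a \<le> hi)"
proof (induction n)
  case 0
  have f': "f \<in> borel_measurable borel_nonneg" "\<And>x. 0 \<le> x \<Longrightarrow> \<bar>f x\<bar> \<le> 1"
    using bounded_measurableD(1)[OF f] lo hi by auto
  have "0 \<le> U f s a \<and> U f s a \<le> 1" if "0 \<le> a" for a
    using U_nonneg[OF f' lo] U_bound[OF f' \<open>0 \<le> s\<close> that] by (simp add: abs_le_iff)
  then show ?case by (intro exI[of _ 0] exI[of _ 1]) simp
next
  case (Suc n)
  define r where "r = real n * (a_star + \<eta>) + s"
  have r: "0 \<le> r" "0 \<le> a_star + \<eta>" using assms a_star_pos by (auto simp: r_def)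
  obtain C where C: "f \<in> borel_measurable borel_nonneg" "\<And>x. 0 \<le> x \<Longrightarrow> \<bar>f x\<bar> \<le> C"
    using f by (rule bounded_measurable_nonnegE) (rule that)
  obtain lo hi where IH: "hi - lo = (1 - \<eta> * \<beta>_min * exp (- \<beta>_max * (a_star + \<eta>))) ^ n"
    "\<And>a. 0 \<le> a \<Longrightarrow> lo \<le> U f r a" "\<And>a. 0 \<le> a \<Longrightarrow> U f r a \<le> hi"
    using Suc.IH[folded r_def] by metis
  have bm: "U f r \<in> bounded_measurable borel_nonneg"
    using C r by (intro U_bounded_measurable)
  obtain lo' hi' where step:
    "hi' - lo' = (1 - \<eta> * \<beta>_min * exp (- \<beta>_max * (a_star + \<eta>))) * (hi - lo)"
    "\<And>a. 0 \<le> a \<Longrightarrow> lo' \<le> U (U f r) (a_star + \<eta>) a" "\<And>a. 0 \<le> a \<Longrightarrow> U (U f r) (a_star + \<eta>) a \<le> hi'"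
  proof (rule U_oscillation[of "U f r" lo hi \<eta>, OF bm])
    show "lo \<le> U f r x" "U f r x \<le> hi" if "0 \<le> x" for x by (rule IH(2,3)[OF that])+
  qed (rule \<open>0 < \<eta>\<close>, rule that)
  have eq: "U f (real (Suc n) * (a_star + \<eta>) + s) a = U (U f r) (a_star + \<eta>) a" if "0 \<le> a" for a
    using U_semigroup[OF f r that] by (simp add: r_def algebra_simps)
  show ?case
  proof (intro exI conjI allI impI)
    show "hi' - lo' = (1 - \<eta> * \<beta>_min * exp (- \<beta>_max * (a_star + \<eta>))) ^ Suc n"
      unfolding step(1) IH(1) by simp
  qed (simp_all only: eq step)
qed

text \<open>The upper bound follows from \<eta> * \<beta>_min \<le> \<beta>_max * \<eta> and x < exp
  x. It makes 1 - c positive, as the logarithm in the rate requires.\<close>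

lemma minorisation_constant_bounds:
  assumes "0 < \<eta>"
  shows "0 < \<eta> * \<beta>_min * exp (- \<beta>_max * (a_star + \<eta>))" "\<eta> * \<beta>_min * exp (- \<beta>_max * (a_star + \<eta>)) < 1"
proof -
  show "0 < \<eta> * \<beta>_min * exp (- \<beta>_max * (a_star + \<eta>))" using assms \<beta>_min_pos by simp
  have "\<eta> * \<beta>_min < exp (\<beta>_max * \<eta>)"
  proof -
    have "\<eta> * \<beta>_min \<le> \<beta>_max * \<eta>"
      using \<beta>_min_le_max assms by (simp add: mult.commute)
    also have "\<dots> < exp (\<beta>_max * \<eta>)"
      using exp_ge_add_one_self[of "\<beta>_max * \<eta>"] by linarith
    finally show ?thesis .
  qed
  also have "\<dots> \<le> exp (\<beta>_max * (a_star + \<eta>))"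
    using a_star_pos \<beta>_max_nonneg by (simp add: algebra_simps)
  finally have "\<eta> * \<beta>_min * inverse (exp (\<beta>_max * (a_star + \<eta>))) < 1"
    by (simp add: pos_divide_less_eq flip: divide_inverse)
  then show "\<eta> * \<beta>_min * exp (- \<beta>_max * (a_star + \<eta>)) < 1"
    by (simp only: exp_minus mult_minus_left)
qed

section \<open>The invariant measure\<close>

text \<open>Beyond \<open>a_star\<close> the function \<open>H\<close> grows at rate at least
  \<beta>_min; before it S \<le> 1, and the prefactor is chosen so that the right-hand side is at
  least 1 there. Integrability of \<open>S\<close> and its decay rest on this.\<close>

lemma S_le_exp:
  assumes "0 \<le> x"
  shows "S x \<le> exp (\<beta>_min * a_star) * exp (- (\<beta>_min * x))"
proof (cases "a_star \<le> x")
  case True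
  have "H a_star - \<beta>_min * a_star \<le> H x - \<beta>_min * x"
    using True
  proof (rule DERIV_nonneg_imp_nondecreasing)
    fix z assume "a_star \<le> z"
    moreover have "((\<lambda>z. H z - \<beta>_min * z) has_real_derivative \<beta> z - \<beta>_min) (at z)"
      by (auto intro!: derivative_eq_intros DERIV_H)
    ultimately show "\<exists>d. ((\<lambda>z. H z - \<beta>_min * z) has_real_derivative d) (at z) \<and> 0 \<le> d"
      using \<beta>_ge[of z] by force
  qed
  then show ?thesis
    using H_mono[of 0 a_star] a_star_pos by (simp add: S_def flip: exp_add)
next
  case False
  then have "0 \<le> \<beta>_min * a_star - \<beta>_min * x"
    using \<beta>_min_pos by (simp flip: right_diff_distrib)
  then have "1 \<le> exp (\<beta>_min * a_star) * exp (- (\<beta>_min * x))"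
    by (simp flip: exp_add)
  then show ?thesis using S_le_1[OF assms] by linarith
qed

lemma exp_tendsto_0: "((\<lambda>x. k * exp (- (\<beta>_min * x))) \<longlongrightarrow> 0) at_top"
proof -
  have "LIM x at_top. - (\<beta>_min * x) :> at_bot"
    unfolding filterlim_uminus_at_bot minus_minus
    by (rule filterlim_tendsto_pos_mult_at_top[OF tendsto_const \<beta>_min_pos filterlim_ident])
  then have "((\<lambda>x. k * exp (- (\<beta>_min * x))) \<longlongrightarrow> k * 0) at_top"
    by (intro tendsto_mult tendsto_const filterlim_compose[OF exp_at_bot])
  then show ?thesis by simp
qed

lemma S_tendsto_0: "(S \<longlongrightarrow> 0) at_top"
proof (rule tendsto_sandwich[OF _ _ tendsto_const exp_tendsto_0])
  show "\<forall>\<^sub>F x in at_top. S x \<le> exp (\<beta>_min * a_star) * exp (- (\<beta>_min * x))"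
    using eventually_ge_at_top[of 0] by eventually_elim (rule S_le_exp)
  show "\<forall>\<^sub>F x in at_top. 0 \<le> S x" by simp
qed

lemma S_integrable: "integrable lborel (\<lambda>x. indicator {0..} x * S x)"
proof (rule integrableI_nonneg)
  have "(\<integral>\<^sup>+x. ennreal (indicator {0..} x * S x) \<partial>lborel)
      \<le> (\<integral>\<^sup>+x. ennreal (exp (\<beta>_min * a_star) * exp (- (\<beta>_min * x))) * indicator {0..} x \<partial>lborel)"
    using S_le_exp by (intro nn_integral_mono) (auto simp: indicator_def intro!: ennreal_leI)
  also have "\<dots> = 0 - (- exp (\<beta>_min * a_star) / \<beta>_min * exp (- (\<beta>_min * 0)))"
  proof (rule nn_integral_FTC_atLeast)
    show "((\<lambda>x. - exp (\<beta>_min * a_star) / \<beta>_min * exp (- (\<beta>_min * x))) has_real_derivative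
        exp (\<beta>_min * a_star) * exp (- (\<beta>_min * x))) (at x)" for x
      using \<beta>_min_pos by (auto intro!: derivative_eq_intros)
    show "((\<lambda>x. - exp (\<beta>_min * a_star) / \<beta>_min * exp (- (\<beta>_min * x))) \<longlongrightarrow> 0) at_top"
      by (rule exp_tendsto_0)
  qed auto
  finally show "(\<integral>\<^sup>+x. ennreal (indicator {0..} x * S x) \<partial>lborel) < \<infinity>"
    by (rule order.strict_trans1) simp
qed auto

lemma S_has_integral: "(S has_integral (\<integral>x. indicator {0..} x * S x \<partial>lborel)) {0..}"
proof -
  have int: "set_integrable lborel {0..} S"
    using S_integrable by (simp add: set_integrable_def)
  show ?thesis
    using integrable_integral[OF set_borel_integral_eq_integral(1)[OF int]]
      set_borel_integral_eq_integral(2)[OF int]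
    by (simp add: set_lebesgue_integral_def)
qed

lemma S_integral_pos: "0 < (\<integral>x. indicator {0..} x * S x \<partial>lborel)"
proof -
  have "(\<integral>x. indicator {0..1::real} x * S 1 \<partial>lborel) \<le> (\<integral>x. indicator {0..} x * S x \<partial>lborel)"
    by (intro integral_mono integrable_indicator_Icc S_integrable)
      (auto simp: indicator_def S_antimono)
  moreover have "(\<integral>x. indicator {0..1::real} x * S 1 \<partial>lborel) = S 1" by simp
  ultimately show ?thesis using S_pos[of 1] by linarith
qed

text \<open>The integral of \<open>S\<close> is finite and positive, so linearity forces the
  normalising constant; the uniqueness part is what the \<open>THE\<close> in the definition
  demands.\<close>

lemma stationary_constant_eq: "stationary_constant \<beta> = 1 / (\<integral>x. indicator {0..} x * S x \<partial>lborel)"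
  unfolding stationary_constant_def
proof (rule the_equality)
  let ?I = "\<integral>x. indicator {0..} x * S x \<partial>lborel"
  have iff: "((\<lambda>a. k * exp (- integral {0..a} \<beta>)) has_integral J) {0..} \<longleftrightarrow> ((\<lambda>a. k * S a) has_integral J) {0..}"
    for k J
    by (intro has_integral_cong) (simp add: S_def H_eq_integral)
  show "0 < 1 / ?I \<and> ((\<lambda>a. 1 / ?I * exp (- integral {0..a} \<beta>)) has_integral 1) {0..}"
    unfolding iff using has_integral_mult_right[OF S_has_integral, of "1 / ?I"] S_integral_pos by simp
  fix k assume "0 < k \<and> ((\<lambda>a. k * exp (- integral {0..a} \<beta>)) has_integral 1) {0..}"
  then have "((\<lambda>a. k * S a) has_integral 1) {0..}" unfolding iff by blast
  then have "k * ?I = 1"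
    using has_integral_mult_right[OF S_has_integral, of k] has_integral_unique by blast
  then show "k = 1 / ?I" using S_integral_pos by (simp add: field_simps)
qed

lemma sets_invariant_measure: "sets (invariant_measure \<beta>) = sets borel_nonneg"
  by (simp add: invariant_measure_def borel_nonneg_def sets_restrict_space)

text \<open>Reduces invariance to an identity between integrals against the weight \<open>S\<close>.
  The nonnegative integral is used so that Tonelli's theorem applies there without integrability
  conditions.\<close>

lemma nn_integral_invariant_measure:
  assumes h: "h \<in> borel_measurable borel_nonneg" and nonneg: "\<And>x. 0 \<le> x \<Longrightarrow> 0 \<le> h x"
  shows "(\<integral>\<^sup>+x. ennreal (h x) \<partial>invariant_measure \<beta>)
    = ennreal (stationary_constant \<beta>) * (\<integral>\<^sup>+x. ennreal (indicator {0..} x * (S x * h x)) \<partial>lborel)"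
proof -
  let ?N = "stationary_constant \<beta>"
  let ?R = "restrict_space lborel {0..} :: real measure"
  have N: "0 < ?N" using S_integral_pos by (simp add: stationary_constant_eq)
  have sets: "sets ?R = sets borel_nonneg" by (simp add: borel_nonneg_def sets_restrict_space)
  have eq: "exp (- integral {0..a} \<beta>) = S a" if "0 \<le> a" for a
    using that by (simp add: S_def H_eq_integral)
  have S_meas: "S \<in> borel_measurable ?R"
    by (intro measurable_restrict_space1) simp
  have dens: "(\<lambda>a. ennreal (?N * exp (- integral {0..a} \<beta>))) \<in> borel_measurable ?R"
  proof (rule measurable_cong[THEN iffD1])
    show "(\<lambda>a. ennreal (?N * S a)) \<in> borel_measurable ?R" using S_meas by measurable
  qed (simp add: space_restrict_space eq)
  have "(\<integral>\<^sup>+x. ennreal (h x) \<partial>invariant_measure \<beta>)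
    = (\<integral>\<^sup>+x. ennreal (?N * exp (- integral {0..x} \<beta>)) * ennreal (h x) \<partial>?R)"
    unfolding invariant_measure_def
    using h by (intro nn_integral_density dens measurable_compose[OF _ measurable_ennreal])
      (simp add: measurable_cong_sets[OF sets refl])
  also have "\<dots> = (\<integral>\<^sup>+x. ennreal (?N * exp (- integral {0..x} \<beta>)) * ennreal (h x) * indicator {0..} x \<partial>lborel)"
    by (rule nn_integral_restrict_space) simp
  also have "\<dots> = (\<integral>\<^sup>+x. ennreal ?N * ennreal (indicator {0..} x * (S x * h x)) \<partial>lborel)"
    using N nonneg by (intro nn_integral_cong) (auto simp: indicator_def eq ennreal_mult' mult.assoc)
  also have "\<dots> = ennreal ?N * (\<integral>\<^sup>+x. ennreal (indicator {0..} x * (S x * h x)) \<partial>lborel)"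
  proof (rule nn_integral_cmult)
    have "(\<lambda>x. S x * (indicator {0..} x * h x)) \<in> borel_measurable borel"
      using h unfolding measurable_borel_nonneg_iff by measurable
    then show "(\<lambda>x. ennreal (indicator {0..} x * (S x * h x))) \<in> borel_measurable lborel"
      by (simp add: mult.left_commute)
  qed
  finally show ?thesis .
qed

lemma emeasure_invariant_measure_space: "emeasure (invariant_measure \<beta>) (space (invariant_measure \<beta>)) = 1"
proof -
  let ?I = "\<integral>x. indicator {0..} x * S x \<partial>lborel"
  have "emeasure (invariant_measure \<beta>) (space (invariant_measure \<beta>))
      = (\<integral>\<^sup>+x. ennreal 1 \<partial>invariant_measure \<beta>)"
    by simp
  also have "\<dots> = ennreal (1 / ?I) * ennreal ?I"
    using S_integrable
    by (subst nn_integral_invariant_measure) (auto simp: stationary_constant_eq nn_integral_eq_integral)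
  also have "\<dots> = 1"
    using S_integral_pos by (simp flip: ennreal_mult)
  finally show ?thesis .
qed

lemma finite_invariant_measure: "finite_measure (invariant_measure \<beta>)"
  by (intro finite_measureI) (simp add: emeasure_invariant_measure_space)

lemma ennreal_conv:
  assumes "\<phi> \<in> borel_measurable borel" "0 \<le> a" "\<And>s. \<bar>\<phi> s\<bar> \<le> C" "\<And>s. 0 \<le> \<phi> s"
  shows "ennreal (conv \<phi> a t) = (\<integral>\<^sup>+s. ennreal (indicator {0..t} s * (\<psi> (a + t - s) * \<phi> s)) \<partial>lborel)"
  unfolding conv_def
  using assms by (intro nn_integral_eq_integral[symmetric] conv_integrable AE_I2) auto

text \<open>The mass \<open>X\<close> of \<open>\<phi>\<close> on \<open>[0, t]\<close> weighted by \<open>1 - S (t - s)\<close> occurs on both sides when the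
  renewal equation \<open>\<phi> = g + conv \<phi> 0\<close> is integrated over \<open>[0, t]\<close>, and cancels.\<close>

lemma nn_integral_S_\<Phi>:
  assumes f: "f \<in> borel_measurable borel_nonneg" and bound: "\<And>x. 0 \<le> x \<Longrightarrow> \<bar>f x\<bar> \<le> C"
    and nonneg: "\<And>x. 0 \<le> x \<Longrightarrow> 0 \<le> f x" and "0 \<le> t"
  shows "(\<integral>\<^sup>+s. ennreal (indicator {0..t} s * (S (t - s) * \<Phi> f s)) \<partial>lborel)
    = (\<integral>\<^sup>+s. ennreal (indicator {0..t} s * g f s) \<partial>lborel)"
proof -
  define \<phi> where "\<phi> = \<Phi> f"
  have [measurable]: "\<phi> \<in> borel_measurable borel" and \<phi>_bound: "\<And>s. \<bar>\<phi> s\<bar> \<le> C" and \<phi>_nonneg: "\<And>s. 0 \<le> \<phi> s"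
    unfolding \<phi>_def using \<Phi>_measurable[OF f bound] \<Phi>_bound[OF f bound] \<Phi>_nonneg[OF f bound nonneg] by auto
  have [measurable]: "g f \<in> borel_measurable borel" by (rule g_measurable[OF f])
  have conv_meas [measurable]: "conv \<phi> 0 \<in> borel_measurable borel"
    using \<phi>_bound by (intro measurable_conv_0) auto
  let ?X = "\<integral>\<^sup>+s. ennreal (indicator {0..t} s * \<phi> s * (1 - S (t - s))) \<partial>lborel"
  have \<Phi>: "\<phi> s = g f s + conv \<phi> 0 s" for s
    unfolding \<phi>_def by (rule \<Phi>_eq[OF f bound])
  have "?X + (\<integral>\<^sup>+s. ennreal (indicator {0..t} s * (S (t - s) * \<phi> s)) \<partial>lborel)
    = (\<integral>\<^sup>+s. ennreal (indicator {0..t} s * \<phi> s * (1 - S (t - s)))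
        + ennreal (indicator {0..t} s * (S (t - s) * \<phi> s)) \<partial>lborel)"
    by (rule nn_integral_add[symmetric]) measurable
  also have "\<dots> = (\<integral>\<^sup>+s. ennreal (indicator {0..t} s * \<phi> s) \<partial>lborel)"
  proof (intro nn_integral_cong)
    fix s
    show "ennreal (indicator {0..t} s * \<phi> s * (1 - S (t - s))) + ennreal (indicator {0..t} s * (S (t - s) * \<phi> s))
        = ennreal (indicator {0..t} s * \<phi> s)"
    proof (cases "s \<in> {0..t}")
      case True
      then have "ennreal (\<phi> s * (1 - S (t - s))) + ennreal (S (t - s) * \<phi> s)
          = ennreal (\<phi> s * (1 - S (t - s)) + S (t - s) * \<phi> s)"
        using \<phi>_nonneg S_le_1[of "t - s"] by (intro ennreal_plus[symmetric]) auto
      then show ?thesis using True by (simp add: algebra_simps)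
    qed simp
  qed
  also have "\<dots> = (\<integral>\<^sup>+s. ennreal (indicator {0..t} s * g f s) + ennreal (indicator {0..t} s * conv \<phi> 0 s) \<partial>lborel)"
  proof (intro nn_integral_cong)
    fix s
    have "indicator {0..t} s * \<phi> s = indicator {0..t} s * g f s + indicator {0..t} s * conv \<phi> 0 s"
      by (subst \<Phi>) (simp add: distrib_left)
    then show "ennreal (indicator {0..t} s * \<phi> s)
        = ennreal (indicator {0..t} s * g f s) + ennreal (indicator {0..t} s * conv \<phi> 0 s)"
      using g_nonneg[of f s, OF nonneg] conv_nonneg[of s \<phi> 0] \<phi>_nonneg by (simp flip: ennreal_plus)
  qed
  also have "\<dots> = (\<integral>\<^sup>+s. ennreal (indicator {0..t} s * g f s) \<partial>lborel)
      + (\<integral>\<^sup>+s. ennreal (indicator {0..t} s * conv \<phi> 0 s) \<partial>lborel)"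
    by (rule nn_integral_add) measurable
  also have "(\<integral>\<^sup>+r. ennreal (indicator {0..t} r * conv \<phi> 0 r) \<partial>lborel)
    = (\<integral>\<^sup>+r. \<integral>\<^sup>+s. ennreal (indicator {0..t} r * (indicator {0..r} s * (\<psi> (r - s) * \<phi> s))) \<partial>lborel \<partial>lborel)"
  proof (intro nn_integral_cong)
    fix r
    show "ennreal (indicator {0..t} r * conv \<phi> 0 r)
        = (\<integral>\<^sup>+s. ennreal (indicator {0..t} r * (indicator {0..r} s * (\<psi> (r - s) * \<phi> s))) \<partial>lborel)"
      using ennreal_conv[of \<phi> 0 C r] \<phi>_bound \<phi>_nonneg by (cases "r \<in> {0..t}") simp_all
  qed
  \<comment> \<open>After the exchange, r runs over [s, t] for fixed s, and the kernel \<psi> (r -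
    s) integrates to 1 - S (t - s), the probability that an individual born at s is renewed again by
    time t.\<close>
  also have "\<dots> = (\<integral>\<^sup>+s. \<integral>\<^sup>+r. ennreal (indicator {0..t} r * (indicator {0..r} s * (\<psi> (r - s) * \<phi> s))) \<partial>lborel \<partial>lborel)"
    by (rule lborel_pair.Fubini') (simp add: indicator_def case_prod_unfold)
  also have "\<dots> = ?X"
  proof (intro nn_integral_cong)
    fix s
    show "(\<integral>\<^sup>+r. ennreal (indicator {0..t} r * (indicator {0..r} s * (\<psi> (r - s) * \<phi> s))) \<partial>lborel)
      = ennreal (indicator {0..t} s * \<phi> s * (1 - S (t - s)))"
    proof (cases "s \<in> {0..t}")
      case True
      have "(\<integral>\<^sup>+r. ennreal (indicator {0..t} r * (indicator {0..r} s * (\<psi> (r - s) * \<phi> s))) \<partial>lborel)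
        = (\<integral>\<^sup>+r. ennreal (\<phi> s) * (ennreal (\<psi> (r - s)) * indicator {s..t} r) \<partial>lborel)"
        using True \<phi>_nonneg by (intro nn_integral_cong) (auto simp: indicator_def ennreal_mult' mult.commute)
      also have "\<dots> = ennreal (\<phi> s) * (\<integral>\<^sup>+r. ennreal (\<psi> (r - s)) * indicator {s..t} r \<partial>lborel)"
        by (rule nn_integral_cmult) measurable
      also have "(\<integral>\<^sup>+r. ennreal (\<psi> (r - s)) * indicator {s..t} r \<partial>lborel)
        = ennreal (- S (t - s) - (- S (s - s)))"
        using True by (intro nn_integral_FTC_Icc) (auto intro!: derivative_eq_intros)
      finally show ?thesis
        using True \<phi>_nonneg S_le_1[of "t - s"] by (simp flip: ennreal_mult)
    next
      case False
      then have z: "(\<lambda>r. ennreal (indicator {0..t} r * (indicator {0..r} s * (\<psi> (r - s) * \<phi> s)))) = (\<lambda>_. 0)"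
        by (auto simp: indicator_def fun_eq_iff)
      show ?thesis unfolding z using False by simp
    qed
  qed
  also have "(\<integral>\<^sup>+s. ennreal (indicator {0..t} s * g f s) \<partial>lborel) + ?X
    = ?X + (\<integral>\<^sup>+s. ennreal (indicator {0..t} s * g f s) \<partial>lborel)"
    by (rule add.commute)
  finally have eq: "?X + (\<integral>\<^sup>+s. ennreal (indicator {0..t} s * (S (t - s) * \<phi> s)) \<partial>lborel)
    = ?X + (\<integral>\<^sup>+s. ennreal (indicator {0..t} s * g f s) \<partial>lborel)" .
  \<comment> \<open>Cancellation in \<open>ennreal\<close> requires \<open>?X\<close> to be finite;
    it is at most C * t.\<close>
  have "?X \<le> (\<integral>\<^sup>+s. ennreal C * indicator {0..t} s \<partial>lborel)"
  proof (intro nn_integral_mono)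
    fix s
    have "\<phi> s * (1 - S (t - s)) \<le> C * 1" if "s \<le> t"
      using \<phi>_bound[of s] \<phi>_nonneg[of s] S_le_1[of "t - s"] that by (intro mult_mono) (auto simp: abs_le_iff)
    then show "ennreal (indicator {0..t} s * \<phi> s * (1 - S (t - s))) \<le> ennreal C * indicator {0..t} s"
      by (auto simp: indicator_def intro!: ennreal_leI)
  qed
  also have "\<dots> < \<infinity>"
    using \<open>0 \<le> t\<close> by (simp add: nn_integral_cmult_indicator ennreal_mult_less_top)
  finally show ?thesis
    using eq by (auto simp: ennreal_add_left_cancel \<phi>_def)
qed

text \<open>The weight \<open>S a\<close> removes the denominator of \<open>U\<close>. Individuals
  that are never renewed give the integral of \<open>g f\<close> over [t, \<infinity>). For the
  others, integrating the kernel over all ages leaves the trace weighted by S (t - s), which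
  \<open>nn_integral_S_\<Phi>\<close> turns into the integral of \<open>g f\<close> over
  [0, t].\<close>

lemma nn_integral_S_U:
  assumes f: "f \<in> borel_measurable borel_nonneg" and bound: "\<And>x. 0 \<le> x \<Longrightarrow> \<bar>f x\<bar> \<le> C"
    and nonneg: "\<And>x. 0 \<le> x \<Longrightarrow> 0 \<le> f x" and "0 \<le> t"
  shows "(\<integral>\<^sup>+a. ennreal (indicator {0..} a * (S a * U f t a)) \<partial>lborel)
    = (\<integral>\<^sup>+a. ennreal (indicator {0..} a * (S a * f a)) \<partial>lborel)"
proof -
  define \<phi> where "\<phi> = \<Phi> f"
  have [measurable]: "\<phi> \<in> borel_measurable borel" and \<phi>_bound: "\<And>s. \<bar>\<phi> s\<bar> \<le> C" and \<phi>_nonneg: "\<And>s. 0 \<le> \<phi> s"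
    unfolding \<phi>_def using \<Phi>_measurable[OF f bound] \<Phi>_bound[OF f bound] \<Phi>_nonneg[OF f bound nonneg] by auto
  have [measurable]: "g f \<in> borel_measurable borel" by (rule g_measurable[OF f])
  have g0: "0 \<le> g f x" for x by (rule g_nonneg[OF nonneg])
  have "(\<integral>\<^sup>+a. ennreal (indicator {0..} a * (S a * U f t a)) \<partial>lborel)
    = (\<integral>\<^sup>+a. ennreal (indicator {0..} a * g f (a + t))
      + (\<integral>\<^sup>+s. ennreal (indicator {0..} a * (indicator {0..t} s * (\<psi> (a + t - s) * \<phi> s))) \<partial>lborel) \<partial>lborel)"
  proof (intro nn_integral_cong)
    fix a
    show "ennreal (indicator {0..} a * (S a * U f t a)) = ennreal (indicator {0..} a * g f (a + t))
      + (\<integral>\<^sup>+s. ennreal (indicator {0..} a * (indicator {0..t} s * (\<psi> (a + t - s) * \<phi> s))) \<partial>lborel)"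
    proof (cases "0 \<le> a")
      case True
      have "ennreal (S a * U f t a) = ennreal (g f (a + t)) + ennreal (conv \<phi> a t)"
        using g0[of "a + t"] conv_nonneg[of t \<phi> a] \<phi>_nonneg
        by (simp add: U_def \<phi>_def flip: ennreal_plus)
      then show ?thesis
        using True ennreal_conv[of \<phi> a C t] \<phi>_bound \<phi>_nonneg by simp
    qed simp
  qed
  also have "\<dots> = (\<integral>\<^sup>+a. ennreal (indicator {0..} a * g f (a + t)) \<partial>lborel)
    + (\<integral>\<^sup>+a. \<integral>\<^sup>+s. ennreal (indicator {0..} a * (indicator {0..t} s * (\<psi> (a + t - s) * \<phi> s))) \<partial>lborel \<partial>lborel)"
    by (rule nn_integral_add) measurable
  also have "(\<integral>\<^sup>+a. \<integral>\<^sup>+s. ennreal (indicator {0..} a * (indicator {0..t} s * (\<psi> (a + t - s) * \<phi> s))) \<partial>lborel \<partial>lborel)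
    = (\<integral>\<^sup>+s. \<integral>\<^sup>+a. ennreal (indicator {0..} a * (indicator {0..t} s * (\<psi> (a + t - s) * \<phi> s))) \<partial>lborel \<partial>lborel)"
    by (rule lborel_pair.Fubini') measurable
  also have "\<dots> = (\<integral>\<^sup>+s. ennreal (indicator {0..t} s * (S (t - s) * \<phi> s)) \<partial>lborel)"
  proof (intro nn_integral_cong)
    fix s
    show "(\<integral>\<^sup>+a. ennreal (indicator {0..} a * (indicator {0..t} s * (\<psi> (a + t - s) * \<phi> s))) \<partial>lborel)
      = ennreal (indicator {0..t} s * (S (t - s) * \<phi> s))"
    proof (cases "s \<in> {0..t}")
      case True
      have "(\<integral>\<^sup>+a. ennreal (indicator {0..} a * (indicator {0..t} s * (\<psi> (a + t - s) * \<phi> s))) \<partial>lborel)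
        = (\<integral>\<^sup>+a. ennreal (\<phi> s) * (ennreal (\<psi> (a + t - s)) * indicator {0..} a) \<partial>lborel)"
        using True \<phi>_nonneg by (intro nn_integral_cong) (auto simp: indicator_def ennreal_mult' mult.commute)
      also have "\<dots> = ennreal (\<phi> s) * (\<integral>\<^sup>+a. ennreal (\<psi> (a + t - s)) * indicator {0..} a \<partial>lborel)"
        by (rule nn_integral_cmult) measurable
      also have "(\<integral>\<^sup>+a. ennreal (\<psi> (a + t - s)) * indicator {0..} a \<partial>lborel) = ennreal (0 - (- S (0 + t - s)))"
      proof (rule nn_integral_FTC_atLeast)
        \<comment> \<open>The boundary term at infinity vanishes because \<open>S\<close> tends to
          0, a consequence of the lower bound on \<open>\<beta>\<close> beyond
          \<open>a_star\<close>.\<close>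
        have "LIM a at_top. (t - s) + a :> at_top"
          by (rule filterlim_tendsto_add_at_top[OF tendsto_const filterlim_ident])
        then have "((\<lambda>a. - S ((t - s) + a)) \<longlongrightarrow> - 0) at_top"
          by (intro tendsto_minus filterlim_compose[OF S_tendsto_0])
        then show "((\<lambda>a. - S (a + t - s)) \<longlongrightarrow> 0) at_top"
          by (simp add: algebra_simps)
      qed (auto intro!: derivative_eq_intros)
      finally show ?thesis
        using True \<phi>_nonneg by (simp add: mult.commute flip: ennreal_mult)
    next
      case False
      then show ?thesis by simp
    qed
  qed
  also have "\<dots> = (\<integral>\<^sup>+s. ennreal (indicator {0..t} s * g f s) \<partial>lborel)"
    unfolding \<phi>_def by (rule nn_integral_S_\<Phi>[OF f bound nonneg \<open>0 \<le> t\<close>])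
  also have "(\<integral>\<^sup>+a. ennreal (indicator {0..} a * g f (a + t)) \<partial>lborel)
    = (\<integral>\<^sup>+x. ennreal (indicator {t..} x * g f x) \<partial>lborel)"
    by (subst (2) nn_integral_real_affine[of _ 1 t])
      (auto intro!: nn_integral_cong simp: indicator_def add.commute)
  also have "(\<integral>\<^sup>+x. ennreal (indicator {t..} x * g f x) \<partial>lborel)
      + (\<integral>\<^sup>+s. ennreal (indicator {0..t} s * g f s) \<partial>lborel)
    = (\<integral>\<^sup>+x. ennreal (indicator {t..} x * g f x) + ennreal (indicator {0..t} x * g f x) \<partial>lborel)"
    by (rule nn_integral_add[symmetric]) measurable
  also have "\<dots> = (\<integral>\<^sup>+a. ennreal (indicator {0..} a * (S a * f a)) \<partial>lborel)"
  proof (rule nn_integral_cong_AE)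
    show "AE x in lborel. ennreal (indicator {t..} x * g f x) + ennreal (indicator {0..t} x * g f x)
        = ennreal (indicator {0..} x * (S x * f x))"
      using AE_lborel_singleton[of t]
      by eventually_elim (use \<open>0 \<le> t\<close> in \<open>auto simp: indicator_def g_def mult.commute\<close>)
  qed
  finally show ?thesis .
qed

lemma integral_U_invariant_measure:
  assumes f: "f \<in> bounded_measurable borel_nonneg" and nonneg: "\<And>x. 0 \<le> x \<Longrightarrow> 0 \<le> f x" and "0 \<le> t"
  shows "(\<integral>a. U f t a \<partial>invariant_measure \<beta>) = (\<integral>x. f x \<partial>invariant_measure \<beta>)"
proof -
  obtain C where C: "f \<in> borel_measurable borel_nonneg" "\<And>x. 0 \<le> x \<Longrightarrow> \<bar>f x\<bar> \<le> C"
    using f by (rule bounded_measurable_nonnegE) (rule that)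
  have U: "U f t \<in> borel_measurable borel_nonneg" "\<And>a. 0 \<le> U f t a"
    using U_measurable[OF C \<open>0 \<le> t\<close>] U_nonneg[OF C nonneg] by auto
  have space: "space (invariant_measure \<beta>) = {0..}"
    using sets_eq_imp_space_eq[OF sets_invariant_measure] by simp
  have eq: "(\<integral>x. h x \<partial>invariant_measure \<beta>) = enn2real (\<integral>\<^sup>+x. ennreal (h x) \<partial>invariant_measure \<beta>)"
    if "h \<in> borel_measurable borel_nonneg" "\<And>x. 0 \<le> x \<Longrightarrow> 0 \<le> h x" for h
    using that space
    by (intro integral_eq_nn_integral AE_I2) (auto simp: measurable_cong_sets[OF sets_invariant_measure refl])
  have "(\<integral>\<^sup>+a. ennreal (U f t a) \<partial>invariant_measure \<beta>) = (\<integral>\<^sup>+a. ennreal (f a) \<partial>invariant_measure \<beta>)"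
    by (simp add: nn_integral_invariant_measure[OF U] nn_integral_invariant_measure[OF C(1) nonneg]
      nn_integral_S_U[OF C nonneg \<open>0 \<le> t\<close>])
  then show ?thesis using eq[OF U] eq[OF C(1) nonneg] by simp
qed

end

section \<open>Integration against signed measures\<close>

context
  fixes M :: "'a measure" and \<mu> :: "'a set \<Rightarrow> real"
  assumes \<mu>: "\<mu> \<in> signed_measures M"
begin

lemma signed_parts:
  shows finite_pos_part: "finite_measure (pos_part M \<mu>)" and finite_neg_part: "finite_measure (neg_part M \<mu>)"
    and sets_pos_part: "sets (pos_part M \<mu>) = sets M" and sets_neg_part: "sets (neg_part M \<mu>) = sets M"
    and signed_eq_parts: "A \<in> sets M \<Longrightarrow> \<mu> A = measure (pos_part M \<mu>) A - measure (neg_part M \<mu>) A"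
  using jordan_decomposition_parts[OF \<mu>] unfolding jordan_decomposition_def by blast+

lemma space_parts: "space (pos_part M \<mu>) = space M" "space (neg_part M \<mu>) = space M"
  using sets_eq_imp_space_eq[OF sets_pos_part] sets_eq_imp_space_eq[OF sets_neg_part] by auto

lemma integrable_parts:
  assumes "f \<in> bounded_measurable M"
  shows "integrable (pos_part M \<mu>) f" "integrable (neg_part M \<mu>) f"
  using assms bounded_measurable_cong_sets[OF sets_pos_part] bounded_measurable_cong_sets[OF sets_neg_part]
  by (auto intro!: finite_measure.integrable_bounded_measurable finite_pos_part finite_neg_part)

lemma signed_integral_cong:
  assumes "\<And>x. x \<in> space M \<Longrightarrow> f x = h x"
  shows "signed_integral M \<mu> f = signed_integral M \<mu> h"
  unfolding signed_integral_def using assms space_parts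
  by (intro arg_cong2[where f = minus] Bochner_Integration.integral_cong) auto

lemma signed_integral_indicator:
  assumes "A \<in> sets M"
  shows "signed_integral M \<mu> (indicator A) = \<mu> A"
  using assms sets.sets_into_space[OF assms] signed_eq_parts[OF assms]
  by (simp add: signed_integral_def space_parts Int_absorb2)

lemma signed_integral_cmult: "signed_integral M \<mu> (\<lambda>x. k * f x) = k * signed_integral M \<mu> f"
  by (simp add: signed_integral_def right_diff_distrib)

lemma signed_integral_add:
  assumes "f \<in> bounded_measurable M" "h \<in> bounded_measurable M"
  shows "signed_integral M \<mu> (\<lambda>x. f x + h x) = signed_integral M \<mu> f + signed_integral M \<mu> h"
  using integrable_parts[OF assms(1)] integrable_parts[OF assms(2)] by (simp add: signed_integral_def)

lemma signed_integral_tendsto: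
  assumes F: "\<And>i. F i \<in> borel_measurable M" and f: "f \<in> borel_measurable M"
    and bound: "\<And>i x. x \<in> space M \<Longrightarrow> \<bar>F i x\<bar> \<le> K"
    and lim: "\<And>x. x \<in> space M \<Longrightarrow> (\<lambda>i. F i x) \<longlonglongrightarrow> f x"
  shows "(\<lambda>i. signed_integral M \<mu> (F i)) \<longlonglongrightarrow> signed_integral M \<mu> f"
proof -
  have "(\<lambda>i. \<integral>x. F i x \<partial>Q) \<longlonglongrightarrow> (\<integral>x. f x \<partial>Q)" if Q: "finite_measure Q" "sets Q = sets M" for Q
  proof (rule integral_dominated_convergence[where w = "\<lambda>_. K"])
    interpret finite_measure Q by (rule Q)
    show "integrable Q (\<lambda>_. K)" by simp
    have space: "space Q = space M" by (rule sets_eq_imp_space_eq[OF Q(2)])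
    show "f \<in> borel_measurable Q" "F i \<in> borel_measurable Q" for i
      using F f by (simp_all add: measurable_cong_sets[OF Q(2) refl])
    show "AE x in Q. (\<lambda>i. F i x) \<longlonglongrightarrow> f x"
      using lim space by (intro AE_I2) simp
    show "AE x in Q. norm (F i x) \<le> K" for i
      using bound space by (intro AE_I2) simp
  qed
  then show ?thesis
    unfolding signed_integral_def
    by (simp add: tendsto_diff finite_pos_part finite_neg_part sets_pos_part sets_neg_part)
qed

text \<open>Any set separating the two singular parts serves as \<open>D\<close>. The norm becomes a
  combination of values of \<mu>, to which the formula for the dual semigroup on indicators
  applies.\<close>

lemma tv_norm_Hahn:
  obtains D where "D \<in> sets M" "tv_norm M \<mu> = \<mu> D - \<mu> (space M - D)"
proof -
  let ?P = "pos_part M \<mu>" and ?N = "neg_part M \<mu>"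
  obtain D where D: "D \<in> sets M" "emeasure ?P (space M - D) = 0" "emeasure ?N D = 0"
    using jordan_decomposition_parts[OF \<mu>] unfolding jordan_decomposition_def by blast
  interpret P: finite_measure ?P by (rule finite_pos_part)
  interpret N: finite_measure ?N by (rule finite_neg_part)
  have "measure ?P (space M - D) = measure ?P (space M) - measure ?P D"
    "measure ?N (space M - D) = measure ?N (space M) - measure ?N D"
    using P.finite_measure_compl[of D] N.finite_measure_compl[of D] D(1)
    by (simp_all add: space_parts sets_pos_part sets_neg_part)
  moreover have "measure ?P (space M - D) = 0" "measure ?N D = 0"
    using D by (simp_all add: measure_def)
  ultimately show ?thesis
    using D(1) by (intro that[of D]) (simp_all add: tv_norm_def signed_eq_parts)
qed

text \<open>If the total mass vanishes, the positive and the negative part both have mass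
  \<open>tv_norm M \<mu> / 2\<close>.\<close>

lemma signed_integral_le_oscillation:
  assumes mass: "\<mu> (space M) = 0" and f: "f \<in> bounded_measurable M"
    and lo: "\<And>x. x \<in> space M \<Longrightarrow> lo \<le> f x" and hi: "\<And>x. x \<in> space M \<Longrightarrow> f x \<le> hi"
  shows "signed_integral M \<mu> f \<le> (hi - lo) * (tv_norm M \<mu> / 2)"
proof -
  let ?P = "pos_part M \<mu>" and ?N = "neg_part M \<mu>"
  interpret P: finite_measure ?P by (rule finite_pos_part)
  interpret N: finite_measure ?N by (rule finite_neg_part)
  have eq: "measure ?P (space M) = tv_norm M \<mu> / 2" "measure ?N (space M) = tv_norm M \<mu> / 2"
    using mass signed_eq_parts[of "space M"] by (auto simp: tv_norm_def)
  have "(\<integral>x. f x \<partial>?P) \<le> (\<integral>x. hi \<partial>?P)"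
    using integrable_parts[OF f] hi space_parts by (intro integral_mono) auto
  moreover have "(\<integral>x. lo \<partial>?N) \<le> (\<integral>x. f x \<partial>?N)"
    using integrable_parts[OF f] lo space_parts by (intro integral_mono) auto
  ultimately show ?thesis
    by (simp add: signed_integral_def space_parts eq algebra_simps)
qed

end

text \<open>The Jordan parts of a combination are not the combination of the Jordan parts, so
  linearity in the measure cannot be read off the definition; it is carried from indicators to all
  integrands by induction.\<close>

lemma signed_integral_diff_cmult:
  assumes \<mu>: "\<mu> \<in> signed_measures M" and \<nu>: "\<nu> \<in> signed_measures M" and f: "f \<in> bounded_measurable M"
  shows "signed_integral M (\<lambda>A. \<mu> A - k * \<nu> A) f = signed_integral M \<mu> f - k * signed_integral M \<nu> f"
  using f
proof (induction rule: bounded_measurable_induct)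
  note \<sigma> = signed_measures_diff_cmult[OF \<mu> \<nu>, of k]
  {
    case (cong u v)
    show ?case
      using cong(2) signed_integral_cong[OF \<mu> cong(1)] signed_integral_cong[OF \<nu> cong(1)]
        signed_integral_cong[OF \<sigma> cong(1)] by simp
  next
    case (indicator A)
    then show ?case by (simp add: signed_integral_indicator[OF \<mu>] signed_integral_indicator[OF \<nu>]
        signed_integral_indicator[OF \<sigma>])
  next
    case (cmult u c)
    then show ?case by (simp add: signed_integral_cmult[OF \<mu>] signed_integral_cmult[OF \<nu>]
        signed_integral_cmult[OF \<sigma>] right_diff_distrib mult.left_commute)
  next
    case (add u v)
    then show ?case by (simp add: signed_integral_add[OF \<mu>] signed_integral_add[OF \<nu>]
        signed_integral_add[OF \<sigma>] algebra_simps)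
  next
    case (lim U u K)
    have bound: "\<bar>U i x\<bar> \<le> K" if "x \<in> space M" for i x
      using lim.hyps(3,4)[OF that] by (simp add: abs_of_nonneg)
    note conv = signed_integral_tendsto[OF _ lim.hyps(1,2) bound lim.hyps(6)]
    have "(\<lambda>i. signed_integral M \<mu> (U i) - k * signed_integral M \<nu> (U i))
      \<longlonglongrightarrow> signed_integral M \<mu> u - k * signed_integral M \<nu> u"
      by (intro tendsto_intros conv \<mu> \<nu>)
    then show ?case
      using conv[OF \<sigma>] unfolding lim.IH by (intro LIMSEQ_unique)
  }
qed

lemma signed_integral_measure:
  assumes "finite_measure Q" "sets Q = sets M" "f \<in> bounded_measurable M"
  shows "signed_integral M (measure Q) f = (\<integral>x. f x \<partial>Q)"
proof -
  have "finite_measure (null_measure M)" by (intro finite_measureI) simp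
  then have "signed_integral M (measure Q) f = (\<integral>x. f x \<partial>Q) - (\<integral>x. f x \<partial>null_measure M)"
    using assms by (intro signed_integral_eq measure_in_signed_measures) auto
  also have "(\<integral>x. f x \<partial>null_measure M) = 0"
    by (intro integral_eq_zero_AE AE_I[where N = "space M"]) auto
  finally show ?thesis by simp
qed

section \<open>The dual semigroup\<close>

lemma C0_nonneg_bounded:
  assumes "f \<in> C0_nonneg"
  obtains C where "\<And>x. 0 \<le> x \<Longrightarrow> \<bar>f x\<bar> \<le> C"
proof -
  have cont: "continuous_on {0..} f" and lim: "(f \<longlongrightarrow> 0) at_top"
    using assms by (auto simp: C0_nonneg_def)
  obtain R where R: "\<And>x. R \<le> x \<Longrightarrow> \<bar>f x\<bar> < 1"
    using order_tendstoD(2)[OF tendsto_rabs[OF lim], of 1] by (auto simp: eventually_at_top_linorder)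
  have "bounded (f ` {0..R})"
    by (intro compact_imp_bounded compact_continuous_image continuous_on_subset[OF cont]) auto
  then obtain C where C: "\<forall>x\<in>{0..R}. \<bar>f x\<bar> \<le> C"
    by (auto simp: bounded_iff)
  show ?thesis
  proof (rule that[of "max 1 C"])
    fix x :: real assume "0 \<le> x"
    show "\<bar>f x\<bar> \<le> max 1 C"
    proof (cases "x \<le> R")
      case True
      then show ?thesis using bspec[OF C, of x] \<open>0 \<le> x\<close> by (simp add: le_max_iff_disj)
    next
      case False
      then show ?thesis using R[of x] by (simp add: le_max_iff_disj)
    qed
  qed
qed

lemma C0_nonneg_bounded_measurable:
  assumes "f \<in> C0_nonneg"
  shows "f \<in> bounded_measurable borel_nonneg"
proof -
  obtain C where "\<And>x. 0 \<le> x \<Longrightarrow> \<bar>f x\<bar> \<le> C"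
    using C0_nonneg_bounded[OF assms] by metis
  moreover have "f \<in> borel_measurable borel_nonneg"
    using assms borel_measurable_continuous_on_restrict by (auto simp: C0_nonneg_def borel_nonneg_def)
  ultimately show ?thesis by (intro bounded_measurableI) auto
qed

text \<open>The indicator of \<open>[0, b]\<close> is the limit of the piecewise linear functions \<open>h n\<close>, which vanish
  beyond \<open>b + 1\<close>.\<close>

lemma signed_measures_eqI_C0:
  assumes \<mu>: "\<mu> \<in> signed_measures borel_nonneg" and \<nu>: "\<nu> \<in> signed_measures borel_nonneg"
    and eq: "\<And>f. f \<in> C0_nonneg \<Longrightarrow> signed_integral borel_nonneg \<mu> f = signed_integral borel_nonneg \<nu> f"
  shows "\<mu> = \<nu>"
proof -
  have sets_iff: "A \<in> sets borel_nonneg \<longleftrightarrow> (\<exists>B\<in>sets borel. A = {0..} \<inter> B)" for A :: "real set"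
    by (auto simp: borel_nonneg_def sets_restrict_space)
  have atMost: "\<mu> ({0..} \<inter> {..b}) = \<nu> ({0..} \<inter> {..b})" for b
  proof -
    \<comment> \<open>With \<open>Suc n\<close> the slope is at least 1 for every n, so that already
      \<open>h 0\<close> vanishes beyond b + 1 and every \<open>h n\<close> lies in
      \<open>C0_nonneg\<close>.\<close>
    define h where "h n x = max 0 (min 1 (1 - real (Suc n) * (x - b)))" for n x
    have h_cont: "continuous_on A (h n)" for n A
      unfolding h_def by (intro continuous_intros)
    have h_C0: "h n \<in> C0_nonneg" for n
    proof -
      have "h n x = 0" if "b + 1 \<le> x" for x
      proof -
        have "1 * 1 \<le> real (Suc n) * (x - b)" using that by (intro mult_mono) auto
        then show ?thesis by (simp add: h_def)
      qed
      then have "(h n \<longlongrightarrow> 0) at_top"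
        by (intro tendsto_eventually eventually_at_top_linorderI[of "b + 1"])
      then show ?thesis using h_cont by (simp add: C0_nonneg_def)
    qed
    have h_bound: "\<bar>h n x\<bar> \<le> 1" for n x by (simp add: h_def)
    have h_lim: "(\<lambda>n. h n x) \<longlonglongrightarrow> indicator ({0..} \<inter> {..b}) x" if "0 \<le> x" for x
    proof (cases "x \<le> b")
      case True
      then have "real (Suc n) * (x - b) \<le> 0" for n by (intro mult_nonneg_nonpos) auto
      then have "h n x = 1" for n by (simp add: h_def)
      then show ?thesis using True that by simp
    next
      case False
      then obtain N where N: "1 < real N * (x - b)" using reals_Archimedean3[of "x - b"] by auto
      have "h n x = 0" if "N \<le> n" for n
      proof -
        have "real N * (x - b) \<le> real (Suc n) * (x - b)"
          using False that by (intro mult_right_mono) auto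
        then show ?thesis using N by (simp add: h_def)
      qed
      then have "(\<lambda>n. h n x) \<longlonglongrightarrow> 0"
        by (intro tendsto_eventually eventually_sequentiallyI[of N])
      then show ?thesis using False by simp
    qed
    have set: "{0..} \<inter> {..b} \<in> sets borel_nonneg" unfolding sets_iff by auto
    have conv: "(\<lambda>n. signed_integral borel_nonneg \<rho> (h n)) \<longlonglongrightarrow> \<rho> ({0..} \<inter> {..b})"
      if \<rho>: "\<rho> \<in> signed_measures borel_nonneg" for \<rho>
      unfolding signed_integral_indicator[OF \<rho> set, symmetric]
      using bounded_measurableD(1)[OF C0_nonneg_bounded_measurable[OF h_C0]] h_bound h_lim set
      by (intro signed_integral_tendsto[OF \<rho>, where K = 1]) auto
    show ?thesis
      using conv[OF \<mu>] conv[OF \<nu>] eq[OF h_C0] LIMSEQ_unique by simp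
  qed
  \<comment> \<open>Needed for complements below. The constant 1 does not tend to 0 at infinity, so
    the total mass is recovered as the limit along the intervals [0, n].\<close>
  have whole: "\<mu> {0..} = \<nu> {0..}"
  proof -
    have "(\<lambda>n. \<rho> ({0..} \<inter> {..real n})) \<longlonglongrightarrow> \<rho> {0..}"
      if \<rho>: "\<rho> \<in> signed_measures borel_nonneg" for \<rho>
    proof -
      have set: "{0..} \<inter> {..real n} \<in> sets borel_nonneg" "{0..} \<in> sets borel_nonneg" for n
        unfolding sets_iff by auto
      have "(\<lambda>n. signed_integral borel_nonneg \<rho> (indicator ({0..} \<inter> {..real n})))
        \<longlonglongrightarrow> signed_integral borel_nonneg \<rho> (indicator {0..})"
      proof (rule signed_integral_tendsto[OF \<rho>, where K = 1])
        fix x :: real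
        obtain N where N: "x \<le> real N" using real_arch_simple by blast
        show "(\<lambda>n. indicator ({0..} \<inter> {..real n}) x) \<longlonglongrightarrow> (indicator {0..} x :: real)"
          using N by (intro tendsto_eventually eventually_sequentiallyI[of N]) (auto simp: indicator_def)
      qed (use set in \<open>auto simp: indicator_def intro!: borel_measurable_indicator\<close>)
      then show ?thesis
        unfolding signed_integral_indicator[OF \<rho> set(1)] signed_integral_indicator[OF \<rho> set(2)] .
    qed
    from this[OF \<mu>] this[OF \<nu>] show ?thesis unfolding atMost by (rule LIMSEQ_unique)
  qed
  have stable: "Int_stable (range (\<lambda>b::real. {..b}))" and subset_Pow: "range (\<lambda>b::real. {..b}) \<subseteq> Pow UNIV"
    by (auto simp: Int_stable_def)
  have "\<mu> ({0..} \<inter> B) = \<nu> ({0..} \<inter> B)" if "B \<in> sigma_sets UNIV (range (\<lambda>b::real. {..b}))" for B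
    using stable subset_Pow that
  proof (induction rule: sigma_sets_induct_disjoint)
    case (basic A)
    then show ?case using atMost by auto
  next
    case empty
    then show ?case using signed_measures_empty[OF \<mu>] signed_measures_empty[OF \<nu>] by simp
  next
    case (compl A)
    have set: "{0..} \<inter> A \<in> sets borel_nonneg" "{0..} \<in> sets borel_nonneg"
      using compl sets.top[of borel_nonneg] by (auto simp: sets_iff borel_eq_atMost)
    have "{0..} \<inter> (UNIV - A) = {0..} - {0..} \<inter> A" by auto
    then show ?case
      using signed_measures_Diff[OF \<mu> set(2,1)] signed_measures_Diff[OF \<nu> set(2,1)] compl whole by simp
  next
    case (union A)
    have set: "range (\<lambda>i. {0..} \<inter> A i) \<subseteq> sets borel_nonneg"
    proof -
      have "A i \<in> sets borel" for i using union(2) by (auto simp: borel_eq_atMost)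
      then show ?thesis unfolding image_subset_iff sets_iff by blast
    qed
    have disj: "disjoint_family (\<lambda>i. {0..} \<inter> A i)"
      using union by (auto simp: disjoint_family_on_def)
    have sums_\<mu>: "(\<lambda>i. \<mu> ({0..} \<inter> A i)) sums \<mu> (\<Union>i. {0..} \<inter> A i)"
      by (rule signed_measures_sums[OF \<mu> set disj])
    have sums_\<nu>: "(\<lambda>i. \<nu> ({0..} \<inter> A i)) sums \<nu> (\<Union>i. {0..} \<inter> A i)"
      by (rule signed_measures_sums[OF \<nu> set disj])
    have "\<mu> (\<Union>i. {0..} \<inter> A i) = \<nu> (\<Union>i. {0..} \<inter> A i)"
      using sums_\<mu> unfolding union(3) by (rule sums_unique2[OF _ sums_\<nu>])
    then show ?case by (simp only: Int_UN_distrib)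
  qed
  then have "\<mu> A = \<nu> A" if "A \<in> sets borel_nonneg" for A
    using that unfolding sets_iff by (auto simp: borel_eq_atMost)
  moreover have "\<mu> A = \<nu> A" if "A \<notin> sets borel_nonneg" for A
    using signed_measures_outside[OF \<mu> that] signed_measures_outside[OF \<nu> that] by simp
  ultimately show ?thesis by blast
qed

context renewal
begin

text \<open>Both Jordan parts are transported by \<open>dual_measure_exists\<close>; the difference
  of the results satisfies the duality formula for all bounded measurable functions. On
  \<open>C0_nonneg\<close>, \<open>U\<close> is the renewal semigroup, and a signed measure is
  determined by its integrals there, so this difference is what the \<open>THE\<close>
  denotes.\<close>

lemma dual_semigroup:
  assumes \<mu>: "\<mu> \<in> signed_measures borel_nonneg" and t: "0 \<le> t"
  shows dual_semigroup_signed: "dual_semigroup \<beta> \<mu> t \<in> signed_measures borel_nonneg"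
    and dual_semigroup_apply: "A \<in> sets borel_nonneg \<Longrightarrow>
      dual_semigroup \<beta> \<mu> t A = signed_integral borel_nonneg \<mu> (U (indicator A) t)"
proof -
  obtain P where P: "finite_measure P" "sets P = sets borel_nonneg"
    "\<And>f. f \<in> bounded_measurable borel_nonneg \<Longrightarrow> (\<integral>x. f x \<partial>P) = (\<integral>a. U f t a \<partial>pos_part borel_nonneg \<mu>)"
    using dual_measure_exists[OF finite_pos_part[OF \<mu>] sets_pos_part[OF \<mu>] t] by blast
  obtain N where N: "finite_measure N" "sets N = sets borel_nonneg"
    "\<And>f. f \<in> bounded_measurable borel_nonneg \<Longrightarrow> (\<integral>x. f x \<partial>N) = (\<integral>a. U f t a \<partial>neg_part borel_nonneg \<mu>)"
    using dual_measure_exists[OF finite_neg_part[OF \<mu>] sets_neg_part[OF \<mu>] t] by blast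
  define \<nu> where "\<nu> A = measure P A - 1 * measure N A" for A
  have \<nu>: "\<nu> \<in> signed_measures borel_nonneg"
    unfolding \<nu>_def[abs_def]
    by (intro signed_measures_diff_cmult measure_in_signed_measures P N)
  have \<nu>_integral: "signed_integral borel_nonneg \<nu> f = signed_integral borel_nonneg \<mu> (U f t)"
    if f: "f \<in> bounded_measurable borel_nonneg" for f
  proof -
    have "signed_integral borel_nonneg \<nu> f = (\<integral>x. f x \<partial>P) - (\<integral>x. f x \<partial>N)"
      using f P(1,2) N(1,2) by (intro signed_integral_eq[OF \<nu>]) (auto simp: \<nu>_def)
    then show ?thesis using P(3)[OF f] N(3)[OF f] by (simp add: signed_integral_def)
  qed
  have M_eq: "signed_integral borel_nonneg \<mu> (renewal_semigroup \<beta> t f) = signed_integral borel_nonneg \<mu> (U f t)"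
    if f: "f \<in> C0_nonneg" for f
  proof (rule signed_integral_cong[OF \<mu>])
    fix a assume "a \<in> space borel_nonneg"
    obtain C where "\<And>x. 0 \<le> x \<Longrightarrow> \<bar>f x\<bar> \<le> C" using C0_nonneg_bounded[OF f] by metis
    then show "renewal_semigroup \<beta> t f a = U f t a"
      using f t \<open>a \<in> _\<close> by (intro renewal_semigroup_eq_U) (auto simp: C0_nonneg_def)
  qed
  have "dual_semigroup \<beta> \<mu> t = \<nu>"
    unfolding dual_semigroup_def
  proof (rule the_equality)
    show "\<nu> \<in> signed_measures borel_nonneg \<and> (\<forall>f\<in>C0_nonneg. signed_integral borel_nonneg \<nu> f
        = signed_integral borel_nonneg \<mu> (renewal_semigroup \<beta> t f))"
      using \<nu> \<nu>_integral M_eq C0_nonneg_bounded_measurable by simp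
    fix \<rho>
    assume "\<rho> \<in> signed_measures borel_nonneg \<and> (\<forall>f\<in>C0_nonneg. signed_integral borel_nonneg \<rho> f
        = signed_integral borel_nonneg \<mu> (renewal_semigroup \<beta> t f))"
    then show "\<rho> = \<nu>"
      using \<nu> \<nu>_integral M_eq C0_nonneg_bounded_measurable by (intro signed_measures_eqI_C0) simp_all
  qed
  then show "dual_semigroup \<beta> \<mu> t \<in> signed_measures borel_nonneg"
    "A \<in> sets borel_nonneg \<Longrightarrow> dual_semigroup \<beta> \<mu> t A = signed_integral borel_nonneg \<mu> (U (indicator A) t)"
    using \<nu> \<nu>_integral[of "indicator A"] signed_integral_indicator[OF \<nu>, of A]
    by (simp_all add: bounded_measurable_indicator)
qed

end

section \<open>Contraction over full periods\<close>

context coercive_renewal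
begin

lemma tv_norm_dual_semigroup_le:
  assumes \<mu>: "\<mu> \<in> signed_measures borel_nonneg" and "0 < \<eta>" and "0 \<le> s"
    and k: "k = signed_integral borel_nonneg \<mu> (\<lambda>_. 1)" and t: "t = real n * (a_star + \<eta>) + s"
  shows "tv_norm borel_nonneg (\<lambda>A. dual_semigroup \<beta> \<mu> t A - k * measure (invariant_measure \<beta>) A)
    \<le> (1 - \<eta> * \<beta>_min * exp (- \<beta>_max * (a_star + \<eta>))) ^ n
      * tv_norm borel_nonneg (\<lambda>A. \<mu> A - k * measure (invariant_measure \<beta>) A)"
proof -
  let ?\<pi> = "invariant_measure \<beta>"
  define \<sigma> where "\<sigma> A = \<mu> A - k * measure ?\<pi> A" for A
  define \<nu> where "\<nu> A = dual_semigroup \<beta> \<mu> t A - k * measure ?\<pi> A" for A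
  have t0: "0 \<le> t" using assms(2,3) a_star_pos by (simp add: t)
  have \<pi>: "measure ?\<pi> \<in> signed_measures borel_nonneg"
    by (rule measure_in_signed_measures[OF finite_invariant_measure sets_invariant_measure])
  have \<sigma>: "\<sigma> \<in> signed_measures borel_nonneg"
    unfolding \<sigma>_def[abs_def] by (rule signed_measures_diff_cmult[OF \<mu> \<pi>])
  have \<nu>: "\<nu> \<in> signed_measures borel_nonneg"
    unfolding \<nu>_def[abs_def] by (rule signed_measures_diff_cmult[OF dual_semigroup_signed[OF \<mu> t0] \<pi>])
  have ind: "indicator A \<in> bounded_measurable borel_nonneg" if "A \<in> sets borel_nonneg" for A
    using that by (rule bounded_measurable_indicator)
  have U_ind: "U (indicator A) t \<in> bounded_measurable borel_nonneg" if "A \<in> sets borel_nonneg" for A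
    using that t0 by (intro U_bounded_measurable[where C = 1] borel_measurable_indicator) auto
  have \<nu>_eq: "\<nu> A = signed_integral borel_nonneg \<sigma> (U (indicator A) t)"
    if A: "A \<in> sets borel_nonneg" for A
  proof -
    \<comment> \<open>Invariance rewrites the subtracted mass of \<open>A\<close> as an integral of
      the same function that represents the dual semigroup, so the two terms combine into one
      integral against \<sigma>.\<close>
    have "(\<integral>a. U (indicator A) t a \<partial>?\<pi>) = (\<integral>a. indicator A a \<partial>?\<pi>)"
      by (intro integral_U_invariant_measure ind A t0) auto
    also have "\<dots> = measure ?\<pi> A"
      using sets.sets_into_space[OF A] sets_eq_imp_space_eq[OF sets_invariant_measure]
      by (simp add: Int_absorb2)
    finally show ?thesis
      unfolding \<sigma>_def[abs_def] \<nu>_def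
      by (simp add: signed_integral_diff_cmult[OF \<mu> \<pi> U_ind[OF A]] dual_semigroup_apply[OF \<mu> t0 A]
          signed_integral_measure[OF finite_invariant_measure sets_invariant_measure U_ind[OF A]])
  qed
  have X: "{0..} \<in> sets borel_nonneg"
    using sets.top[of borel_nonneg] by simp
  have one: "signed_integral borel_nonneg \<rho> (\<lambda>_. 1) = \<rho> {0..}"
    if \<rho>: "\<rho> \<in> signed_measures borel_nonneg" for \<rho>
    using signed_integral_cong[OF \<rho>, of "\<lambda>_. 1" "indicator {0..}"] signed_integral_indicator[OF \<rho> X]
    by simp
  have \<sigma>_mass: "\<sigma> (space borel_nonneg) = 0"
    using emeasure_invariant_measure_space sets_eq_imp_space_eq[OF sets_invariant_measure] one[OF \<mu>]
    by (simp add: \<sigma>_def k measure_def)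
  have \<nu>_mass: "\<nu> (space borel_nonneg) = 0"
  proof -
    \<comment> \<open>\<open>U\<close> fixes the constant 1, hence mass 0 passes from \<sigma> to
      \<nu>.\<close>
    have "U (indicator {0..}) = U (\<lambda>_. 1)" by (rule U_cong) simp
    then have "\<nu> {0..} = signed_integral borel_nonneg \<sigma> (\<lambda>_. 1)"
      unfolding \<nu>_eq[OF X] using t0 by (intro signed_integral_cong[OF \<sigma>]) (simp add: U_const)
    then show ?thesis using one[OF \<sigma>] \<sigma>_mass by simp
  qed
  obtain D where D: "D \<in> sets borel_nonneg" "tv_norm borel_nonneg \<nu> = \<nu> D - \<nu> (space borel_nonneg - D)"
    using tv_norm_Hahn[OF \<nu>] .
  \<comment> \<open>Since the total mass is 0, the complement of \<open>D\<close> carries - \<nu> D.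
    The factor 2 compensates the 1/2 in the oscillation bound, so the contraction has no
    prefactor.\<close>
  have "tv_norm borel_nonneg \<nu> = 2 * \<nu> D"
    using D(2) \<nu>_mass signed_measures_Diff[OF \<nu> sets.top D(1) sets.sets_into_space[OF D(1)]] by simp
  moreover obtain lo hi where osc: "hi - lo = (1 - \<eta> * \<beta>_min * exp (- \<beta>_max * (a_star + \<eta>))) ^ n"
    "\<And>a. 0 \<le> a \<Longrightarrow> lo \<le> U (indicator D) t a" "\<And>a. 0 \<le> a \<Longrightarrow> U (indicator D) t a \<le> hi"
    using U_oscillation_iterate[OF ind[OF D(1)] _ _ \<open>0 < \<eta>\<close> \<open>0 \<le> s\<close>, of n]
    unfolding t by (auto simp: indicator_le_1)
  moreover have "\<nu> D \<le> (hi - lo) * (tv_norm borel_nonneg \<sigma> / 2)"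
    unfolding \<nu>_eq[OF D(1)]
    by (rule signed_integral_le_oscillation[OF \<sigma> \<sigma>_mass U_ind[OF D(1)]]) (simp_all add: osc)
  ultimately show ?thesis
    unfolding \<sigma>_def[symmetric] \<nu>_def[symmetric] by simp
qed

end

section \<open>From the half-line to the whole line, and from periods to an exponential\<close>

text \<open>All ages in the renewal equation are nonnegative, so \<open>\<beta>\<close> may be
  replaced by its extension to the line.\<close>

lemma renewal_semigroup_cong:
  assumes "\<And>x. 0 \<le> x \<Longrightarrow> \<beta> x = \<gamma> x"
  shows "renewal_semigroup \<beta> = renewal_semigroup \<gamma>"
proof -
  have inner: "integral {0..\<tau>} (\<lambda>u. \<beta> (a + u)) = integral {0..\<tau>} (\<lambda>u. \<gamma> (a + u))" if "0 \<le> a" for a \<tau>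
    using that assms by (intro Henstock_Kurzweil_Integration.integral_cong) auto
  have "integral {0..t} (\<lambda>\<tau>. exp (- integral {0..\<tau>} (\<lambda>u. \<beta> (a + u))) * \<beta> (a + \<tau>) * f (t - \<tau>, 0))
    = integral {0..t} (\<lambda>\<tau>. exp (- integral {0..\<tau>} (\<lambda>u. \<gamma> (a + u))) * \<gamma> (a + \<tau>) * f (t - \<tau>, 0))"
    if "0 \<le> a" for a t :: real and f :: "real \<times> real \<Rightarrow> real"
    using that assms by (intro Henstock_Kurzweil_Integration.integral_cong) (simp add: inner)
  then have "renewal_solution \<beta> = renewal_solution \<gamma>"
    unfolding renewal_solution_def[abs_def] using inner by (intro ext) simp
  then show ?thesis
    unfolding renewal_semigroup_def[abs_def] by simp
qed

lemma invariant_measure_cong: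
  assumes "\<And>x. 0 \<le> x \<Longrightarrow> \<beta> x = \<gamma> x"
  shows "invariant_measure \<beta> = invariant_measure \<gamma>"
proof -
  have "integral {0..a} \<beta> = integral {0..a} \<gamma>" for a
    using assms by (intro Henstock_Kurzweil_Integration.integral_cong) auto
  then show ?thesis
    by (simp add: invariant_measure_def stationary_constant_def)
qed

text \<open>The floor is at least t / T - 1, and ln q \<le> 0 reverses the inequality; the lost unit
  becomes the shift of t by T.\<close>

lemma power_floor_le_exp:
  fixes q T t :: real
  assumes "0 < q" "q \<le> 1" "0 < T" "0 \<le> t"
  shows "q ^ nat \<lfloor>t / T\<rfloor> \<le> exp (- (- ln q / T) * (t - T))"
proof -
  have n: "t / T - 1 \<le> real (nat \<lfloor>t / T\<rfloor>)"
    using assms by (simp add: of_nat_nat)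
  have "q ^ nat \<lfloor>t / T\<rfloor> = exp (real (nat \<lfloor>t / T\<rfloor>) * ln q)"
    by (subst exp_of_nat_mult) (simp add: assms)
  also have "\<dots> \<le> exp ((t / T - 1) * ln q)"
    using n assms by (simp add: mult_right_mono_neg)
  also have "(t / T - 1) * ln q = - (- ln q / T) * (t - T)"
    using assms by (simp add: field_simps)
  finally show ?thesis .
qed

theorem corollary13:
  fixes \<beta> :: "real \<Rightarrow> real" and a_star \<beta>_min \<beta>_max \<eta> t0 c \<alpha> :: real
    and \<mu> :: "real set \<Rightarrow> real"
  assumes "continuous_on {0..} \<beta>"
    and "a_star > 0" and "\<beta>_min > 0" and "\<beta>_max > 0"
    and "\<And>a. a \<ge> 0 \<Longrightarrow> \<beta>_min * indicator {a_star..} a \<le> \<beta> a"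
    and "\<And>a. a \<ge> 0 \<Longrightarrow> \<beta> a \<le> \<beta>_max"
    and "\<mu> \<in> signed_measures borel_nonneg"
    and "\<eta> > 0"
    and "t0 = a_star + \<eta>"
    and "c = \<eta> * \<beta>_min * exp (- \<beta>_max * (a_star + \<eta>))"
    and "\<alpha> = - ln (1 - c) / t0"
  shows "\<forall>t\<ge>0.
    tv_norm borel_nonneg (\<lambda>A. dual_semigroup \<beta> \<mu> t A
        - signed_integral borel_nonneg \<mu> (\<lambda>_. 1) * measure (invariant_measure \<beta>) A)
    \<le> exp (- \<alpha> * (t - t0)) *
      tv_norm borel_nonneg (\<lambda>A. \<mu> A
        - signed_integral borel_nonneg \<mu> (\<lambda>_. 1) * measure (invariant_measure \<beta>) A)"
proof (intro allI impI)
  fix t :: real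
  assume "0 \<le> t"
  \<comment> \<open>Constant extension to the left: it stays continuous and within the same bounds,
    as the locale demands on the whole line.\<close>
  define \<gamma> where "\<gamma> x = \<beta> (max 0 x)" for x
  have \<gamma>: "\<beta> x = \<gamma> x" if "0 \<le> x" for x
    using that by (simp add: \<gamma>_def max_def)
  interpret coercive_renewal \<gamma> \<beta>_max a_star \<beta>_min
  proof
    show "continuous_on UNIV \<gamma>"
      unfolding \<gamma>_def by (intro continuous_on_compose2[OF assms(1)] continuous_intros) auto
    show "0 \<le> \<gamma> a" for a
    proof -
      have "0 \<le> \<beta>_min * indicator {a_star..} (max 0 a)" using assms(3) by simp
      also have "\<dots> \<le> \<gamma> a" unfolding \<gamma>_def by (rule assms(5)) simp
      finally show ?thesis .
    qed
    show "\<gamma> a \<le> \<beta>_max" for a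
      using assms(6)[of "max 0 a"] by (simp add: \<gamma>_def)
    show "\<beta>_min \<le> \<gamma> a" if "a_star \<le> a" for a
      using assms(2) assms(5)[of a] that by (simp add: \<gamma>_def max_def)
  qed (use assms in auto)
  have M_eq: "renewal_semigroup \<beta> = renewal_semigroup \<gamma>" and \<pi>_eq: "invariant_measure \<beta> = invariant_measure \<gamma>"
    by (rule renewal_semigroup_cong invariant_measure_cong, rule \<gamma>, assumption)+
  define n where "n = nat \<lfloor>t / t0\<rfloor>"
  have "0 < t0" using assms by simp
  have c: "0 < c" "c < 1" using minorisation_constant_bounds[OF assms(8)] assms(10) by auto
  have n: "real n * t0 \<le> t"
  proof -
    have "real n \<le> t / t0" using \<open>0 \<le> t\<close> \<open>0 < t0\<close> by (simp add: n_def)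
    then show ?thesis using \<open>0 < t0\<close> by (simp add: pos_le_divide_eq)
  qed
  let ?k = "signed_integral borel_nonneg \<mu> (\<lambda>_. 1)"
  let ?V = "tv_norm borel_nonneg (\<lambda>A. \<mu> A - ?k * measure (invariant_measure \<gamma>) A)"
  \<comment> \<open>The time is split into n full periods and the remainder t - n * t0, which is
    nonnegative because n is the floor of t / t0.\<close>
  have "tv_norm borel_nonneg (\<lambda>A. dual_semigroup \<gamma> \<mu> t A - ?k * measure (invariant_measure \<gamma>) A)
      \<le> (1 - c) ^ n * ?V"
    unfolding assms(10)
    by (rule tv_norm_dual_semigroup_le[OF assms(7,8) _ refl, of "t - real n * t0"]) (use n assms(9) in auto)
  also have "\<dots> \<le> exp (- \<alpha> * (t - t0)) * ?V"
  proof (rule mult_right_mono)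
    show "(1 - c) ^ n \<le> exp (- \<alpha> * (t - t0))"
      unfolding n_def assms(11) using c \<open>0 < t0\<close> \<open>0 \<le> t\<close> by (intro power_floor_le_exp) auto
    show "0 \<le> ?V" by (simp add: tv_norm_def)
  qed
  finally show "tv_norm borel_nonneg (\<lambda>A. dual_semigroup \<beta> \<mu> t A - ?k * measure (invariant_measure \<beta>) A)
      \<le> exp (- \<alpha> * (t - t0)) * tv_norm borel_nonneg (\<lambda>A. \<mu> A - ?k * measure (invariant_measure \<beta>) A)"
    unfolding dual_semigroup_def M_eq \<pi>_eq .
qed

end
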